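(* Let $p$ be a prime and $G=\mathrm{GL}_2(\mathbb{Q}_p)$. The $G$-equivariant map $$\mathrm{ind}_{IZ}^G\,1\to\mathrm{ind}_{KZ}^G\,(V_{2p-2}/V_{2p-2}^* ),\qquad [[\mathrm{id},1]]\mapsto[\mathrm{id},\,Y^{2p-2}-X^{p-1}Y^{p-1}]$$ induces (via the projections onto the two summands of $\mathrm{ind}_{KZ}^G(V_{2p-2}/V_{2p-2}^* )=\mathrm{ind}_{KZ}^G V_{p-1}\oplus\mathrm{ind}_{KZ}^G V_0$) isomorphisms of $G$-representations $$\frac{\mathrm{ind}_{IZ}^G\,1}{(T_{1,2}T_{1,0})}\simeq\mathrm{ind}_{KZ}^G V_0\qquad\text{and}\qquad\frac{\mathrm{ind}_{IZ}^G\,1}{(1+T_{1,2}T_{1,0})}\simeq\mathrm{ind}_{KZ}^G V_{p-1}.$$ Moreover, under the first isomorphism the operator induced by $T_{-1,0}+T_{1,0}$ on the left corresponds to the operator $T$ on the right, and under the second isomorphism the operator induced by $T_{-1,0}$ on the left corresponds to the operator $T$ on the right.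
   Context: Groups. $G=\mathrm{GL}_2(\mathbb{Q}_p)$, $Z$ is its center, $K=\mathrm{GL}_2(\mathbb{Z}_p)$, and $I\subset K$ is the Iwahori subgroup of matrices that are upper triangular mod $p$. Put $\alpha=\begin{pmatrix} 1 & 0 \\ 0 & p \end{pmatrix}$, $\beta=\begin{pmatrix} 0 & 1 \\ p & 0 \end{pmatrix}$. $I_1\subset\mathbb{Z}_p$ is the set of the $p$ Teichmüller representatives $\{[x]:x\in\mathbb{F}_p\}$ of $\mathbb{Z}_p/p$. Weights. $V_r$ ($r\ge0$) is the space of homogeneous polynomials of degree $r$ in $X,Y$ over $\mathbb{F}_p$ with $K$ acting through reduction mod $p$ by $\begin{pmatrix} a & b \\ c & d \end{pmatrix}P(X,Y)=P(aX+cY,bX+dY)$, extended to $KZ$ by letting the scalar matrix $p$ act trivially. $V_r^*\subset V_r$ is the subrepresentation of polynomials divisible by $X^pY-XY^p$. The representation $V_{2p-2}/V_{2p-2}^*$ is the direct sum of a copy of $V_{p-1}$, the subrepresentation generated by $X^{2p-2}$ (with $X^{p-1}\in V_{p-1}$ corresponding to $X^{2p-2}$), and a copy of $V_0$, spanned by $X^{2p-2}-X^{p-1}Y^{p-1}+Y^{2p-2}$ (corresponding to $1\in V_0$). Compact induction (over $\mathbb{F}_p$). For $H=KZ$ or $IZ$ and a representation $\sigma$ of $H$, $\mathrm{ind}_H^G\sigma$ is the space of functions $f:G\to\sigma$ with $f(hx)=\sigma(h)f(x)$ for $h\in H$, compactly supported modulo $Z$, with $G$ acting by right translation. For $g\in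 G$, $v\in\sigma$, the function supported on $Hg^{-1}$ and sending $x\in Hg^{-1}$ to $\sigma(xg)v$ is denoted $[g,v]$ when $H=KZ$ and $[[g,v]]$ when $H=IZ$; thus $g'[[g,v]]=[[g'g,v]]$. The trivial character is denoted $1$. Hecke operators. $T$ is the $G$-endomorphism of $\mathrm{ind}_{KZ}^G V_r$ (here $r=0$ or $p-1$) determined by $$T[\mathrm{id},P(X,Y)]=\sum_{\lambda\in I_1}\left[\begin{pmatrix} p & \lambda \\ 0 & 1 \end{pmatrix},P(X,-\lambda X+pY)\right]+\left[\alpha,P(pX,Y)\right].$$ $T_{1,0}$, $T_{1,2}$, $T_{-1,0}$ are the $G$-endomorphisms of $\mathrm{ind}_{IZ}^G 1$ determined by $$T_{1,0}[[\mathrm{id},1]]=[[\beta,1]],\quad T_{1,2}[[\mathrm{id},1]]=\sum_{\lambda\in I_1}\left[\left[\begin{pmatrix} 1 & 0 \\ p\lambda & p \end{pmatrix},1\right]\right],\quad T_{-1,0}[[\mathrm{id},1]]=\sum_{\lambda\in I_1}\left[\left[\begin{pmatrix} p & \lambda \\ 0 & 1 \end{pmatrix},1\right]\right].$$ For an endomorphism $S$, $(S)$ denotes its image. Products of operators are compositions. *)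

theory Defs
  imports
    "HOL-Analysis.Analysis"
    "HOL-Algebra.Module"
    "HOL-Algebra.AbelCoset"
    "HOL-Computational_Algebra.Fraction_Field"
    "Berlekamp_Zassenhaus.Finite_Field"
begin

text \<open>Throughout, the prime \<open>p\<close> is \<open>CARD('p)\<close> for a type \<open>'p\<close> of class
  \<^class>\<open>prime_card\<close>, and the field with \<open>p\<close> elements is the type \<open>'p mod_ring\<close>.\<close>


section \<open>The \<open>p\<close>-adic integers and the \<open>p\<close>-adic numbers\<close>

text \<open>The ring of \<open>p\<close>-adic integers is the inverse limit of the rings of integers modulo \<open>p ^ n\<close>;
  the residue modulo \<open>p ^ n\<close> is given by its representative in \<open>{0..<p ^ n}\<close>
  (the range condition is implied by the coherence condition below).\<close>

typedef (overloaded) 'p padic_int =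
  "{x :: nat \<Rightarrow> int. \<forall>n. x (Suc n) mod int CARD('p::prime_card) ^ n = x n}"
  by (rule exI[of _ "\<lambda>_. 0"]) simp

setup_lifting type_definition_padic_int

lemma padic_mod_mod: "(a::int) mod (int CARD('p::prime_card)) ^ Suc n mod int CARD('p) ^ n
    = a mod int CARD('p) ^ n"
  by (simp add: mod_mod_cancel)

instantiation padic_int :: (prime_card) comm_ring_1
begin

lift_definition zero_padic_int :: "'a padic_int" is "\<lambda>_. 0" by simp

lift_definition one_padic_int :: "'a padic_int" is "\<lambda>n. 1 mod int CARD('a) ^ n"
  by (simp only: padic_mod_mod)

lift_definition plus_padic_int :: "'a padic_int \<Rightarrow> 'a padic_int \<Rightarrow> 'a padic_int"
  is "\<lambda>x y n. (x n + y n) mod int CARD('a) ^ n"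
  by (simp only: padic_mod_mod) (metis mod_add_eq)

lift_definition times_padic_int :: "'a padic_int \<Rightarrow> 'a padic_int \<Rightarrow> 'a padic_int"
  is "\<lambda>x y n. (x n * y n) mod int CARD('a) ^ n"
  by (simp only: padic_mod_mod) (metis mod_mult_eq)

lift_definition uminus_padic_int :: "'a padic_int \<Rightarrow> 'a padic_int"
  is "\<lambda>x n. (- x n) mod int CARD('a) ^ n"
  by (simp only: padic_mod_mod) (metis mod_minus_eq)

lift_definition minus_padic_int :: "'a padic_int \<Rightarrow> 'a padic_int \<Rightarrow> 'a padic_int"
  is "\<lambda>x y n. (x n - y n) mod int CARD('a) ^ n"
  by (simp only: padic_mod_mod) (metis mod_diff_eq)

instance
proof
  fix a b c :: "'a padic_int"
  have idem: "x n mod int CARD('a) ^ n = x n"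
    if "\<forall>n. x (Suc n) mod int CARD('a) ^ n = x n" for x n
    using that by (metis mod_mod_trivial)
  show "a * b * c = a * (b * c)"
    by transfer (auto simp: fun_eq_iff mod_simps mult.assoc)
  show "a * b = b * a"
    by transfer (auto simp: fun_eq_iff mult.commute)
  show "1 * a = a"
    by transfer (auto simp: fun_eq_iff mod_simps idem)
  show "a + b + c = a + (b + c)"
    by transfer (auto simp: fun_eq_iff mod_simps add.assoc)
  show "a + b = b + a"
    by transfer (auto simp: fun_eq_iff add.commute)
  show "0 + a = a"
    by transfer (auto simp: fun_eq_iff idem)
  show "- a + a = 0"
    by transfer (auto simp: fun_eq_iff mod_simps)
  show "a - b = a + - b"
    by transfer (auto simp: fun_eq_iff mod_simps)
  show "(a + b) * c = a * c + b * c"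
    by transfer (auto simp: fun_eq_iff mod_simps distrib_right)
  have "prime CARD('a)" by (rule prime_card)
  then have "(1::int) < int CARD('a)" using prime_gt_1_nat by simp
  then show "(0::'a padic_int) \<noteq> 1"
    by transfer (auto simp: fun_eq_iff intro!: exI[of _ 1])
qed

end

instance padic_int :: (prime_card) idom
proof
  fix a b :: "'a padic_int"
  assume "a \<noteq> 0" "b \<noteq> 0"
  then show "a * b \<noteq> 0"
  proof transfer
    fix x y :: "nat \<Rightarrow> int"
    let ?p = "int CARD('a)"
    assume x: "\<forall>n. x (Suc n) mod ?p ^ n = x n" and y: "\<forall>n. y (Suc n) mod ?p ^ n = y n"
    assume "x \<noteq> (\<lambda>_. 0)" "y \<noteq> (\<lambda>_. 0)"
    then obtain m n where mn: "x m \<noteq> 0" "y n \<noteq> 0"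
      by (auto simp: fun_eq_iff)
    have coh: "z (k + l) mod ?p ^ k = z k" if z: "\<forall>n. z (Suc n) mod ?p ^ n = z n" for z k l
    proof (induction l)
      case 0
      then show ?case using z by (metis add_0_right mod_mod_trivial)
    next
      case (Suc l)
      have "z (k + Suc l) mod ?p ^ k = z (Suc (k + l)) mod ?p ^ (k + l) mod ?p ^ k"
        by (simp add: mod_mod_cancel power_add)
      then show ?case using z Suc by simp
    qed
    have "\<not> ?p ^ m dvd x (m + n)" using coh[OF x, of m n] mn by (metis dvd_imp_mod_0)
    moreover have "\<not> ?p ^ n dvd y (m + n)"
      using coh[OF y, of n m] mn by (metis add.commute dvd_imp_mod_0)
    moreover have "prime_elem ?p" using prime_card_int[where 'a='a] by blast
    ultimately have "\<not> ?p ^ (m + n) dvd x (m + n) * y (m + n)"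
      using prime_elem_power_dvd_cases[of ?p "m + n" "x (m + n)" "y (m + n)" m "Suc n"]
      by (metis add_Suc_right prime_elem_power_dvd_cases power_le_dvd le_SucI order_refl)
    then show "(\<lambda>k. x k * y k mod ?p ^ k) \<noteq> (\<lambda>_. 0)"
      by (metis dvd_eq_mod_eq_0)
  qed
qed

definition residue :: "'p::prime_card padic_int \<Rightarrow> 'p mod_ring" where
  "residue x = of_int (Rep_padic_int x 1)"

type_synonym 'p padic = "'p padic_int fract"

definition of_padic_int :: "'p::prime_card padic_int \<Rightarrow> 'p padic" where
  "of_padic_int x = Fract x 1"

text \<open>The \<open>p\<close>-adic topology on the fraction field: the sets \<open>x + p ^ n * \<int>\<^sub>p\<close> form a basis of
  neighbourhoods of \<open>x\<close>. The auxiliary class only serves to single out the element \<open>p\<close> in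
  a type class instance for \<^type>\<open>fract\<close>.\<close>

class idom_uniformizer = idom +
  fixes uniformizer :: 'a

instantiation padic_int :: (prime_card) idom_uniformizer
begin
definition uniformizer_padic_int :: "'a padic_int" where
  "uniformizer_padic_int = of_nat CARD('a)"
instance ..
end

instantiation fract :: (idom_uniformizer) topological_space
begin

definition open_fract :: "'a fract set \<Rightarrow> bool" where
  "open_fract U \<longleftrightarrow> (\<forall>x\<in>U. \<exists>n. \<forall>b. x + Fract (uniformizer ^ n * b) 1 \<in> U)"

instance
proof
  show "open (UNIV :: 'a fract set)" by (simp add: open_fract_def)
next
  fix S T :: "'a fract set"
  assume S: "open S" and T: "open T"
  show "open (S \<inter> T)"
    unfolding open_fract_def
  proof
    fix x assume "x \<in> S \<inter> T"
    with S T obtain m n where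
      m: "\<And>b. x + Fract (uniformizer ^ m * b) 1 \<in> S" and
      n: "\<And>b. x + Fract (uniformizer ^ n * b) 1 \<in> T"
      unfolding open_fract_def by blast
    have "x + Fract (uniformizer ^ (m + n) * b) 1 \<in> S \<inter> T" for b
      using m[of "uniformizer ^ n * b"] n[of "uniformizer ^ m * b"]
      by (simp add: power_add ac_simps)
    then show "\<exists>n. \<forall>b. x + Fract (uniformizer ^ n * b) 1 \<in> S \<inter> T" by blast
  qed
next
  fix K :: "'a fract set set"
  assume "\<forall>S\<in>K. open S"
  then show "open (\<Union>K)"
    unfolding open_fract_def by (meson Union_iff)
qed

end

text \<open>\<open>teich x\<close> is the Teichmueller representative of \<open>x\<close>: its unique lift \<open>t\<close> with \<open>t ^ p = t\<close>.\<close>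

definition teich :: "'p::prime_card mod_ring \<Rightarrow> 'p padic_int" where
  "teich x = (THE t. residue t = x \<and> t ^ CARD('p) = t)"

definition I1 :: "'p::prime_card padic_int set" where
  "I1 = range teich"


section \<open>Groups\<close>

definition mat2 :: "'a::zero \<Rightarrow> 'a \<Rightarrow> 'a \<Rightarrow> 'a \<Rightarrow> 'a ^ 2 ^ 2" where
  "mat2 a b c d = vector [vector [a, b], vector [c, d]]"

definition GL2 :: "('p::prime_card padic ^ 2 ^ 2) set" where
  "GL2 = {g. invertible g}"

definition Zcent :: "('p::prime_card padic ^ 2 ^ 2) set" where
  "Zcent = {z \<in> GL2. \<forall>g\<in>GL2. z ** g = g ** z}"

definition Kmax :: "('p::prime_card padic ^ 2 ^ 2) set" where
  "Kmax = {map_matrix of_padic_int k |k. invertible k}"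

definition Iwahori :: "('p::prime_card padic ^ 2 ^ 2) set" where
  "Iwahori = {map_matrix of_padic_int k |k. invertible k \<and> residue (k $ 2 $ 1) = 0}"

definition KZ :: "('p::prime_card padic ^ 2 ^ 2) set" where
  "KZ = {k ** z |k z. k \<in> Kmax \<and> z \<in> Zcent}"

definition IZ :: "('p::prime_card padic ^ 2 ^ 2) set" where
  "IZ = {k ** z |k z. k \<in> Iwahori \<and> z \<in> Zcent}"

definition p_adic :: "'p::prime_card padic" where
  "p_adic = of_nat CARD('p)"

definition alpha :: "'p::prime_card padic ^ 2 ^ 2" where
  "alpha = mat2 1 0 0 p_adic"

definition beta :: "'p::prime_card padic ^ 2 ^ 2" where
  "beta = mat2 0 1 p_adic 0"


section \<open>Representations\<close>

text \<open>A representation over the field \<open>'k\<close> is a module record with an additional action;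
  the ring multiplication and unit that are part of the library's module record play no role and
  are left undefined.\<close>

record ('k, 'v, 'g) rep = "('k, 'v) module" +
  act :: "'g \<Rightarrow> 'v \<Rightarrow> 'v"

text \<open>Homomorphisms of representations of \<open>H\<close>, as extensional functions on the carrier.\<close>

definition rep_hom ::
  "'g set \<Rightarrow> ('k, 'v, 'g) rep \<Rightarrow> ('k, 'w, 'g) rep \<Rightarrow> ('v \<Rightarrow> 'w) set" where
  "rep_hom H M N = {\<phi> \<in> carrier M \<rightarrow>\<^sub>E carrier N.
     (\<forall>x\<in>carrier M. \<forall>y\<in>carrier M. \<phi> (x \<oplus>\<^bsub>M\<^esub> y) = \<phi> x \<oplus>\<^bsub>N\<^esub> \<phi> y) \<and>
     (\<forall>c. \<forall>x\<in>carrier M. \<phi> (c \<odot>\<^bsub>M\<^esub> x) = c \<odot>\<^bsub>N\<^esub> \<phi> x) \<and>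
     (\<forall>g\<in>H. \<forall>x\<in>carrier M. \<phi> (act M g x) = act N g (\<phi> x))}"

definition rep_iso ::
  "'g set \<Rightarrow> ('k, 'v, 'g) rep \<Rightarrow> ('k, 'w, 'g) rep \<Rightarrow> ('v \<Rightarrow> 'w) set" where
  "rep_iso H M N = {\<phi> \<in> rep_hom H M N. bij_betw \<phi> (carrier M) (carrier N)}"

text \<open>The quotient of \<open>M\<close> by a subrepresentation \<open>N\<close>, with the cosets of \<open>N\<close> as elements.\<close>

definition quot_rep :: "('k, 'v, 'g) rep \<Rightarrow> 'v set \<Rightarrow> ('k, 'v set, 'g) rep" where
  "quot_rep M N = \<lparr>carrier = a_rcosets\<^bsub>M\<^esub> N, mult = undefined, one = undefined,
     zero = N, add = (\<lambda>A B. A <+>\<^bsub>M\<^esub> B), smult = (\<lambda>c A. N <+>\<^bsub>M\<^esub> ((\<odot>\<^bsub>M\<^esub>) c ` A)),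
     act = (\<lambda>g A. act M g ` A)\<rparr>"

text \<open>The map on \<open>M/N\<close> induced by a map \<open>\<phi>\<close> that is constant on the cosets of \<open>N\<close>.\<close>

definition induced :: "('k, 'v, 'g) rep \<Rightarrow> 'v set \<Rightarrow> ('v \<Rightarrow> 'w) \<Rightarrow> 'v set \<Rightarrow> 'w" where
  "induced M N \<phi> = (\<lambda>A\<in>a_rcosets\<^bsub>M\<^esub> N. the_elem (\<phi> ` A))"

definition induced_op :: "('k, 'v, 'g) rep \<Rightarrow> 'v set \<Rightarrow> ('v \<Rightarrow> 'v) \<Rightarrow> 'v set \<Rightarrow> 'v set" where
  "induced_op M N S = induced M N (\<lambda>x. N +>\<^bsub>M\<^esub> S x)"


section \<open>Weights\<close>

text \<open>Polynomials in \<open>X\<close> and \<open>Y\<close> are polynomials in \<open>Y\<close> whose coefficients are polynomials in \<open>X\<close>.\<close>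

type_synonym 'p bipoly = "'p mod_ring poly poly"

definition const2 :: "'p::prime_card mod_ring \<Rightarrow> 'p bipoly" where
  "const2 c = [:[:c:]:]"

definition pX :: "'p::prime_card bipoly" where
  "pX = [:[:0, 1:]:]"

definition pY :: "'p::prime_card bipoly" where
  "pY = [:0, 1:]"

text \<open>\<open>subst2 P U W\<close> is \<open>P(U, W)\<close>.\<close>

definition subst2 :: "'p::prime_card bipoly \<Rightarrow> 'p bipoly \<Rightarrow> 'p bipoly \<Rightarrow> 'p bipoly" where
  "subst2 P U W = poly (map_poly (\<lambda>q. poly (map_poly const2 q) U) P) W"

definition homogeneous2 :: "nat \<Rightarrow> 'p::prime_card bipoly \<Rightarrow> bool" where
  "homogeneous2 r P \<longleftrightarrow> (\<forall>i j. poly.coeff (poly.coeff P j) i \<noteq> 0 \<longrightarrow> i + j = r)"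

text \<open>An element of \<open>KZ\<close> is uniquely \<open>p ^ n * k\<close> with \<open>n\<close> an integer and \<open>k\<close> in \<open>Kmax\<close>;
  since \<open>p\<close> acts trivially, only \<open>k\<close> matters for the action.\<close>

definition K_part :: "'p::prime_card padic ^ 2 ^ 2 \<Rightarrow> 'p padic_int ^ 2 ^ 2" where
  "K_part g = (THE k. invertible k \<and>
     (\<exists>n::int. g = mat (p_adic powi n) ** map_matrix of_padic_int k))"

definition weight_act :: "'p::prime_card padic ^ 2 ^ 2 \<Rightarrow> 'p bipoly \<Rightarrow> 'p bipoly" where
  "weight_act g P = (let k = map_matrix residue (K_part g) in
     subst2 P (const2 (k $ 1 $ 1) * pX + const2 (k $ 2 $ 1) * pY)
              (const2 (k $ 1 $ 2) * pX + const2 (k $ 2 $ 2) * pY))"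

definition Wt :: "nat \<Rightarrow> ('p::prime_card mod_ring, 'p bipoly, 'p padic ^ 2 ^ 2) rep" where
  "Wt r = \<lparr>carrier = {P. homogeneous2 r P}, mult = undefined, one = undefined,
     zero = 0, add = (+), smult = (\<lambda>c P. const2 c * P), act = weight_act\<rparr>"

definition Wt_star :: "nat \<Rightarrow> 'p::prime_card bipoly set" where
  "Wt_star r = {P \<in> carrier (Wt r). pX ^ CARD('p) * pY - pX * pY ^ CARD('p) dvd P}"

definition Wt_quot :: "('p::prime_card mod_ring, 'p bipoly set, 'p padic ^ 2 ^ 2) rep" where
  "Wt_quot = quot_rep (Wt (2 * CARD('p) - 2)) (Wt_star (2 * CARD('p) - 2))"

definition to_Wt_quot :: "'p::prime_card bipoly \<Rightarrow> 'p bipoly set" where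
  "to_Wt_quot P = Wt_star (2 * CARD('p) - 2) +>\<^bsub>Wt (2 * CARD('p) - 2)\<^esub> P"

text \<open>The inclusions of the two direct summands of \<open>Wt_quot\<close>, and the resulting projections.\<close>

definition incl_top :: "'p::prime_card bipoly \<Rightarrow> 'p bipoly set" where
  "incl_top = (THE \<iota>. \<iota> \<in> rep_hom KZ (Wt (CARD('p) - 1)) Wt_quot \<and>
     \<iota> (pX ^ (CARD('p) - 1)) = to_Wt_quot (pX ^ (2 * CARD('p) - 2)))"

definition incl_0 :: "'p::prime_card bipoly \<Rightarrow> 'p bipoly set" where
  "incl_0 = (THE \<iota>. \<iota> \<in> rep_hom KZ (Wt 0) Wt_quot \<and>
     \<iota> 1 = to_Wt_quot (pX ^ (2 * CARD('p) - 2) - pX ^ (CARD('p) - 1) * pY ^ (CARD('p) - 1)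
                  + pY ^ (2 * CARD('p) - 2)))"

definition proj_top :: "'p::prime_card bipoly set \<Rightarrow> 'p bipoly" where
  "proj_top q = (THE v. v \<in> carrier (Wt (CARD('p) - 1)) \<and>
     (\<exists>w\<in>carrier (Wt 0). q = incl_top v \<oplus>\<^bsub>Wt_quot\<^esub> incl_0 w))"

definition proj_0 :: "'p::prime_card bipoly set \<Rightarrow> 'p bipoly" where
  "proj_0 q = (THE w. w \<in> carrier (Wt 0) \<and>
     (\<exists>v\<in>carrier (Wt (CARD('p) - 1)). q = incl_top v \<oplus>\<^bsub>Wt_quot\<^esub> incl_0 w))"

definition triv :: "('p::prime_card mod_ring, 'p mod_ring, 'p padic ^ 2 ^ 2) rep" where
  "triv = \<lparr>carrier = UNIV, mult = undefined, one = undefined,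
     zero = 0, add = (+), smult = (*), act = (\<lambda>_ x. x)\<rparr>"


section \<open>Compact induction\<close>

text \<open>The group \<open>GL2\<close> carries the subspace topology of the space of all matrices, so its compact
  subsets are the compact sets of matrices contained in it.\<close>

definition compact_mod_Z :: "('p::prime_card padic ^ 2 ^ 2) set \<Rightarrow> bool" where
  "compact_mod_Z A \<longleftrightarrow> (\<exists>C\<subseteq>GL2. compact C \<and> A \<subseteq> {c ** z |c z. c \<in> C \<and> z \<in> Zcent})"

definition ind ::
  "('p::prime_card padic ^ 2 ^ 2) set \<Rightarrow> ('p mod_ring, 'v, 'p padic ^ 2 ^ 2) rep \<Rightarrow>
   ('p mod_ring, 'p padic ^ 2 ^ 2 \<Rightarrow> 'v, 'p padic ^ 2 ^ 2) rep" where
  "ind H \<sigma> = \<lparr>carrier = {f \<in> GL2 \<rightarrow>\<^sub>E carrier \<sigma>.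
       (\<forall>h\<in>H. \<forall>x\<in>GL2. f (h ** x) = act \<sigma> h (f x)) \<and>
       compact_mod_Z {x \<in> GL2. f x \<noteq> \<zero>\<^bsub>\<sigma>\<^esub>}},
     mult = undefined, one = undefined,
     zero = (\<lambda>x\<in>GL2. \<zero>\<^bsub>\<sigma>\<^esub>),
     add = (\<lambda>f f'. \<lambda>x\<in>GL2. f x \<oplus>\<^bsub>\<sigma>\<^esub> f' x),
     smult = (\<lambda>c f. \<lambda>x\<in>GL2. c \<odot>\<^bsub>\<sigma>\<^esub> f x),
     act = (\<lambda>g f. \<lambda>x\<in>GL2. f (x ** g))\<rparr>"

text \<open>The functions \<open>[g, v]\<close> (for \<open>H = KZ\<close>) and \<open>[[g, v]]\<close> (for \<open>H = IZ\<close>).\<close>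

definition ind_elem ::
  "('p::prime_card padic ^ 2 ^ 2) set \<Rightarrow> ('p mod_ring, 'v, 'p padic ^ 2 ^ 2) rep \<Rightarrow>
   'p padic ^ 2 ^ 2 \<Rightarrow> 'v \<Rightarrow> 'p padic ^ 2 ^ 2 \<Rightarrow> 'v" where
  "ind_elem H \<sigma> g v = (\<lambda>x\<in>GL2.
     if x \<in> {h ** matrix_inv g |h. h \<in> H} then act \<sigma> (x ** g) v else \<zero>\<^bsub>\<sigma>\<^esub>)"

definition ind_triv ::
  "('p::prime_card mod_ring, 'p padic ^ 2 ^ 2 \<Rightarrow> 'p mod_ring, 'p padic ^ 2 ^ 2) rep" where
  "ind_triv = ind IZ triv"

abbreviation ind_elem_IZ ::
  "'p::prime_card padic ^ 2 ^ 2 \<Rightarrow> 'p padic ^ 2 ^ 2 \<Rightarrow> 'p mod_ring" where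
  "ind_elem_IZ g \<equiv> ind_elem IZ triv g 1"

text \<open>The map \<open>f \<mapsto> \<pi> \<circ> f\<close> on \<open>ind H \<sigma>\<close> given by a map \<open>\<pi>\<close> defined on \<open>\<sigma>\<close>.\<close>

definition ind_map ::
  "('p::prime_card padic ^ 2 ^ 2) set \<Rightarrow> ('p mod_ring, 'v, 'p padic ^ 2 ^ 2) rep \<Rightarrow>
   ('v \<Rightarrow> 'w) \<Rightarrow> ('p padic ^ 2 ^ 2 \<Rightarrow> 'v) \<Rightarrow> 'p padic ^ 2 ^ 2 \<Rightarrow> 'w" where
  "ind_map H \<sigma> \<pi> = (\<lambda>f\<in>carrier (ind H \<sigma>). compose GL2 \<pi> f)"


section \<open>Hecke operators\<close>

definition Hecke_T ::
  "nat \<Rightarrow> ('p::prime_card padic ^ 2 ^ 2 \<Rightarrow> 'p bipoly) \<Rightarrow> 'p padic ^ 2 ^ 2 \<Rightarrow> 'p bipoly" where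
  "Hecke_T r = (THE S. S \<in> rep_hom GL2 (ind KZ (Wt r)) (ind KZ (Wt r)) \<and>
     (\<forall>P\<in>carrier (Wt r). S (ind_elem KZ (Wt r) (mat 1) P) =
        (\<Oplus>\<^bsub>ind KZ (Wt r)\<^esub>l\<in>I1. ind_elem KZ (Wt r) (mat2 p_adic (of_padic_int l) 0 1)
             (subst2 P pX (- const2 (residue l) * pX + of_nat CARD('p) * pY)))
        \<oplus>\<^bsub>ind KZ (Wt r)\<^esub> ind_elem KZ (Wt r) alpha (subst2 P (of_nat CARD('p) * pX) pY)))"

definition T_1_0 ::
  "('p::prime_card padic ^ 2 ^ 2 \<Rightarrow> 'p mod_ring) \<Rightarrow> 'p padic ^ 2 ^ 2 \<Rightarrow> 'p mod_ring" where
  "T_1_0 = (THE S. S \<in> rep_hom GL2 ind_triv ind_triv \<and>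
     S (ind_elem_IZ (mat 1)) = ind_elem_IZ beta)"

definition T_1_2 ::
  "('p::prime_card padic ^ 2 ^ 2 \<Rightarrow> 'p mod_ring) \<Rightarrow> 'p padic ^ 2 ^ 2 \<Rightarrow> 'p mod_ring" where
  "T_1_2 = (THE S. S \<in> rep_hom GL2 ind_triv ind_triv \<and>
     S (ind_elem_IZ (mat 1)) =
       (\<Oplus>\<^bsub>ind_triv\<^esub>l\<in>I1. ind_elem_IZ (mat2 1 0 (p_adic * of_padic_int l) p_adic)))"

definition T_m1_0 ::
  "('p::prime_card padic ^ 2 ^ 2 \<Rightarrow> 'p mod_ring) \<Rightarrow> 'p padic ^ 2 ^ 2 \<Rightarrow> 'p mod_ring" where
  "T_m1_0 = (THE S. S \<in> rep_hom GL2 ind_triv ind_triv \<and>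
     S (ind_elem_IZ (mat 1)) =
       (\<Oplus>\<^bsub>ind_triv\<^esub>l\<in>I1. ind_elem_IZ (mat2 p_adic (of_padic_int l) 0 1)))"

text \<open>The image of an operator on \<open>ind_triv\<close>.\<close>

definition op_image ::
  "(('p::prime_card padic ^ 2 ^ 2 \<Rightarrow> 'p mod_ring) \<Rightarrow> 'p padic ^ 2 ^ 2 \<Rightarrow> 'p mod_ring) \<Rightarrow>
   ('p padic ^ 2 ^ 2 \<Rightarrow> 'p mod_ring) set" where
  "op_image S = S ` carrier ind_triv"

end

theory Submission
  imports Defs
begin

text \<open>A function \<open>f\<close> in \<open>ind IZ 1\<close> restricted to a coset \<open>KZ y\<close> is a function on
  \<open>IZ \<setminus> KZ\<close>, that is, on the projective line over the prime field (by way of bottom rows), and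
  the quotient of the weight \<open>2p - 2\<close> is the space of all functions on that line. So \<open>\<Phi>\<close> is fibrewise
  evaluation, the projection to \<open>V\<^sub>0\<close> is summation over the line, which has \<open>p + 1 = 1\<close> points,
  and the projection to \<open>V\<^sub>p\<^sub>-\<^sub>1\<close> interpolates what is left.

  Let \<open>E\<close> be fibrewise summation, an idempotent of \<open>ind IZ 1\<close>, and \<open>U = E - 1\<close>. Left translation by
  \<open>\<beta>\<close> gives the involution \<open>T\<^sub>1\<^sub>,\<^sub>0\<close>, and comparing values on the generator yields
  \<open>T\<^sub>1\<^sub>,\<^sub>2 = U T\<^sub>1\<^sub>,\<^sub>0\<close> and \<open>T\<^sub>-\<^sub>1\<^sub>,\<^sub>0 = T\<^sub>1\<^sub>,\<^sub>0 U\<close>. Hence \<open>T\<^sub>1\<^sub>,\<^sub>2 T\<^sub>1\<^sub>,\<^sub>0 = U\<close> has image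
  \<open>ker E\<close>, and \<open>1 + T\<^sub>1\<^sub>,\<^sub>2 T\<^sub>1\<^sub>,\<^sub>0 = E\<close>; these are the kernels of the two projections.
  Moreover \<open>(T\<^sub>-\<^sub>1\<^sub>,\<^sub>0 + T\<^sub>1\<^sub>,\<^sub>0) U = T\<^sub>1\<^sub>,\<^sub>0 E U = 0\<close> and \<open>T\<^sub>-\<^sub>1\<^sub>,\<^sub>0 E = T\<^sub>1\<^sub>,\<^sub>0 U E = 0\<close>, so both
  operators descend to the quotients. The descended operators satisfy the formula defining \<open>T\<close>: on the
  vectors of the weight coming from the generator by inspection, and on the translates
  \<open>(Y + c X)\<^sup>p\<^sup>-\<^sup>1\<close> of \<open>X\<^sup>p\<^sup>-\<^sup>1\<close>, which span \<open>V\<^sub>p\<^sub>-\<^sub>1\<close>, by the permutation \<open>\<lambda> \<mapsto> c + 1 / \<lambda>\<close> of the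
  cosets, which exchanges one of them with \<open>\<alpha>\<close>.\<close>

section \<open>Arithmetic of the \<open>p\<close>-adic integers\<close>

text \<open>The operators, the inclusions of the two summands and \<open>T\<close> itself are
  definite descriptions, so each needs an existence and a uniqueness proof before anything can be
  said about it. Uniqueness comes from generators. Existence is obtained by writing the map as a
  composite of maps given by their values at all points of the group, where equivariance is visible.
  For \<open>T\<close> this uses a section of the projection: a form is evaluated at the point
  (0:1), an operator on functions is applied, and the result is projected again. The splitting of
  the quotient weight rests on counting roots. A form of degree p - 1 is determined by its values,
  and these sum to 0 over the line; subtracting from a function its total, as a constant, leaves
  exactly the values of such a form. Compactness modulo the centre enters only as finiteness of the
  set of cosets that meet the support; passing between the two needs that \<open>Kmax\<close> is
  compact and that \<open>Iwahori\<close> is open.\<close>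

abbreviation (input) pint :: "'p::prime_card padic_int" where
  "pint \<equiv> of_nat CARD('p)"

lemma p_gt_1: "1 < int CARD('p::prime_card)"
  using prime_card[where 'a='p] prime_gt_1_nat by simp

lemma Rep_padic_Suc: "Rep_padic_int x (Suc n) mod int CARD('p) ^ n = Rep_padic_int (x::'p::prime_card padic_int) n"
  using Rep_padic_int[of x] by simp

lemma Rep_padic_mod: "Rep_padic_int x n mod int CARD('p) ^ n = Rep_padic_int (x::'p::prime_card padic_int) n"
  by (metis Rep_padic_Suc mod_mod_trivial)

lemma Rep_padic_add_mod:
  "Rep_padic_int x (n + k) mod int CARD('p) ^ n = Rep_padic_int (x::'p::prime_card padic_int) n"
proof (induction k)
  case 0
  then show ?case by (simp add: Rep_padic_mod)
next
  case (Suc k)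
  have "Rep_padic_int x (n + Suc k) mod int CARD('p) ^ n
    = Rep_padic_int x (Suc (n + k)) mod int CARD('p) ^ (n + k) mod int CARD('p) ^ n"
    by (simp add: mod_mod_cancel power_add)
  then show ?case using Suc by (simp add: Rep_padic_Suc)
qed

lemma padic_eqI: "(\<And>n. Rep_padic_int x n = Rep_padic_int y n) \<Longrightarrow> x = y"
  by (simp add: Rep_padic_int_inject[symmetric] fun_eq_iff)

lemma Rep_of_nat: "Rep_padic_int (of_nat a :: 'p::prime_card padic_int) n = int a mod int CARD('p) ^ n"
proof (induction a)
  case 0
  then show ?case by (simp add: zero_padic_int.rep_eq)
next
  case (Suc a)
  then show ?case
    by (simp add: plus_padic_int.rep_eq one_padic_int.rep_eq mod_simps)
qed

lemma Rep_p_power: "Rep_padic_int (pint ^ k :: 'p::prime_card padic_int) n = int CARD('p) ^ k mod int CARD('p) ^ n"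
  using Rep_of_nat[of "CARD('p) ^ k" n] by simp

lemma residue_add: "residue (x + y) = residue x + residue (y::'p::prime_card padic_int)"
  and residue_mult: "residue (x * y) = residue x * residue y"
  and residue_diff: "residue (x - y) = residue x - residue y"
  and residue_0 [simp]: "residue (0::'p padic_int) = 0"
  and residue_1 [simp]: "residue (1::'p padic_int) = 1"
  and residue_of_nat [simp]: "residue (of_nat a :: 'p padic_int) = of_nat a"
proof -
  have *: "of_int (a mod int CARD('p)) = (of_int a :: 'p mod_ring)" for a
    unfolding of_int_of_int_mod_ring by (transfer; simp)
  show "residue (x + y) = residue x + residue y" "residue (x * y) = residue x * residue y"
    "residue (x - y) = residue x - residue y"
    "residue (0::'p padic_int) = 0" "residue (1::'p padic_int) = 1"
    "residue (of_nat a :: 'p padic_int) = of_nat a"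
    by (simp_all only: residue_def plus_padic_int.rep_eq times_padic_int.rep_eq
        minus_padic_int.rep_eq zero_padic_int.rep_eq one_padic_int.rep_eq Rep_of_nat power_one_right *
        of_int_add of_int_mult of_int_diff of_int_0 of_int_1 of_int_of_nat_eq)
qed

lemma residue_power: "residue (x ^ n) = residue x ^ n"
  by (induction n) (simp_all add: residue_mult)

lemma residue_sum: "residue (sum f A) = (\<Sum>a\<in>A. residue (f a))"
  by (induction A rule: infinite_finite_induct) (simp_all add: residue_add)

lemma residue_surj: "\<exists>x::'p::prime_card padic_int. residue x = a"
proof -
  obtain i where "a = of_nat i" using surj_of_nat_mod_ring by blast
  then have "residue (of_nat i :: 'p padic_int) = a" by simp
  then show ?thesis by blast
qed

lemma p_power_dvd_iff: "pint ^ n dvd x \<longleftrightarrow> Rep_padic_int (x::'p::prime_card padic_int) n = 0"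
proof
  assume "pint ^ n dvd x"
  then obtain y where "x = pint ^ n * y" by (auto simp: dvd_def)
  then show "Rep_padic_int x n = 0" by (simp add: times_padic_int.rep_eq Rep_p_power)
next
  let ?p = "int CARD('p)"
  assume x: "Rep_padic_int x n = 0"
  \<comment> \<open>The quotient has its digits shifted by n places: x / p^n modulo p^m is read off
    from x modulo p^(n+m).\<close>
  define y :: "'p padic_int" where "y = Abs_padic_int (\<lambda>m. Rep_padic_int x (n + m) div ?p ^ n)"
  have coh: "(Rep_padic_int x (n + Suc m) div ?p ^ n) mod ?p ^ m = Rep_padic_int x (n + m) div ?p ^ n" for m
  proof -
    have "Rep_padic_int x (n + m) = Rep_padic_int x (n + Suc m) mod (?p ^ n * ?p ^ m)"
      using Rep_padic_Suc[of x "n + m"] by (simp add: power_add)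
    also have "\<dots> = ?p ^ n * (Rep_padic_int x (n + Suc m) div ?p ^ n mod ?p ^ m) + Rep_padic_int x (n + Suc m) mod ?p ^ n"
      by (rule zmod_zmult2_eq) simp
    also have "Rep_padic_int x (n + Suc m) mod ?p ^ n = 0" using Rep_padic_add_mod x by metis
    finally show ?thesis by simp
  qed
  have Rep_y: "Rep_padic_int y m = Rep_padic_int x (n + m) div ?p ^ n" for m
    unfolding y_def using coh by (subst Abs_padic_int_inverse) auto
  have "x = pint ^ n * y"
  proof (rule padic_eqI)
    fix m
    have d: "?p ^ n dvd Rep_padic_int x (n + m)" using Rep_padic_add_mod[of x n m] x by auto
    have "Rep_padic_int (pint ^ n * y) m = (?p ^ n * Rep_padic_int y m) mod ?p ^ m"
      by (simp add: times_padic_int.rep_eq Rep_p_power mod_simps)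
    also have "\<dots> = Rep_padic_int x (m + n) mod ?p ^ m" using d by (simp add: Rep_y add.commute)
    finally show "Rep_padic_int x m = Rep_padic_int (pint ^ n * y) m"
      by (simp add: Rep_padic_add_mod)
  qed
  then show "pint ^ n dvd x" by simp
qed

lemma p_power_dvd_diff_iff:
  "pint ^ n dvd x - y \<longleftrightarrow> Rep_padic_int (x::'p::prime_card padic_int) n = Rep_padic_int y n"
proof -
  have "(Rep_padic_int x n - Rep_padic_int y n) mod int CARD('p) ^ n = 0 \<longleftrightarrow>
      Rep_padic_int x n mod int CARD('p) ^ n = Rep_padic_int y n mod int CARD('p) ^ n"
    by (simp add: mod_eq_dvd_iff dvd_eq_mod_eq_0)
  then show ?thesis by (simp add: p_power_dvd_iff minus_padic_int.rep_eq Rep_padic_mod)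
qed

lemma padic_eq_iff_p_power_dvd: "x = y \<longleftrightarrow> (\<forall>n. pint ^ n dvd x - (y::'p::prime_card padic_int))"
  unfolding p_power_dvd_diff_iff using padic_eqI by blast

text \<open>The limit takes its residue modulo p^n from \<open>s n\<close>; the hypothesis is the
  coherence of these residues. The lemma serves the geometric series, the Teichmueller limit and the
  nested balls of the compactness proof.\<close>

lemma padic_complete:
  fixes s :: "nat \<Rightarrow> 'p::prime_card padic_int"
  assumes "\<And>n. pint ^ n dvd s (Suc n) - s n"
  shows "\<exists>t. \<forall>n. pint ^ n dvd t - s n"
proof (rule exI[of _ "Abs_padic_int (\<lambda>n. Rep_padic_int (s n) n)"], rule allI)
  fix n
  have "Rep_padic_int (s (Suc n)) (Suc n) mod int CARD('p) ^ n = Rep_padic_int (s n) n" for n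
    using assms[of n] by (simp add: p_power_dvd_diff_iff Rep_padic_Suc)
  then show "pint ^ n dvd Abs_padic_int (\<lambda>n. Rep_padic_int (s n) n) - s n"
    by (simp add: p_power_dvd_diff_iff Abs_padic_int_inverse)
qed

lemma residue_eq_0_iff: "residue x = 0 \<longleftrightarrow> pint dvd (x::'p::prime_card padic_int)"
proof -
  have "residue x = 0 \<longleftrightarrow> Rep_padic_int x 1 mod int CARD('p) = 0"
    unfolding residue_def of_int_of_int_mod_ring by (transfer; simp)
  then show ?thesis using p_power_dvd_iff[of 1 x] Rep_padic_mod[of x 1] by simp
qed

lemma residue_eq_iff: "residue x = residue y \<longleftrightarrow> pint dvd x - (y::'p::prime_card padic_int)"
  by (simp flip: residue_eq_0_iff add: residue_diff)

text \<open>Lifting an inverse of the residue gives x y = 1 - p z, and the geometric series in p z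
  converges to an inverse of the right-hand side.\<close>

lemma unit_iff: "(x::'p::prime_card padic_int) dvd 1 \<longleftrightarrow> residue x \<noteq> 0"
proof
  assume "x dvd 1"
  then show "residue x \<noteq> 0" by (metis dvdE mult_zero_left residue_1 residue_mult zero_neq_one)
next
  assume "residue x \<noteq> 0"
  moreover obtain y :: "'p padic_int" where y: "residue y = inverse (residue x)"
    using residue_surj by blast
  ultimately have "residue (x * y) = residue 1" by (simp add: residue_mult)
  then have "pint dvd x * y - 1" by (rule iffD1[OF residue_eq_iff])
  then obtain z where z: "x * y = 1 - pint * z" by (metis add.commute diff_eq_eq dvdE minus_diff_eq
        mult_minus_right diff_conv_add_uminus)
  let ?s = "\<lambda>n. \<Sum>i<n. (pint * z) ^ i"
  have "\<exists>t. \<forall>n. pint ^ n dvd t - ?s n"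
    by (rule padic_complete) (simp add: power_mult_distrib)
  then obtain t where t: "\<And>n. pint ^ n dvd t - ?s n" by blast
  have "x * y * t = 1"
    unfolding padic_eq_iff_p_power_dvd
  proof
    fix n
    have "x * y * t - 1 = x * y * (t - ?s n) - (pint * z) ^ n"
      using one_diff_power_eq[of "pint * z" n] by (simp add: z algebra_simps)
    then show "pint ^ n dvd x * y * t - 1"
      using t by (simp add: dvd_diff dvd_mult power_mult_distrib)
  qed
  then show "x dvd 1" by (metis dvd_triv_left mult.assoc)
qed

lemma pint_nonzero [simp]: "(pint :: 'p::prime_card padic_int) \<noteq> 0"
proof
  assume "(pint :: 'p padic_int) = 0"
  then have "Rep_padic_int (pint :: 'p padic_int) 2 = 0" by (simp add: zero_padic_int.rep_eq)
  then have "int CARD('p) mod (int CARD('p) ^ 2) = 0" by (simp add: Rep_of_nat)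
  then show False using p_gt_1[where 'p='p] by (simp add: power2_eq_square)
qed

text \<open>The exponent n is the last one for which p^n still divides x; it exists because only 0
  is divisible by every power of p. The cofactor is then prime to p, hence a unit.\<close>

lemma padic_int_decomp:
  assumes "(x::'p::prime_card padic_int) \<noteq> 0"
  shows "\<exists>n u. x = pint ^ n * u \<and> u dvd 1"
proof -
  from assms obtain m where m: "\<not> pint ^ m dvd x"
    using padic_eq_iff_p_power_dvd[of x 0] by auto
  define k where "k = (LEAST m. \<not> pint ^ m dvd x)"
  have k: "\<not> pint ^ k dvd x" unfolding k_def by (rule LeastI[of _ m], rule m)
  then obtain n where n: "k = Suc n" by (cases k) auto
  then have "pint ^ n dvd x" using not_less_Least[of n "\<lambda>m. \<not> pint ^ m dvd x"] by (simp add: k_def)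
  then obtain u where u: "x = pint ^ n * u" by (auto simp: dvd_def)
  have "\<not> pint dvd u" using k unfolding n u by (auto simp: mult_ac dvd_def)
  then show ?thesis using u residue_eq_0_iff unit_iff by blast
qed

text \<open>The cofactor of a - b in a^p - b^p is a sum of p terms, each congruent to b^(p-1) modulo
  p, so it contributes one more factor p.\<close>

lemma power_p_congruence:
  assumes "pint ^ Suc k dvd a - (b::'p::prime_card padic_int)"
  shows "pint ^ Suc (Suc k) dvd a ^ CARD('p) - b ^ CARD('p)"
proof -
  have "residue a = residue b" using assms by (metis dvd_mult_left power_Suc residue_eq_iff)
  then have "residue (\<Sum>i<CARD('p). b ^ (CARD('p) - Suc i) * a ^ i)
      = (\<Sum>i<CARD('p). residue b ^ (CARD('p) - 1))"
    unfolding residue_sum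
    by (intro sum.cong refl) (simp add: residue_mult residue_power flip: power_add)
  also have "\<dots> = 0" by simp
  finally have "pint dvd (\<Sum>i<CARD('p). b ^ (CARD('p) - Suc i) * a ^ i)"
    by (simp add: residue_eq_0_iff)
  then have "pint ^ Suc k * pint dvd (a - b) * (\<Sum>i<CARD('p). b ^ (CARD('p) - Suc i) * a ^ i)"
    using assms by (rule mult_dvd_mono[rotated])
  then show ?thesis by (simp add: power_diff_sumr2 mult_ac)
qed

text \<open>The representative is the limit of a^(p^n) for any lift a of x: Fermat makes the first
  two terms congruent modulo p, and each p-th power improves the congruence by one digit.\<close>

lemma teich_exists: "\<exists>t::'p::prime_card padic_int. residue t = x \<and> t ^ CARD('p) = t"
proof -
  obtain a :: "'p padic_int" where a: "residue a = x" using residue_surj by blast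
  let ?s = "\<lambda>n. a ^ (CARD('p) ^ n)"
  have s: "pint ^ Suc n dvd ?s (Suc n) - ?s n" for n
  proof (induction n)
    case 0
    have "residue (a ^ CARD('p)) = residue a"
      using finite_field_power_card_eq_same[of "residue a"] by (simp add: residue_power)
    then show ?case by (simp add: residue_eq_iff)
  next
    case (Suc n)
    then show ?case using power_p_congruence[OF Suc] by (simp add: power_mult[symmetric] mult.commute)
  qed
  then have "\<And>n. pint ^ n dvd ?s (Suc n) - ?s n"
    by (metis dvd_mult_right power_Suc)
  then obtain t where t: "\<And>n. pint ^ n dvd t - ?s n"
    using padic_complete[of ?s] by blast
  have "residue t = x"
  proof -
    have "residue t = residue (?s 1)" using t[of 1] by (simp add: residue_eq_iff)
    also have "\<dots> = x" using finite_field_power_card_eq_same[of x] by (simp add: residue_power a)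
    finally show ?thesis .
  qed
  moreover have "t ^ CARD('p) = t"
    unfolding padic_eq_iff_p_power_dvd
  proof
    fix n
    have "t - ?s n dvd t ^ CARD('p) - ?s n ^ CARD('p)" by (simp add: power_diff_sumr2)
    then have 1: "pint ^ n dvd t ^ CARD('p) - ?s n ^ CARD('p)" using t dvd_trans by blast
    have e: "?s n ^ CARD('p) = ?s (Suc n)" by (simp add: power_mult[symmetric] mult.commute)
    have 2: "pint ^ n dvd t - ?s (Suc n)"
      using t[of "Suc n"] by (metis dvd_mult_right power_Suc)
    show "pint ^ n dvd t ^ CARD('p) - t"
      using dvd_diff[OF 1 2] by (simp add: e)
  qed
  ultimately show ?thesis by blast
qed

text \<open>Taking p-th powers fixes both elements but improves a congruence between them by one
  power of p.\<close>

lemma teich_unique: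
  fixes s t :: "'p::prime_card padic_int"
  assumes "residue s = residue t" "s ^ CARD('p) = s" "t ^ CARD('p) = t"
  shows "s = t"
proof -
  have "pint ^ Suc n dvd s - t" for n
  proof (induction n)
    case 0
    then show ?case using assms by (simp add: residue_eq_iff)
  next
    case (Suc n)
    then show ?case using power_p_congruence[OF Suc] assms by simp
  qed
  then show ?thesis unfolding padic_eq_iff_p_power_dvd by (metis dvd_mult_right power_Suc)
qed

lemma residue_teich [simp]: "residue (teich x) = x"
proof -
  have "\<exists>!t. residue t = x \<and> t ^ CARD('a) = t"
    using teich_exists teich_unique by (metis (no_types, lifting))
  then show ?thesis unfolding teich_def by (rule the1I2) auto
qed

lemma inj_teich: "inj teich"
  by (rule inj_on_inverseI[where g=residue]) simp

section \<open>The p-adic integers inside their fraction field\<close>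

lemma of_padic_int_hom [simp]:
  "of_padic_int (x + y) = of_padic_int x + of_padic_int (y::'p::prime_card padic_int)"
  "of_padic_int (x * y) = of_padic_int x * of_padic_int y"
  "of_padic_int (- x) = - of_padic_int x"
  "of_padic_int (x - y) = of_padic_int x - of_padic_int y"
  "of_padic_int (0::'p padic_int) = 0"
  "of_padic_int (1::'p padic_int) = 1"
  by (simp_all add: of_padic_int_def Zero_fract_def One_fract_def)

lemma of_padic_int_inj [simp]: "of_padic_int x = of_padic_int y \<longleftrightarrow> x = (y::'p::prime_card padic_int)"
  by (simp add: of_padic_int_def eq_fract)

lemma of_padic_int_eq_0 [simp]: "of_padic_int x = 0 \<longleftrightarrow> x = (0::'p::prime_card padic_int)"
  using of_padic_int_inj[of x 0] by (simp del: of_padic_int_inj)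

lemma of_padic_int_power [simp]: "of_padic_int (x ^ n) = of_padic_int x ^ n"
  by (induction n) simp_all

lemma of_padic_int_of_nat [simp]: "of_padic_int (of_nat n) = of_nat n"
  by (induction n) simp_all

lemma p_adic_eq: "p_adic = of_padic_int pint"
  by (simp add: p_adic_def)

lemma of_nat_card_padic_nonzero [simp]: "(of_nat CARD('p) :: 'p::prime_card padic) \<noteq> 0"
  using of_padic_int_eq_0[of "pint :: 'p padic_int"] by (simp del: of_padic_int_eq_0)

lemma p_adic_nonzero [simp]: "(p_adic :: 'p::prime_card padic) \<noteq> 0"
  by (simp add: p_adic_def)

lemma padic_integral_multiple: "\<exists>n (y::'p::prime_card padic_int). p_adic ^ n * (a :: 'p padic) = of_padic_int y"
proof (cases a)
  case (Fract x d)
  then obtain n u where n: "d = pint ^ n * u" "u dvd 1" using padic_int_decomp by blast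
  then obtain w where w: "u * w = 1" by (metis dvdE)
  then have [simp]: "u \<noteq> 0" by auto
  have "p_adic ^ n * a = of_padic_int (pint ^ n) * a" by (simp add: p_adic_eq)
  also have "\<dots> = of_padic_int (x * w)"
    using w by (simp add: Fract n of_padic_int_def eq_fract mult_ac)
  finally show ?thesis by blast
qed

lemma padic_decomp:
  assumes "(a :: 'p::prime_card padic) \<noteq> 0"
  shows "\<exists>n u. a = p_adic powi n * of_padic_int u \<and> u dvd 1"
proof -
  obtain n y where y: "p_adic ^ n * a = of_padic_int y" using padic_integral_multiple by blast
  then have "y \<noteq> 0" using assms by auto
  then obtain m u where u: "y = pint ^ m * u" "u dvd 1" using padic_int_decomp by blast
  have "a = p_adic powi (int m - int n) * of_padic_int u"
    using y by (simp add: u power_int_diff p_adic_def field_simps)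
  then show ?thesis using u by blast
qed

section \<open>Two by two matrices\<close>

lemma mat2_nth [simp]:
  "mat2 a b c d $ 1 $ 1 = a" "mat2 a b c d $ 1 $ 2 = b"
  "mat2 a b c d $ 2 $ 1 = c" "mat2 a b c d $ 2 $ 2 = d"
  by (simp_all add: mat2_def)

lemma mat2_eqI:
  assumes "A $ 1 $ 1 = B $ 1 $ 1" "A $ 1 $ 2 = B $ 1 $ 2" "A $ 2 $ 1 = B $ 2 $ 1" "A $ 2 $ 2 = B $ 2 $ 2"
  shows "A = (B :: 'a ^ 2 ^ 2)"
  using assms by (simp add: vec_eq_iff forall_2)

lemma matrix_mult_nth_2: "((A :: 'a::comm_ring_1 ^ 2 ^ 2) ** (B :: 'a ^ 2 ^ 2)) $ i $ j = A $ i $ 1 * B $ 1 $ j + A $ i $ 2 * B $ 2 $ j"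
  by (simp add: matrix_matrix_mult_def sum_2)

lemma mat_nth_2 [simp]: "mat s $ (1::2) $ (1::2) = s" "mat s $ (2::2) $ (2::2) = s"
  "mat s $ (1::2) $ (2::2) = 0" "mat s $ (2::2) $ (1::2) = 0"
  by (simp_all add: mat_def)

lemma mat_mult_nth: "((mat s :: 'a::comm_ring_1 ^ 2 ^ 2) ** (A :: 'a ^ 2 ^ 2)) $ i $ j = s * A $ i $ j"
  using exhaust_2[of i] by (auto simp: matrix_mult_nth_2)

lemma mat_mult_commute: "mat s ** A = A ** mat s" for A :: "'a::comm_ring_1 ^ 2 ^ 2"
  by (rule mat2_eqI) (simp_all add: matrix_mult_nth_2 mult.commute)

lemma mat_mult_mat: "(mat s :: 'a::comm_ring_1 ^ 2 ^ 2) ** mat t = mat (s * t)"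
  by (rule mat2_eqI) (simp_all add: matrix_mult_nth_2)

lemma invertible_2_iff: "invertible (A :: 'a::comm_ring_1 ^ 2 ^ 2) \<longleftrightarrow> det A dvd 1"
proof
  assume "invertible A"
  then obtain B where "A ** B = mat 1" by (auto simp: invertible_def)
  then have "det A * det B = 1" by (metis det_I det_mul)
  then show "det A dvd 1" by (metis dvd_triv_left)
next
  assume "det A dvd 1"
  then obtain u where u: "1 = det A * u" by (auto simp: dvd_def)
  \<comment> \<open>The adjugate, scaled by the inverse u of the determinant.\<close>
  define B where "B = mat2 (u * A $ 2 $ 2) (- (u * A $ 1 $ 2)) (- (u * A $ 2 $ 1)) (u * A $ 1 $ 1)"
  have "A ** B = mat 1" "B ** A = mat 1"
    using u by (auto intro!: mat2_eqI simp: B_def matrix_mult_nth_2 det_2 algebra_simps)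
  then show "invertible A" by (auto simp: invertible_def)
qed

abbreviation (input) embed_mat :: "'p::prime_card padic_int ^ 2 ^ 2 \<Rightarrow> 'p padic ^ 2 ^ 2" where
  "embed_mat \<equiv> map_matrix of_padic_int"

abbreviation (input) residue_mat :: "'p::prime_card padic_int ^ 2 ^ 2 \<Rightarrow> 'p mod_ring ^ 2 ^ 2" where
  "residue_mat \<equiv> map_matrix residue"

lemma embed_mat_mult: "embed_mat (A ** B) = embed_mat A ** embed_mat B"
  by (rule mat2_eqI) (simp_all add: matrix_mult_nth_2)

lemma embed_mat_1 [simp]: "embed_mat (mat 1) = mat 1"
  by (rule mat2_eqI) simp_all

lemma embed_mat_inj [simp]: "embed_mat A = embed_mat B \<longleftrightarrow> A = B"
  by (auto simp: vec_eq_iff)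

lemma det_embed_mat: "det (embed_mat A) = of_padic_int (det A)"
  by (simp add: det_2)

lemma residue_mat_mult: "residue_mat (A ** B) = residue_mat A ** residue_mat B"
  by (rule mat2_eqI) (simp_all add: matrix_mult_nth_2 residue_add residue_mult)

lemma residue_mat_1 [simp]: "residue_mat (mat 1) = mat 1"
  by (rule mat2_eqI) simp_all

lemma det_residue_mat: "det (residue_mat A) = residue (det A)"
  by (simp add: det_2 residue_diff residue_mult)

lemma invertible_iff_residue: "invertible (A :: 'p::prime_card padic_int ^ 2 ^ 2) \<longleftrightarrow> det (residue_mat A) \<noteq> 0"
  by (simp add: invertible_2_iff unit_iff det_residue_mat)

section \<open>The groups \<open>KZ\<close> and \<open>IZ\<close>\<close>

lemma GL2_iff: "g \<in> GL2 \<longleftrightarrow> det g \<noteq> 0"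
  by (simp add: GL2_def invertible_det_nz)

lemma GL2_mult [simp, intro]: "g \<in> GL2 \<Longrightarrow> h \<in> GL2 \<Longrightarrow> g ** h \<in> GL2"
  by (simp add: GL2_iff det_mul)

lemma GL2_1 [simp]: "mat 1 \<in> GL2"
  by (simp add: GL2_iff)

lemma matrix_inv_GL2:
  assumes "g \<in> GL2"
  shows "matrix_inv g \<in> GL2" "g ** matrix_inv g = mat 1" "matrix_inv g ** g = mat 1"
proof -
  show 1: "g ** matrix_inv g = mat 1" "matrix_inv g ** g = mat 1"
    using assms someI_ex[of "\<lambda>h. g ** h = mat 1 \<and> h ** g = mat 1"]
    by (auto simp: GL2_def invertible_def matrix_inv_def)
  then show "matrix_inv g \<in> GL2" unfolding GL2_def invertible_def by blast
qed

lemma matrix_inv_cancel [simp]: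
  assumes "g \<in> GL2"
  shows "(x ** g) ** matrix_inv g = x" "(x ** matrix_inv g) ** g = x"
    "g ** (matrix_inv g ** x) = x" "matrix_inv g ** (g ** x) = x"
proof -
  show "(x ** g) ** matrix_inv g = x" "(x ** matrix_inv g) ** g = x"
    using assms by (simp_all add: matrix_mul_assoc[symmetric] matrix_inv_GL2)
  show "g ** (matrix_inv g ** x) = x" "matrix_inv g ** (g ** x) = x"
    using assms by (simp_all add: matrix_mul_assoc matrix_inv_GL2)
qed

lemma mat_GL2: "mat s \<in> GL2 \<longleftrightarrow> s \<noteq> 0"
  by (simp add: GL2_iff det_2)

lemma Zcent_eq: "Zcent = {mat s |s. s \<noteq> (0 :: 'p::prime_card padic)}"
proof (intro equalityI subsetI)
  fix z :: "'p padic ^ 2 ^ 2" assume z: "z \<in> Zcent"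
  then have c: "z ** g = g ** z" if "g \<in> GL2" for g using that by (simp add: Zcent_def)
  \<comment> \<open>Commuting with the two elementary unipotent matrices already forces a scalar
    matrix.\<close>
  have "z ** mat2 1 1 0 1 = mat2 1 1 0 1 ** z" "z ** mat2 1 0 1 1 = mat2 1 0 1 1 ** z"
    by (simp_all add: c GL2_iff det_2)
  then have "z $ 2 $ 1 = 0" "z $ 1 $ 2 = 0" "z $ 1 $ 1 = z $ 2 $ 2"
    by (simp_all add: vec_eq_iff forall_2 matrix_mult_nth_2)
  then have "z = mat (z $ 1 $ 1)" by (intro mat2_eqI) simp_all
  moreover have "z \<in> GL2" using z by (simp add: Zcent_def)
  ultimately show "z \<in> {mat s |s. s \<noteq> 0}" by (metis (mono_tags, lifting) mat_GL2 mem_Collect_eq)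
qed (auto simp: Zcent_def mat_GL2 mat_mult_commute)

abbreviation (input) p_scalar :: "int \<Rightarrow> 'p::prime_card padic ^ 2 ^ 2" where
  "p_scalar n \<equiv> mat (p_adic powi n)"

lemma p_scalar_mult: "p_scalar m ** p_scalar n = p_scalar (m + n)"
  by (simp add: mat_mult_mat power_int_add)

text \<open>A scalar is a power of p times a unit, and the unit is absorbed into A. What remains is
  the normal form on which \<open>KZ_eq\<close>, \<open>IZ_eq\<close> and \<open>K_part\<close> are
  based.\<close>

lemma times_Zcent_eq:
  assumes "\<And>(k :: 'p::prime_card padic_int ^ 2 ^ 2) u. k \<in> A \<Longrightarrow> u dvd 1 \<Longrightarrow> k ** mat u \<in> A"
  shows "{k ** z |k z. k \<in> embed_mat ` A \<and> z \<in> Zcent} = {p_scalar n ** embed_mat k |n k. k \<in> A}"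
proof (intro equalityI subsetI)
  fix x assume "x \<in> {k ** z |k z. k \<in> embed_mat ` A \<and> z \<in> Zcent}"
  then obtain k s where k: "k \<in> A" "s \<noteq> 0" and x: "x = embed_mat k ** mat s"
    by (auto simp: Zcent_eq)
  obtain n u where u: "s = p_adic powi n * of_padic_int u" "u dvd 1"
    using padic_decomp[OF k(2)] by blast
  have "x = p_scalar n ** embed_mat (k ** mat u)"
    unfolding x u by (rule mat2_eqI) (simp_all add: matrix_mult_nth_2)
  then show "x \<in> {p_scalar n ** embed_mat k |n k. k \<in> A}" using assms k u by blast
next
  fix x assume "x \<in> {p_scalar n ** embed_mat k |n k. k \<in> A}"
  then obtain n k where "x = embed_mat k ** p_scalar n" "k \<in> A" by (auto simp: mat_mult_commute)
  moreover have "p_scalar n \<in> Zcent" by (auto simp: Zcent_eq power_int_eq_0_iff)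
  ultimately show "x \<in> {k ** z |k z. k \<in> embed_mat ` A \<and> z \<in> Zcent}" by blast
qed

lemma KZ_eq: "(KZ :: ('p::prime_card padic ^ 2 ^ 2) set) = {p_scalar n ** embed_mat k |n k. det (residue_mat k) \<noteq> 0}"
proof -
  let ?A = "{k :: 'p padic_int ^ 2 ^ 2. det (residue_mat k) \<noteq> 0}"
  have 1: "Kmax = embed_mat ` ?A"
    by (auto simp: Kmax_def invertible_iff_residue)
  have 2: "k ** mat u \<in> ?A" if "k \<in> ?A" "u dvd 1" for k u
    using that by (simp add: residue_mat_mult det_mul det_residue_mat unit_iff matrix_mult_nth_2 residue_mult residue_add)
      (simp add: det_2 residue_mult)
  show ?thesis
    using times_Zcent_eq[of ?A, OF 2] unfolding KZ_def 1 mem_Collect_eq .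
qed

lemma IZ_eq: "(IZ :: ('p::prime_card padic ^ 2 ^ 2) set) = {p_scalar n ** embed_mat k |n k. det (residue_mat k) \<noteq> 0 \<and> residue (k $ 2 $ 1) = 0}"
proof -
  let ?A = "{k :: 'p padic_int ^ 2 ^ 2. det (residue_mat k) \<noteq> 0 \<and> residue (k $ 2 $ 1) = 0}"
  have 1: "Iwahori = embed_mat ` ?A"
    by (auto simp: Iwahori_def invertible_iff_residue)
  have 2: "k ** mat u \<in> ?A" if "k \<in> ?A" "u dvd 1" for k u
    using that by (simp add: residue_mat_mult det_mul det_residue_mat unit_iff matrix_mult_nth_2 residue_mult residue_add)
      (simp add: det_2 residue_mult)
  show ?thesis
    using times_Zcent_eq[of ?A, OF 2] unfolding IZ_def 1 mem_Collect_eq .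
qed

text \<open>If p^i a = p^j b with i at most j, then a = p^(j-i) b; a positive exponent would make a
  reduce to the zero matrix modulo p, against its nonzero determinant. Hence the integral part of an
  element of \<open>KZ\<close> is unique.\<close>

lemma K_part_eq:
  assumes "det (residue_mat k) \<noteq> 0"
  shows "K_part (p_scalar n ** embed_mat k) = k"
  unfolding K_part_def
proof (rule the_equality)
  show "invertible k \<and> (\<exists>m. p_scalar n ** embed_mat k = p_scalar m ** embed_mat k)"
    using assms invertible_iff_residue by blast
next
  fix k' assume "invertible k' \<and> (\<exists>m. p_scalar n ** embed_mat k = p_scalar m ** embed_mat k')"
  then obtain m where k': "det (residue_mat k') \<noteq> 0" and e: "p_scalar n ** embed_mat k = p_scalar m ** embed_mat k'"
    using invertible_iff_residue by blast
  have *: "a = b" if "p_scalar i ** embed_mat a = p_scalar j ** embed_mat b" "i \<le> j"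
     "det (residue_mat a) \<noteq> 0" for i j and a b :: "'a padic_int ^ 2 ^ 2"
  proof -
    define l where "l = nat (j - i)"
    have "p_scalar (- i) ** (p_scalar i ** embed_mat a) = p_scalar (- i) ** (p_scalar j ** embed_mat b)"
      using that by simp
    then have "embed_mat a = p_scalar (j - i) ** embed_mat b"
      by (simp add: matrix_mul_assoc p_scalar_mult)
    also have "\<dots> = embed_mat (mat (pint ^ l) ** b)"
      using that(2) unfolding l_def
      by (intro mat2_eqI) (simp_all add: matrix_mult_nth_2 power_int_def p_adic_def)
    finally have a: "a = mat (pint ^ l) ** b" by simp
    have "l = 0"
    proof (rule ccontr)
      assume "l \<noteq> 0"
      then have "residue (pint ^ l :: 'a padic_int) = 0" by (simp add: residue_power)
      then show False using that(3) by (simp add: a residue_mat_mult det_mul) (simp add: det_2)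
    qed
    then show ?thesis by (simp add: a)
  qed
  show "k' = k" using *[OF e _ assms] *[OF e[symmetric] _ k'] linear[of n m] by blast
qed

text \<open>On \<open>KZ\<close> this is the homomorphism to the invertible matrices over the prime
  field through which every weight acts; powers of p go to the identity.\<close>

definition red :: "'p::prime_card padic ^ 2 ^ 2 \<Rightarrow> 'p mod_ring ^ 2 ^ 2" where
  "red g = residue_mat (K_part g)"

lemma red_eq: "det (residue_mat k) \<noteq> 0 \<Longrightarrow> red (p_scalar n ** embed_mat k) = residue_mat k"
  by (simp add: red_def K_part_eq)

lemma embed_mat_KZ: "det (residue_mat k) \<noteq> 0 \<Longrightarrow> embed_mat k \<in> KZ \<and> red (embed_mat k) = residue_mat k"
  using red_eq[of k 0] unfolding KZ_eq by (auto intro: exI[of _ 0])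

lemma KZ_mult: "g \<in> KZ \<Longrightarrow> h \<in> KZ \<Longrightarrow> g ** h \<in> KZ \<and> red (g ** h) = red g ** red h"
proof -
  assume "g \<in> KZ" "h \<in> KZ"
  then obtain m n k l where g: "g = p_scalar m ** embed_mat k" and k: "det (residue_mat k) \<noteq> 0"
    and h: "h = p_scalar n ** embed_mat l" and l: "det (residue_mat l) \<noteq> 0"
    by (auto simp: KZ_eq)
  have e: "g ** h = p_scalar (m + n) ** embed_mat (k ** l)"
    unfolding g h embed_mat_mult p_scalar_mult[symmetric]
    by (rule mat2_eqI) (simp_all add: matrix_mult_nth_2 algebra_simps)
  have d: "det (residue_mat (k ** l)) \<noteq> 0" using k l by (simp add: residue_mat_mult det_mul)
  show ?thesis
    using red_eq[OF d, of "m + n"] red_eq[OF k, of m] red_eq[OF l, of n] e d unfolding KZ_eq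
    by (auto simp: g[symmetric] h[symmetric] residue_mat_mult det_mul intro!: exI[of _ "m + n"] exI[of _ "k ** l"])
qed

lemma red_mult [simp]: "g \<in> KZ \<Longrightarrow> h \<in> KZ \<Longrightarrow> red (g ** h) = red g ** red h"
  and KZ_mult_closed [simp, intro]: "g \<in> KZ \<Longrightarrow> h \<in> KZ \<Longrightarrow> g ** h \<in> KZ"
  using KZ_mult by blast+

lemma det_red: "g \<in> KZ \<Longrightarrow> det (red g) \<noteq> 0"
  by (auto simp: KZ_eq red_eq)

lemma KZ_sub_GL2: "g \<in> KZ \<Longrightarrow> g \<in> GL2"
proof -
  assume "g \<in> KZ"
  then obtain n k where g: "g = p_scalar n ** embed_mat k" and k: "det (residue_mat k) \<noteq> 0"
    by (auto simp: KZ_eq)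
  have "det k \<noteq> 0" using k by (auto simp: det_residue_mat)
  then show ?thesis by (simp add: g GL2_iff det_mul det_embed_mat) (simp add: det_2)
qed

lemma p_scalar_KZ: "p_scalar n \<in> KZ" "red (p_scalar n :: 'p::prime_card padic ^ 2 ^ 2) = mat 1"
  "p_scalar n \<in> IZ"
proof -
  have *: "p_scalar n ** embed_mat (mat 1) = (p_scalar n :: 'p padic ^ 2 ^ 2)" by simp
  show "red (p_scalar n :: 'p padic ^ 2 ^ 2) = mat 1"
    using red_eq[of "mat 1" n] unfolding * by simp
  have "residue_mat (mat 1 :: 'p padic_int ^ 2 ^ 2) = mat 1" by simp
  then show "p_scalar n \<in> KZ" "p_scalar n \<in> IZ" using * unfolding KZ_eq IZ_eq
    by (auto intro!: exI[of _ n] exI[of _ "mat 1"])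
qed

lemma KZ_1 [simp]: "mat 1 \<in> KZ" "red (mat 1) = mat 1"
  using p_scalar_KZ[of 0] by simp_all

lemma KZ_inv:
  assumes "g \<in> KZ"
  shows "matrix_inv g \<in> KZ"
proof -
  obtain n k where g: "g = p_scalar n ** embed_mat k" and k: "det (residue_mat k) \<noteq> 0"
    using assms by (auto simp: KZ_eq)
  obtain l where l: "k ** l = mat 1" "l ** k = mat 1"
    using k by (auto simp: invertible_iff_residue[symmetric] invertible_def)
  have "det (residue_mat l) \<noteq> 0"
    using l by (metis invertible_def invertible_iff_residue)
  then have h: "p_scalar (- n) ** embed_mat l \<in> KZ" by (auto simp: KZ_eq)
  have "g ** (p_scalar (- n) ** embed_mat l) = p_scalar (n + - n) ** embed_mat (k ** l)"
    unfolding g embed_mat_mult p_scalar_mult[symmetric]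
    by (rule mat2_eqI) (simp_all add: matrix_mult_nth_2 algebra_simps)
  then have "g ** (p_scalar (- n) ** embed_mat l) = mat 1" by (simp add: l)
  then have "matrix_inv g = p_scalar (- n) ** embed_mat l"
    by (metis KZ_sub_GL2 assms matrix_inv_cancel(4) matrix_mul_rid)
  then show ?thesis using h by simp
qed

lemma red_inv: "g \<in> KZ \<Longrightarrow> red (matrix_inv g) ** red g = mat 1"
  by (metis KZ_1(2) KZ_inv KZ_sub_GL2 matrix_inv_GL2(3) red_mult)

text \<open>Turns the Iwahori condition into one over the prime field: \<open>IZ\<close> is the
  preimage of the upper triangular matrices, so closure under products and inverses becomes a
  computation with reductions.\<close>

lemma IZ_iff: "g \<in> IZ \<longleftrightarrow> g \<in> KZ \<and> red g $ 2 $ 1 = 0"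
proof
  assume "g \<in> IZ"
  then show "g \<in> KZ \<and> red g $ 2 $ 1 = 0" unfolding IZ_eq KZ_eq by (auto simp: red_eq)
next
  assume g: "g \<in> KZ \<and> red g $ 2 $ 1 = 0"
  then obtain n k where gk: "g = p_scalar n ** embed_mat k" and k: "det (residue_mat k) \<noteq> 0"
    by (auto simp: KZ_eq)
  with g have "residue (k $ 2 $ 1) = 0" by (simp add: red_eq)
  then show "g \<in> IZ" using gk k by (auto simp: IZ_eq)
qed

lemma IZ_KZ: "g \<in> IZ \<Longrightarrow> g \<in> KZ"
  by (simp add: IZ_iff)

lemma IZ_mult [simp, intro]: "g \<in> IZ \<Longrightarrow> h \<in> IZ \<Longrightarrow> g ** h \<in> IZ"
  by (simp add: IZ_iff matrix_mult_nth_2)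

lemma IZ_1 [simp]: "mat 1 \<in> IZ"
  by (simp add: IZ_iff)

lemma IZ_inv: "g \<in> IZ \<Longrightarrow> matrix_inv g \<in> IZ"
proof -
  assume g: "g \<in> IZ"
  let ?r = "red (matrix_inv g)"
  have k: "g \<in> KZ" using g by (rule IZ_KZ)
  have "?r ** red g = mat 1" using k by (rule red_inv)
  then have "?r $ 2 $ 1 * red g $ 1 $ 1 + ?r $ 2 $ 2 * red g $ 2 $ 1 = 0"
    by (metis matrix_mult_nth_2 mat_nth_2(4))
  moreover have "red g $ 2 $ 1 = 0" using g by (simp add: IZ_iff)
  moreover have "det (red g) \<noteq> 0" using k by (rule det_red)
  ultimately have "?r $ 2 $ 1 = 0" by (auto simp: det_2)
  then show ?thesis using k by (simp add: IZ_iff KZ_inv)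
qed

lemma red_surj:
  assumes "det A \<noteq> 0"
  shows "\<exists>k::'p::prime_card padic ^ 2 ^ 2. k \<in> KZ \<and> red k = A"
proof -
  define k :: "'p padic_int ^ 2 ^ 2" where "k = map_matrix teich A"
  have "residue_mat k = A" by (simp add: k_def vec_eq_iff)
  then show ?thesis using embed_mat_KZ[of k] assms by auto
qed

lemma KZ_same_bottom_row:
  assumes k: "k \<in> KZ" "k' \<in> KZ"
    and t: "red k $ 2 $ 1 = t * red k' $ 2 $ 1" "red k $ 2 $ 2 = t * red k' $ 2 $ 2"
  shows "\<exists>i\<in>IZ. k = i ** k'"
proof -
  define i where "i = k ** matrix_inv k'"
  have i: "i \<in> KZ" using k by (simp add: i_def KZ_inv)
  have e: "k = i ** k'" using k by (simp add: i_def KZ_sub_GL2)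
  let ?c = "red i $ 2 $ 1" and ?d = "red i $ 2 $ 2" and ?r = "red k'"
  have 1: "?c * ?r $ 1 $ 1 + ?d * ?r $ 2 $ 1 = t * ?r $ 2 $ 1"
    and 2: "?c * ?r $ 1 $ 2 + ?d * ?r $ 2 $ 2 = t * ?r $ 2 $ 2"
    using t unfolding e using i k by (simp_all add: matrix_mult_nth_2)
  have "?c * det ?r = (?c * ?r $ 1 $ 1 + ?d * ?r $ 2 $ 1) * ?r $ 2 $ 2
      - (?c * ?r $ 1 $ 2 + ?d * ?r $ 2 $ 2) * ?r $ 2 $ 1"
    by (simp add: det_2 algebra_simps)
  also have "\<dots> = 0" unfolding 1 2 by simp
  finally have "?c * det ?r = 0" .
  then have "?c = 0" using det_red[OF k(2)] by simp
  then show ?thesis using i e by (auto simp: IZ_iff)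
qed

section \<open>The \<open>p\<close>-adic topology\<close>

lemma open_padic_iff:
  "open (U :: 'p::prime_card padic set) \<longleftrightarrow> (\<forall>x\<in>U. \<exists>n. \<forall>b. x + of_padic_int (pint ^ n * b) \<in> U)"
  by (simp only: open_fract_def of_padic_int_def uniformizer_padic_int_def)

definition padic_ball :: "nat \<Rightarrow> 'p::prime_card padic \<Rightarrow> 'p padic set" where
  "padic_ball n x = range (\<lambda>b. x + of_padic_int (pint ^ n * b))"

lemma open_padic_iff_ball: "open (U :: 'p::prime_card padic set) \<longleftrightarrow> (\<forall>x\<in>U. \<exists>n. padic_ball n x \<subseteq> U)"
  unfolding open_padic_iff padic_ball_def by blast

lemma padic_ball_eq: "y \<in> padic_ball n x \<Longrightarrow> padic_ball n y = padic_ball n (x :: 'p::prime_card padic)"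
proof -
  have *: "padic_ball n y \<subseteq> padic_ball n x" if yx: "y \<in> padic_ball n x" for x y :: "'p padic"
  proof
    fix z assume "z \<in> padic_ball n y"
    with yx obtain b c where "z = x + of_padic_int (pint ^ n * b) + of_padic_int (pint ^ n * c)"
      unfolding padic_ball_def by auto
    then have "z = x + of_padic_int (pint ^ n * (b + c))"
      by (simp only: of_padic_int_hom distrib_left add.assoc)
    then show "z \<in> padic_ball n x" unfolding padic_ball_def by blast
  qed
  assume yx: "y \<in> padic_ball n x"
  then obtain b where "y = x + of_padic_int (pint ^ n * b)" unfolding padic_ball_def by blast
  then have "x = y + of_padic_int (pint ^ n * - b)" by simp
  then have "x \<in> padic_ball n y" unfolding padic_ball_def by blast
  then show ?thesis using * yx by blast
qed

lemma centre_in_padic_ball [simp]: "x \<in> padic_ball n (x :: 'p::prime_card padic)"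
  unfolding padic_ball_def by (rule range_eqI[of _ _ 0]) simp

lemma open_padic_ball: "open (padic_ball n (x :: 'p::prime_card padic))"
  unfolding open_padic_iff_ball using padic_ball_eq by blast

lemma padic_ball_mono: "m \<le> n \<Longrightarrow> padic_ball n x \<subseteq> padic_ball m (x :: 'p::prime_card padic)"
proof
  fix y assume mn: "m \<le> n" and "y \<in> padic_ball n x"
  then obtain b where "y = x + of_padic_int (pint ^ n * b)" unfolding padic_ball_def by blast
  moreover have "pint ^ n * b = pint ^ m * (pint ^ (n - m) * b)"
    using mn by (simp add: mult.assoc[symmetric] flip: power_add)
  ultimately show "y \<in> padic_ball m x" unfolding padic_ball_def by (metis (no_types, lifting) rangeI)
qed

lemma padic_ball_of_padic_int:
  "of_padic_int b \<in> padic_ball n (of_padic_int a) \<longleftrightarrow> pint ^ n dvd b - (a :: 'p::prime_card padic_int)"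
proof -
  have "of_padic_int b = of_padic_int a + of_padic_int (pint ^ n * c) \<longleftrightarrow> b - a = pint ^ n * c" for c
    unfolding of_padic_int_hom(1)[symmetric] of_padic_int_inj by (auto simp: algebra_simps)
  then show ?thesis unfolding padic_ball_def dvd_def by blast
qed

text \<open>The next digit of a point selects one of p balls of the next radius. That these are
  finitely many is what compactness needs.\<close>

lemma padic_ball_Suc:
  fixes a :: "'p::prime_card padic_int"
  shows "padic_ball n (of_padic_int a) \<subseteq> (\<Union>r. padic_ball (Suc n) (of_padic_int (a + pint ^ n * teich r)))"
proof
  fix y assume "y \<in> padic_ball n (of_padic_int a)"
  then obtain b where "y = of_padic_int a + of_padic_int (pint ^ n * b)" unfolding padic_ball_def by blast
  then have y: "y = of_padic_int (a + pint ^ n * b)" by simp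
  have "pint dvd b - teich (residue b)" by (rule iffD1[OF residue_eq_iff]) simp
  then have "pint ^ n * pint dvd pint ^ n * (b - teich (residue b))" by (rule mult_dvd_mono[OF dvd_refl])
  then have "pint ^ Suc n dvd (a + pint ^ n * b) - (a + pint ^ n * teich (residue b))"
    by (simp add: algebra_simps)
  then have "y \<in> padic_ball (Suc n) (of_padic_int (a + pint ^ n * teich (residue b)))"
    unfolding y padic_ball_of_padic_int .
  then show "y \<in> (\<Union>r. padic_ball (Suc n) (of_padic_int (a + pint ^ n * teich r)))" by blast
qed

text \<open>If no finite subfamily covers the integers, there is a descending chain of balls none of
  which is finitely covered. Their centres converge to some t, and the member of the cover that
  contains t contains one of these balls, a contradiction.\<close>

lemma compact_padic_int: "compact (range of_padic_int :: 'p::prime_card padic set)"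
  unfolding compact_eq_Heine_Borel
proof (intro allI impI)
  fix C :: "'p padic set set"
  assume C: "(\<forall>c\<in>C. open c) \<and> range of_padic_int \<subseteq> \<Union>C"
  define bad where "bad n a \<longleftrightarrow> \<not> (\<exists>D\<subseteq>C. finite D \<and> padic_ball n (of_padic_int a) \<subseteq> \<Union>D)" for n a
  have step: "\<exists>b. bad (Suc n) b \<and> pint ^ n dvd b - a" if "bad n a" for n a
  proof (rule ccontr)
    assume *: "\<not> (\<exists>b. bad (Suc n) b \<and> pint ^ n dvd b - a)"
    have "\<forall>r. \<not> bad (Suc n) (a + pint ^ n * teich r)" using * by fastforce
    then have "\<forall>r. \<exists>D\<subseteq>C. finite D \<and> padic_ball (Suc n) (of_padic_int (a + pint ^ n * teich r)) \<subseteq> \<Union>D"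
      unfolding bad_def by blast
    then obtain D where D: "\<And>r. D r \<subseteq> C" "\<And>r. finite (D r)"
      "\<And>r. padic_ball (Suc n) (of_padic_int (a + pint ^ n * teich r)) \<subseteq> \<Union>(D r)"
      by metis
    have "padic_ball n (of_padic_int a) \<subseteq> \<Union>(\<Union>(range D))"
    proof
      fix y :: "'p padic" assume "y \<in> padic_ball n (of_padic_int a)"
      then obtain r where "y \<in> padic_ball (Suc n) (of_padic_int (a + pint ^ n * teich r))"
        using padic_ball_Suc[THEN subsetD] by blast
      then have "y \<in> \<Union>(D r)" using D(3)[of r] by (rule subsetD[rotated])
      then show "y \<in> \<Union>(\<Union>(range D))" by blast
    qed
    moreover have "finite (\<Union>(range D))" using D(2) by simp
    moreover have "\<Union>(range D) \<subseteq> C" using D(1) by blast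
    ultimately show False using that unfolding bad_def by blast
  qed
  show "\<exists>D\<subseteq>C. finite D \<and> range of_padic_int \<subseteq> \<Union>D"
  proof (rule ccontr)
    assume neg: "\<not> (\<exists>D\<subseteq>C. finite D \<and> range of_padic_int \<subseteq> \<Union>D)"
    have "bad 0 0" using neg unfolding bad_def padic_ball_def by simp
    then have "\<exists>s. \<forall>n. bad n (s n) \<and> pint ^ n dvd s (Suc n) - s n"
      using dependent_nat_choice[of bad "\<lambda>n a b. pint ^ n dvd b - a"] step by blast
    then obtain s where s: "\<And>n. bad n (s n)" "\<And>n. pint ^ n dvd s (Suc n) - s n" by blast
    obtain t where t: "\<And>n. pint ^ n dvd t - s n" using padic_complete[of s, OF s(2)] by blast
    obtain c where c: "c \<in> C" "of_padic_int t \<in> c" using C by blast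
    then obtain n where n: "padic_ball n (of_padic_int t) \<subseteq> c"
      using C unfolding open_padic_iff_ball by blast
    have "of_padic_int t \<in> padic_ball n (of_padic_int (s n))" using t padic_ball_of_padic_int by blast
    then have "padic_ball n (of_padic_int (s n)) \<subseteq> \<Union>{c}" using n padic_ball_eq by blast
    then show False using s(1)[of n] c(1) unfolding bad_def by blast
  qed
qed

section \<open>The topology of matrices and compactness modulo the centre\<close>

definition close_mats :: "nat \<Rightarrow> 'p::prime_card padic ^ 2 ^ 2 \<Rightarrow> 'p padic ^ 2 ^ 2 \<Rightarrow> bool" where
  "close_mats n A B \<longleftrightarrow> (\<forall>i j. B $ i $ j \<in> padic_ball n (A $ i $ j))"

text \<open>Matrices carry a product topology taken twice. With finitely many entries one radius
  serves all of them, so entrywise congruence modulo p^n gives a neighbourhood basis.\<close>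

lemma open_mats_iff:
  "open (U :: ('p::prime_card padic ^ 2 ^ 2) set) \<longleftrightarrow> (\<forall>A\<in>U. \<exists>n. \<forall>B. close_mats n A B \<longrightarrow> B \<in> U)"
proof
  assume U: "open U"
  show "\<forall>A\<in>U. \<exists>n. \<forall>B. close_mats n A B \<longrightarrow> B \<in> U"
  proof
    fix A assume "A \<in> U"
    with U obtain R where R: "\<And>i. open (R i) \<and> A $ i \<in> R i" "\<And>B. (\<forall>i. B $ i \<in> R i) \<Longrightarrow> B \<in> U"
      using bspec[OF iffD1[OF open_vec_def, OF U]] by blast
    have "\<exists>E. (\<forall>j. open (E j) \<and> A $ i $ j \<in> E j) \<and> (\<forall>r. (\<forall>j. r $ j \<in> E j) \<longrightarrow> r \<in> R i)" for i
      using bspec[OF iffD1[OF open_vec_def], of "R i" "A $ i"] R(1)[of i] by blast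
    then obtain E where E: "\<And>i j. open (E i j) \<and> A $ i $ j \<in> E i j"
      "\<And>i r. (\<forall>j. r $ j \<in> E i j) \<Longrightarrow> r \<in> R i" by metis
    have "\<exists>n. padic_ball n (A $ i $ j) \<subseteq> E i j" for i j
      using E(1) unfolding open_padic_iff_ball by blast
    then obtain n where n: "\<And>i j. padic_ball (n i j) (A $ i $ j) \<subseteq> E i j" by metis
    define N where "N = Max (range (\<lambda>(i, j). n i j))"
    have N: "n i j \<le> N" for i j unfolding N_def by (rule Max_ge) auto
    have "B \<in> U" if B: "close_mats N A B" for B
    proof (rule R(2), intro allI, rule E(2), intro allI)
      fix i j
      show "B $ i $ j \<in> E i j" using B n N padic_ball_mono unfolding close_mats_def by blast
    qed
    then show "\<exists>n. \<forall>B. close_mats n A B \<longrightarrow> B \<in> U" by blast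
  qed
next
  assume U: "\<forall>A\<in>U. \<exists>n. \<forall>B. close_mats n A B \<longrightarrow> B \<in> U"
  show "open U"
  proof (rule iffD2[OF open_vec_def], rule ballI)
    fix A assume "A \<in> U"
    then obtain n where n: "\<And>B. close_mats n A B \<Longrightarrow> B \<in> U" using U by blast
    define R where "R i = {r. \<forall>j. r $ j \<in> padic_ball n (A $ i $ j)}" for i
    have "open (R i)" for i
      unfolding open_vec_def
    proof
      fix r assume "r \<in> R i"
      then show "\<exists>E. (\<forall>j. open (E j) \<and> r $ j \<in> E j) \<and> (\<forall>r'. (\<forall>j. r' $ j \<in> E j) \<longrightarrow> r' \<in> R i)"
        unfolding R_def
        by (intro exI[of _ "\<lambda>j. padic_ball n (A $ i $ j)"]) (auto simp: open_padic_ball)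
    qed
    then show "\<exists>R. (\<forall>i. open (R i) \<and> A $ i \<in> R i) \<and> (\<forall>B. (\<forall>i. B $ i \<in> R i) \<longrightarrow> B \<in> U)"
      by (intro exI[of _ R]) (auto simp: R_def intro!: n[unfolded close_mats_def])
  qed
qed

lemma close_mats_iff: "close_mats n A B \<longleftrightarrow> (\<exists>C. B = A + embed_mat (mat (pint ^ n) ** C))"
proof
  assume "close_mats n A B"
  then have "\<forall>i j. \<exists>c. B $ i $ j = A $ i $ j + of_padic_int (pint ^ n * c)"
    unfolding close_mats_def padic_ball_def by blast
  then obtain c where c: "\<And>i j. B $ i $ j = A $ i $ j + of_padic_int (pint ^ n * c i j)" by metis
  have "B = A + embed_mat (mat (pint ^ n) ** (\<chi> i j. c i j))"
    by (simp add: vec_eq_iff mat_mult_nth c)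
  then show "\<exists>C. B = A + embed_mat (mat (pint ^ n) ** C)" by blast
next
  assume "\<exists>C. B = A + embed_mat (mat (pint ^ n) ** C)"
  then show "close_mats n A B" unfolding close_mats_def padic_ball_def by (auto simp: mat_mult_nth)
qed

text \<open>N clears the denominators of x: as p^N x is integral, right multiplication by x loses at
  most N digits of a congruence.\<close>

lemma close_mats_mult:
  fixes x :: "'p::prime_card padic ^ 2 ^ 2"
  shows "\<exists>N. \<forall>A B n. close_mats (n + N) A B \<longrightarrow> close_mats n (A ** x) (B ** x)"
proof -
  have "\<exists>N y. p_adic ^ N * x $ i $ j = of_padic_int y" for i j
    using padic_integral_multiple by blast
  then obtain N where N: "\<And>i j. \<exists>y. p_adic ^ N i j * x $ i $ j = of_padic_int y" by metis
  define M where "M = N 1 1 + N 1 2 + N 2 1 + N 2 2"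
  have "\<exists>y. p_adic ^ M * x $ i $ j = of_padic_int y" for i j
  proof -
    have "N i j \<le> M" using exhaust_2[of i] exhaust_2[of j] by (auto simp: M_def)
    then have e: "p_adic ^ M * x $ i $ j = p_adic ^ (M - N i j) * (p_adic ^ N i j * x $ i $ j)"
      by (simp add: mult.assoc[symmetric] flip: power_add)
    obtain y where y: "p_adic ^ N i j * x $ i $ j = of_padic_int y" using N by blast
    have "p_adic ^ M * x $ i $ j = of_padic_int (pint ^ (M - N i j) * y)"
      unfolding e y by (simp add: p_adic_def)
    then show ?thesis by blast
  qed
  then obtain y where y: "\<And>i j. p_adic ^ M * x $ i $ j = of_padic_int (y i j)" by metis
  have "close_mats n (A ** x) (B ** x)" if AB: "close_mats (n + M) A B" for A B n
  proof -
    obtain C where C: "B = A + embed_mat (mat (pint ^ (n + M)) ** C)" using AB close_mats_iff by blast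
    define D where "D = C ** (\<chi> i j. y i j)"
    have "B ** x = A ** x + embed_mat (mat (pint ^ (n + M)) ** C) ** x"
      unfolding C by (rule mat2_eqI) (simp_all add: matrix_mult_nth_2 algebra_simps)
    also have "embed_mat (mat (pint ^ (n + M)) ** C) ** x = embed_mat (mat (pint ^ n) ** D)"
      by (rule mat2_eqI)
        (simp_all add: D_def matrix_mult_nth_2 y[symmetric] power_add p_adic_def algebra_simps)
    finally show ?thesis unfolding close_mats_iff by blast
  qed
  then show ?thesis by blast
qed

lemma continuous_on_mult_right: "continuous_on S (\<lambda>A :: 'p padic ^ 2 ^ 2. A ** (x :: 'p::prime_card padic ^ 2 ^ 2))"
proof -
  have "open ((\<lambda>A :: 'p padic ^ 2 ^ 2. A ** x) -` U)" if "open U" for U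
  proof -
    obtain N where N: "\<And>A B n. close_mats (n + N) A B \<Longrightarrow> close_mats n (A ** x) (B ** x)"
      using close_mats_mult by blast
    show ?thesis unfolding open_mats_iff
    proof
      fix A assume "A \<in> (\<lambda>A. A ** x) -` U"
      then obtain n where "\<And>B. close_mats n (A ** x) B \<Longrightarrow> B \<in> U" using \<open>open U\<close> unfolding open_mats_iff by auto
      then show "\<exists>n. \<forall>B. close_mats n A B \<longrightarrow> B \<in> (\<lambda>A. A ** x) -` U" using N by blast
    qed
  qed
  then have "continuous_on UNIV (\<lambda>A :: 'p padic ^ 2 ^ 2. A ** x)" by (simp add: continuous_on_open_vimage)
  then show ?thesis by (rule continuous_on_subset) simp
qed

text \<open>Integrality and the reduction modulo p are stable under congruence modulo p. This makes
  \<open>Kmax\<close> closed and the cosets of \<open>Iwahori\<close> open.\<close>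

lemma close_mats_embed:
  assumes "close_mats (Suc 0) (embed_mat k) B"
  shows "\<exists>l. B = embed_mat l \<and> residue_mat l = residue_mat k"
proof -
  obtain C where "B = embed_mat k + embed_mat (mat (pint ^ Suc 0) ** C)"
    using assms close_mats_iff by blast
  then have "B = embed_mat (k + mat pint ** C)" by (simp add: vec_eq_iff)
  moreover have "residue_mat (k + mat pint ** C) = residue_mat k"
    by (simp add: vec_eq_iff mat_mult_nth residue_add residue_mult)
  ultimately show ?thesis by blast
qed

lemma close_mats_sym: "close_mats n A B \<Longrightarrow> close_mats n B A"
  unfolding close_mats_def using padic_ball_eq centre_in_padic_ball by metis

text \<open>The integral matrices are the continuous image of four copies of the compact ring of
  p-adic integers, and \<open>Kmax\<close> is a closed subset of them.\<close>

lemma compact_Kmax: "compact (Kmax :: ('p::prime_card padic ^ 2 ^ 2) set)"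
proof -
  define f :: "('p padic \<times> 'p padic) \<times> ('p padic \<times> 'p padic) \<Rightarrow> 'p padic ^ 2 ^ 2"
    where "f = (\<lambda>x. \<chi> i. \<chi> j. if i = 1 then (if j = 1 then fst (fst x) else snd (fst x))
        else (if j = 1 then fst (snd x) else snd (snd x)))"
  have "continuous_on UNIV (\<lambda>x :: ('p padic \<times> 'p padic) \<times> ('p padic \<times> 'p padic).
      if i = 1 then (if j = 1 then fst (fst x) else snd (fst x))
        else (if j = 1 then fst (snd x) else snd (snd x)))" for i j :: 2
    by (cases "i = 1"; cases "j = 1") (auto intro!: continuous_intros)
  then have "continuous_on UNIV f" unfolding f_def by (intro continuous_on_vec_lambda)
  then have "compact (f ` ((range of_padic_int \<times> range of_padic_int) \<times> (range of_padic_int \<times> range of_padic_int)))"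
    by (intro compact_continuous_image compact_Times compact_padic_int) (auto intro: continuous_on_subset)
  moreover have "closed (Kmax :: ('p padic ^ 2 ^ 2) set)"
    unfolding closed_def open_mats_iff
  proof
    fix A :: "'p padic ^ 2 ^ 2" assume A: "A \<in> - Kmax"
    have "B \<notin> Kmax" if "close_mats (Suc 0) A B" for B
    proof
      assume "B \<in> Kmax"
      then obtain k where k: "B = embed_mat k" "det (residue_mat k) \<noteq> 0"
        by (auto simp: Kmax_def invertible_iff_residue)
      then obtain l where "A = embed_mat l" "residue_mat l = residue_mat k"
        using close_mats_embed close_mats_sym \<open>close_mats (Suc 0) A B\<close> by blast
      then have "A \<in> Kmax" using k by (auto simp: Kmax_def invertible_iff_residue)
      then show False using A by simp
    qed
    then show "\<exists>n. \<forall>B. close_mats n A B \<longrightarrow> B \<in> - Kmax" by blast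
  qed
  ultimately have "compact (f ` ((range of_padic_int \<times> range of_padic_int) \<times> (range of_padic_int \<times> range of_padic_int)) \<inter> Kmax)"
    by (rule compact_Int_closed)
  moreover have "Kmax \<subseteq> f ` ((range of_padic_int \<times> range of_padic_int) \<times> (range of_padic_int \<times> range of_padic_int))"
  proof
    fix A :: "'p padic ^ 2 ^ 2" assume "A \<in> Kmax"
    then obtain k where "A = embed_mat k" by (auto simp: Kmax_def)
    then have "A = f ((of_padic_int (k $ 1 $ 1), of_padic_int (k $ 1 $ 2)), (of_padic_int (k $ 2 $ 1), of_padic_int (k $ 2 $ 2)))"
      by (intro mat2_eqI) (simp_all add: f_def)
    then show "A \<in> f ` ((range of_padic_int \<times> range of_padic_int) \<times> (range of_padic_int \<times> range of_padic_int))" by blast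
  qed
  ultimately show ?thesis by (simp add: Int_absorb1)
qed

lemma open_Iwahori_coset:
  assumes "x \<in> GL2"
  shows "open ((\<lambda>i. i ** x) ` Iwahori)"
proof -
  obtain N where N: "\<And>A B n. close_mats (n + N) A B \<Longrightarrow> close_mats n (A ** matrix_inv x) (B ** matrix_inv x)"
    using close_mats_mult by blast
  have "B \<in> (\<lambda>i. i ** x) ` Iwahori" if i: "i \<in> Iwahori" and B: "close_mats (Suc 0 + N) (i ** x) B" for i B
  proof -
    obtain k where k: "i = embed_mat k" "det (residue_mat k) \<noteq> 0" "residue_mat k $ 2 $ 1 = 0"
      using i by (auto simp: Iwahori_def invertible_iff_residue)
    have "close_mats (Suc 0) i (B ** matrix_inv x)" using N[OF B] assms by simp
    then obtain l where l: "B ** matrix_inv x = embed_mat l" "residue_mat l = residue_mat k"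
      using close_mats_embed unfolding k by blast
    then have "residue (l $ 2 $ 1) = 0" using k by (metis nth_map_matrix)
    then have "B ** matrix_inv x \<in> Iwahori" using k l by (auto simp: Iwahori_def invertible_iff_residue)
    then have "B ** matrix_inv x ** x \<in> (\<lambda>i. i ** x) ` Iwahori" by blast
    then show ?thesis using assms by simp
  qed
  then show ?thesis unfolding open_mats_iff by blast
qed

lemma Zcent_commute: "z \<in> Zcent \<Longrightarrow> z ** A = A ** (z :: 'p::prime_card padic ^ 2 ^ 2)"
  by (auto simp: Zcent_eq mat_mult_commute)

text \<open>The open cosets of \<open>Iwahori\<close> through the points of C cover C, so finitely
  many suffice; a central factor moves past the representative and is absorbed into
  \<open>IZ\<close>.\<close>

lemma compact_mod_Z_imp_finite:
  assumes "compact_mod_Z A"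
  shows "\<exists>F\<subseteq>GL2. finite F \<and> A \<subseteq> {h ** x |h x. h \<in> IZ \<and> x \<in> F}"
proof -
  obtain C where C: "C \<subseteq> GL2" "compact C" "A \<subseteq> {c ** z |c z. c \<in> C \<and> z \<in> Zcent}"
    using assms unfolding compact_mod_Z_def by blast
  have "mat 1 \<in> Iwahori" unfolding Iwahori_def
    by (auto simp: invertible_iff_residue intro!: exI[of _ "mat 1"])
  then have "x \<in> (\<lambda>i. i ** x) ` Iwahori" for x :: "'a padic ^ 2 ^ 2"
    by (metis imageI matrix_mul_lid)
  then have cover: "C \<subseteq> (\<Union>x\<in>C. (\<lambda>i. i ** x) ` Iwahori)" by blast
  have "open ((\<lambda>i. i ** x) ` Iwahori)" if "x \<in> C" for x
    using open_Iwahori_coset that C(1) by blast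
  from compactE_image[OF C(2) this cover] obtain F where
    F: "F \<subseteq> C" "finite F" "C \<subseteq> (\<Union>x\<in>F. (\<lambda>i. i ** x) ` Iwahori)" by blast
  have "A \<subseteq> {h ** x |h x. h \<in> IZ \<and> x \<in> F}"
  proof
    fix a assume "a \<in> A"
    then obtain c z where a: "a = c ** z" "c \<in> C" "z \<in> Zcent" using C by blast
    then obtain i x where ix: "c = i ** x" "i \<in> Iwahori" "x \<in> F" using F by blast
    have "a = (i ** z) ** x"
      unfolding a ix using Zcent_commute[OF a(3), of x] by (simp add: matrix_mul_assoc[symmetric])
    moreover have "i ** z \<in> IZ" using ix a unfolding IZ_def by blast
    ultimately show "a \<in> {h ** x |h x. h \<in> IZ \<and> x \<in> F}" using ix by blast
  qed
  then show ?thesis using F C by (meson order_trans)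
qed

text \<open>The compact set is the finite union of the translates of \<open>Kmax\<close> by the
  points of F.\<close>

lemma finite_imp_compact_mod_Z:
  assumes F: "finite F" "F \<subseteq> GL2" and A: "A \<subseteq> {h ** x |h x. h \<in> KZ \<and> x \<in> F}"
  shows "compact_mod_Z A"
  unfolding compact_mod_Z_def
proof (intro exI conjI)
  let ?C = "\<Union>x\<in>F. (\<lambda>k. k ** x) ` Kmax"
  show "compact ?C"
    using F by (intro compact_UN compact_continuous_image continuous_on_mult_right compact_Kmax) auto
  have "Kmax \<subseteq> KZ" using embed_mat_KZ by (auto simp: Kmax_def invertible_iff_residue)
  then show "?C \<subseteq> GL2"
    using F(2) by (auto simp: subset_iff KZ_sub_GL2 intro!: GL2_mult)
  show "A \<subseteq> {c ** z |c z. c \<in> ?C \<and> z \<in> Zcent}"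
  proof
    fix a assume "a \<in> A"
    then obtain h x where a: "a = h ** x" "h \<in> KZ" "x \<in> F" using A by blast
    then obtain k z where h: "h = k ** z" "k \<in> Kmax" "z \<in> Zcent" unfolding KZ_def by blast
    have "a = (k ** x) ** z"
      unfolding a h using Zcent_commute[OF h(3), of x] by (simp add: matrix_mul_assoc[symmetric])
    then show "a \<in> {c ** z |c z. c \<in> ?C \<and> z \<in> Zcent}" using a h by blast
  qed
qed

section \<open>Representations and quotients\<close>

locale representation = abelian_group M
  for M :: "('k, 'v, 'p::prime_card padic ^ 2 ^ 2) rep" (structure) and H :: "('p padic ^ 2 ^ 2) set" +
  assumes H_GL2: "g \<in> H \<Longrightarrow> g \<in> GL2"
    and H_one [simp]: "mat 1 \<in> H"
    and H_mult [simp, intro]: "g \<in> H \<Longrightarrow> h \<in> H \<Longrightarrow> g ** h \<in> H"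
    and H_inv [simp, intro]: "g \<in> H \<Longrightarrow> matrix_inv g \<in> H"
    and smult_closed [simp, intro]: "x \<in> carrier M \<Longrightarrow> c \<odot> x \<in> carrier M"
    and smult_add: "x \<in> carrier M \<Longrightarrow> y \<in> carrier M \<Longrightarrow> c \<odot> (x \<oplus> y) = c \<odot> x \<oplus> c \<odot> y"
    and act_closed [simp, intro]: "g \<in> H \<Longrightarrow> x \<in> carrier M \<Longrightarrow> act M g x \<in> carrier M"
    and act_add: "g \<in> H \<Longrightarrow> x \<in> carrier M \<Longrightarrow> y \<in> carrier M \<Longrightarrow> act M g (x \<oplus> y) = act M g x \<oplus> act M g y"
    and act_smult: "g \<in> H \<Longrightarrow> x \<in> carrier M \<Longrightarrow> act M g (c \<odot> x) = c \<odot> act M g x"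
    and act_mult: "g \<in> H \<Longrightarrow> h \<in> H \<Longrightarrow> x \<in> carrier M \<Longrightarrow> act M (g ** h) x = act M g (act M h x)"
    and act_one: "x \<in> carrier M \<Longrightarrow> act M (mat 1) x = x"
begin

lemma additive_zero:
  assumes "f \<zero> \<in> carrier M" "f (\<zero> \<oplus> \<zero>) = f \<zero> \<oplus> f \<zero>"
  shows "f \<zero> = \<zero>"
  using assms by (simp add: add.l_cancel_one')

lemma smult_zero [simp]: "c \<odot> \<zero> = \<zero>"
  by (rule additive_zero) (simp_all add: smult_add[symmetric])

lemma act_zero [simp]: "g \<in> H \<Longrightarrow> act M g \<zero> = \<zero>"
  by (rule additive_zero) (simp_all add: act_add[symmetric])

lemma act_inv:
  assumes "g \<in> H" "x \<in> carrier M"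
  shows "act M (matrix_inv g) (act M g x) = x" "act M g (act M (matrix_inv g) x) = x"
  using assms by (simp_all add: act_mult[symmetric] matrix_inv_GL2 H_GL2 act_one)

end

lemma rep_homD:
  assumes "\<phi> \<in> rep_hom H M N"
  shows "x \<in> carrier M \<Longrightarrow> \<phi> x \<in> carrier N"
    and "x \<in> carrier M \<Longrightarrow> y \<in> carrier M \<Longrightarrow> \<phi> (x \<oplus>\<^bsub>M\<^esub> y) = \<phi> x \<oplus>\<^bsub>N\<^esub> \<phi> y"
    and "x \<in> carrier M \<Longrightarrow> \<phi> (c \<odot>\<^bsub>M\<^esub> x) = c \<odot>\<^bsub>N\<^esub> \<phi> x"
    and "g \<in> H \<Longrightarrow> x \<in> carrier M \<Longrightarrow> \<phi> (act M g x) = act N g (\<phi> x)"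
    and "\<phi> \<in> extensional (carrier M)"
  using assms by (auto simp: rep_hom_def PiE_def)

lemma rep_homI:
  assumes "\<And>x. x \<in> carrier M \<Longrightarrow> \<phi> x \<in> carrier N"
    and "\<And>x y. x \<in> carrier M \<Longrightarrow> y \<in> carrier M \<Longrightarrow> \<phi> (x \<oplus>\<^bsub>M\<^esub> y) = \<phi> x \<oplus>\<^bsub>N\<^esub> \<phi> y"
    and "\<And>c x. x \<in> carrier M \<Longrightarrow> \<phi> (c \<odot>\<^bsub>M\<^esub> x) = c \<odot>\<^bsub>N\<^esub> \<phi> x"
    and "\<And>g x. g \<in> H \<Longrightarrow> x \<in> carrier M \<Longrightarrow> \<phi> (act M g x) = act N g (\<phi> x)"
    and "\<phi> \<in> extensional (carrier M)"
  shows "\<phi> \<in> rep_hom H M N"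
  using assms by (auto simp: rep_hom_def PiE_def)

lemma rep_hom_restrictI:
  assumes "representation M H"
    and "\<And>x. x \<in> carrier M \<Longrightarrow> \<phi> x \<in> carrier N"
    and "\<And>x y. x \<in> carrier M \<Longrightarrow> y \<in> carrier M \<Longrightarrow> \<phi> (x \<oplus>\<^bsub>M\<^esub> y) = \<phi> x \<oplus>\<^bsub>N\<^esub> \<phi> y"
    and "\<And>c x. x \<in> carrier M \<Longrightarrow> \<phi> (c \<odot>\<^bsub>M\<^esub> x) = c \<odot>\<^bsub>N\<^esub> \<phi> x"
    and "\<And>g x. g \<in> H \<Longrightarrow> x \<in> carrier M \<Longrightarrow> \<phi> (act M g x) = act N g (\<phi> x)"
  shows "restrict \<phi> (carrier M) \<in> rep_hom H M N"
proof -
  interpret representation M H by fact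
  show ?thesis by (rule rep_homI) (simp_all add: assms)
qed

lemma rep_hom_compose:
  assumes "\<phi> \<in> rep_hom H M N" "\<psi> \<in> rep_hom H N L" and M: "representation M H"
  shows "compose (carrier M) \<psi> \<phi> \<in> rep_hom H M L"
  unfolding compose_def
  by (rule rep_hom_restrictI[OF M]) (simp_all add: rep_homD[OF assms(1)] rep_homD[OF assms(2)])

lemma rep_hom_zero:
  assumes "\<phi> \<in> rep_hom H M N" "representation M H" "representation N H"
  shows "\<phi> \<zero>\<^bsub>M\<^esub> = \<zero>\<^bsub>N\<^esub>"
proof -
  interpret M: representation M H by fact
  interpret N: representation N H by fact
  have "\<phi> \<zero>\<^bsub>M\<^esub> \<oplus>\<^bsub>N\<^esub> \<phi> \<zero>\<^bsub>M\<^esub> = \<phi> \<zero>\<^bsub>M\<^esub>"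
    using rep_homD(2)[OF assms(1), of "\<zero>\<^bsub>M\<^esub>" "\<zero>\<^bsub>M\<^esub>"] by simp
  then show ?thesis using rep_homD(1)[OF assms(1), of "\<zero>\<^bsub>M\<^esub>"] by (simp add: N.add.l_cancel_one')
qed

lemma rep_hom_minus:
  assumes "\<phi> \<in> rep_hom H M N" "representation M H" "representation N H"
    and x: "x \<in> carrier M" "y \<in> carrier M"
  shows "\<phi> (x \<ominus>\<^bsub>M\<^esub> y) = \<phi> x \<ominus>\<^bsub>N\<^esub> \<phi> y"
proof -
  interpret M: representation M H by fact
  interpret N: representation N H by fact
  have c: "\<phi> y \<in> carrier N" "\<phi> (x \<ominus>\<^bsub>M\<^esub> y) \<in> carrier N" "\<phi> x \<in> carrier N"
    using rep_homD(1)[OF assms(1)] x by simp_all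
  have "(x \<ominus>\<^bsub>M\<^esub> y) \<oplus>\<^bsub>M\<^esub> y = x" using x by (simp add: M.minus_eq M.a_assoc M.l_neg)
  then have "\<phi> (x \<ominus>\<^bsub>M\<^esub> y) \<oplus>\<^bsub>N\<^esub> \<phi> y = \<phi> x"
    using rep_homD(2)[OF assms(1), of "x \<ominus>\<^bsub>M\<^esub> y" y] x by simp
  then show ?thesis using c by (metis N.add.inv_solve_right' N.minus_eq)
qed

lemma rep_hom_finsum:
  assumes "\<phi> \<in> rep_hom H M N" "representation M H" "representation N H"
    and "finite A" "\<And>a. a \<in> A \<Longrightarrow> f a \<in> carrier M"
  shows "\<phi> (\<Oplus>\<^bsub>M\<^esub>a\<in>A. f a) = (\<Oplus>\<^bsub>N\<^esub>a\<in>A. \<phi> (f a))"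
proof -
  interpret M: representation M H by fact
  interpret N: representation N H by fact
  show ?thesis
    using assms(4,5)
  proof (induction A)
    case empty
    then show ?case by (simp add: rep_hom_zero[OF assms(1-3)])
  next
    case (insert a A)
    have "(\<Oplus>\<^bsub>M\<^esub>a\<in>insert a A. f a) = f a \<oplus>\<^bsub>M\<^esub> (\<Oplus>\<^bsub>M\<^esub>a\<in>A. f a)"
      using insert by (intro M.finsum_insert) auto
    moreover have "(\<Oplus>\<^bsub>N\<^esub>a\<in>insert a A. \<phi> (f a)) = \<phi> (f a) \<oplus>\<^bsub>N\<^esub> (\<Oplus>\<^bsub>N\<^esub>a\<in>A. \<phi> (f a))"
      using insert rep_homD(1)[OF assms(1)] by (intro N.finsum_insert) auto
    moreover have "(\<Oplus>\<^bsub>M\<^esub>a\<in>A. f a) \<in> carrier M" using insert by (intro M.finsum_closed) auto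
    ultimately show ?case using insert rep_homD(2)[OF assms(1)] by simp
  qed
qed

locale quotient_by_kernel =
  M: representation M H + Q: representation Q H
  for M :: "('k, 'v, 'p::prime_card padic ^ 2 ^ 2) rep" (structure)
    and Q :: "('k, 'w, 'p padic ^ 2 ^ 2) rep" and H +
  fixes \<phi> N
  assumes hom: "\<phi> \<in> rep_hom H M Q"
    and N: "N = {x \<in> carrier M. \<phi> x = \<zero>\<^bsub>Q\<^esub>}"
begin

text \<open>Cosets of the kernel are fibres of \<phi>. Well-definedness of every operation on the
  quotient thereby becomes an equation in Q.\<close>

lemma coset_eq:
  assumes x: "x \<in> carrier M"
  shows "N +>\<^bsub>M\<^esub> x = {y \<in> carrier M. \<phi> y = \<phi> x}"
proof (intro equalityI subsetI)
  fix y assume "y \<in> N +>\<^bsub>M\<^esub> x"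
  then show "y \<in> {y \<in> carrier M. \<phi> y = \<phi> x}"
    using x rep_homD(1,2)[OF hom] by (auto simp: a_r_coset_def' N)
next
  fix y assume y: "y \<in> {y \<in> carrier M. \<phi> y = \<phi> x}"
  then have "\<phi> (y \<ominus> x) = \<zero>\<^bsub>Q\<^esub>"
    using x rep_homD(1)[OF hom] by (simp add: rep_hom_minus[OF hom M.representation_axioms Q.representation_axioms]
        Q.minus_eq Q.r_neg)
  then have "y \<ominus> x \<in> N" using x y by (simp add: N)
  moreover have "y = (y \<ominus> x) \<oplus> x" using x y by (simp add: M.minus_eq M.a_assoc M.l_neg)
  ultimately show "y \<in> N +>\<^bsub>M\<^esub> x" by (auto simp: a_r_coset_def')
qed

lemma coset_eq_iff: "x \<in> carrier M \<Longrightarrow> y \<in> carrier M \<Longrightarrow> N +>\<^bsub>M\<^esub> x = N +>\<^bsub>M\<^esub> y \<longleftrightarrow> \<phi> x = \<phi> y"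
  by (auto simp: coset_eq)

lemma carrier_quot: "carrier (quot_rep M N) = {N +>\<^bsub>M\<^esub> x |x. x \<in> carrier M}"
  by (auto simp: quot_rep_def A_RCOSETS_def')

lemma quot_carrierE:
  assumes "A \<in> carrier (quot_rep M N)"
  obtains x where "x \<in> carrier M" "A = N +>\<^bsub>M\<^esub> x"
  using assms by (auto simp: carrier_quot)

lemma coset_carrier [simp]: "x \<in> carrier M \<Longrightarrow> N +>\<^bsub>M\<^esub> x \<in> carrier (quot_rep M N)"
  by (auto simp: carrier_quot)

lemma coset_add:
  assumes x: "x \<in> carrier M" "y \<in> carrier M"
  shows "(N +>\<^bsub>M\<^esub> x) \<oplus>\<^bsub>quot_rep M N\<^esub> (N +>\<^bsub>M\<^esub> y) = N +>\<^bsub>M\<^esub> (x \<oplus> y)"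
proof -
  have "{a \<in> carrier M. \<phi> a = \<phi> x} <+>\<^bsub>M\<^esub> {b \<in> carrier M. \<phi> b = \<phi> y} = {z \<in> carrier M. \<phi> z = \<phi> (x \<oplus> y)}"
  proof (intro equalityI subsetI)
    fix z assume "z \<in> {a \<in> carrier M. \<phi> a = \<phi> x} <+>\<^bsub>M\<^esub> {b \<in> carrier M. \<phi> b = \<phi> y}"
    then show "z \<in> {z \<in> carrier M. \<phi> z = \<phi> (x \<oplus> y)}"
      using x rep_homD(2)[OF hom] by (auto simp: set_add_def')
  next
    fix z assume z: "z \<in> {z \<in> carrier M. \<phi> z = \<phi> (x \<oplus> y)}"
    then have "\<phi> (z \<ominus> x) = \<phi> y"
      using x rep_homD(1,2)[OF hom]
      by (simp add: rep_hom_minus[OF hom M.representation_axioms Q.representation_axioms]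
        Q.minus_eq Q.a_assoc Q.a_lcomm[of "\<phi> x" "\<phi> y"] Q.r_neg)
    moreover have "z = x \<oplus> (z \<ominus> x)"
      using x z M.a_lcomm[of x z "\<ominus> x"] by (simp add: M.minus_eq M.r_neg)
    ultimately show "z \<in> {a \<in> carrier M. \<phi> a = \<phi> x} <+>\<^bsub>M\<^esub> {b \<in> carrier M. \<phi> b = \<phi> y}"
      using x z unfolding set_add_def'
      by (intro UN_I[of x] UN_I[of "z \<ominus> x"]) auto
  qed
  then show ?thesis using x by (simp add: coset_eq quot_rep_def)
qed

lemma coset_smult:
  assumes x: "x \<in> carrier M"
  shows "c \<odot>\<^bsub>quot_rep M N\<^esub> (N +>\<^bsub>M\<^esub> x) = N +>\<^bsub>M\<^esub> (c \<odot> x)"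
proof -
  have "N <+>\<^bsub>M\<^esub> ((\<odot>) c ` {y \<in> carrier M. \<phi> y = \<phi> x}) = {z \<in> carrier M. \<phi> z = \<phi> (c \<odot> x)}"
  proof (intro equalityI subsetI)
    fix z assume "z \<in> N <+>\<^bsub>M\<^esub> ((\<odot>) c ` {y \<in> carrier M. \<phi> y = \<phi> x})"
    then show "z \<in> {z \<in> carrier M. \<phi> z = \<phi> (c \<odot> x)}"
      using x rep_homD(1,2,3)[OF hom] by (auto simp: set_add_def' N)
  next
    fix z assume z: "z \<in> {z \<in> carrier M. \<phi> z = \<phi> (c \<odot> x)}"
    then have "z \<in> N +>\<^bsub>M\<^esub> (c \<odot> x)" using x by (simp add: coset_eq)
    then show "z \<in> N <+>\<^bsub>M\<^esub> ((\<odot>) c ` {y \<in> carrier M. \<phi> y = \<phi> x})"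
      using x by (auto simp: set_add_def' a_r_coset_def')
  qed
  then show ?thesis using x by (simp add: coset_eq quot_rep_def)
qed

lemma coset_act:
  assumes g: "g \<in> H" and x: "x \<in> carrier M"
  shows "act (quot_rep M N) g (N +>\<^bsub>M\<^esub> x) = N +>\<^bsub>M\<^esub> act M g x"
proof -
  have "act M g ` {y \<in> carrier M. \<phi> y = \<phi> x} = {z \<in> carrier M. \<phi> z = \<phi> (act M g x)}"
  proof (intro equalityI subsetI)
    fix z assume "z \<in> act M g ` {y \<in> carrier M. \<phi> y = \<phi> x}"
    then show "z \<in> {z \<in> carrier M. \<phi> z = \<phi> (act M g x)}"
      using g x rep_homD(4)[OF hom] by auto
  next
    fix z assume z: "z \<in> {z \<in> carrier M. \<phi> z = \<phi> (act M g x)}"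
    have "\<phi> (act M (matrix_inv g) z) = \<phi> x"
      using z g x rep_homD(1,4)[OF hom] by (simp add: Q.act_inv)
    moreover have "z = act M g (act M (matrix_inv g) z)" using z g by (simp add: M.act_inv)
    ultimately show "z \<in> act M g ` {y \<in> carrier M. \<phi> y = \<phi> x}" using z g by blast
  qed
  then show ?thesis using x g by (simp add: coset_eq quot_rep_def)
qed

lemma coset_zero: "\<zero>\<^bsub>quot_rep M N\<^esub> = N +>\<^bsub>M\<^esub> \<zero>"
  using rep_hom_zero[OF hom M.representation_axioms Q.representation_axioms]
  by (simp add: coset_eq) (simp add: N quot_rep_def)

lemma representation_quot: "representation (quot_rep M N) H"
proof -
  have "abelian_group (quot_rep M N)"
  proof (rule abelian_groupI)
    show "\<zero>\<^bsub>quot_rep M N\<^esub> \<in> carrier (quot_rep M N)" by (simp add: coset_zero)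
    fix A assume A: "A \<in> carrier (quot_rep M N)"
    then obtain x where x: "x \<in> carrier M" "A = N +>\<^bsub>M\<^esub> x" by (rule quot_carrierE)
    show "\<zero>\<^bsub>quot_rep M N\<^esub> \<oplus>\<^bsub>quot_rep M N\<^esub> A = A"
      using x by (simp add: coset_zero coset_add)
    have "(N +>\<^bsub>M\<^esub> (\<ominus> x)) \<oplus>\<^bsub>quot_rep M N\<^esub> A = \<zero>\<^bsub>quot_rep M N\<^esub>"
      using x by (simp add: coset_zero coset_add M.l_neg)
    then show "\<exists>B\<in>carrier (quot_rep M N). B \<oplus>\<^bsub>quot_rep M N\<^esub> A = \<zero>\<^bsub>quot_rep M N\<^esub>"
      using x by (intro bexI[of _ "N +>\<^bsub>M\<^esub> (\<ominus> x)"]) auto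
    fix B assume "B \<in> carrier (quot_rep M N)"
    then obtain y where y: "y \<in> carrier M" "B = N +>\<^bsub>M\<^esub> y" by (rule quot_carrierE)
    show "A \<oplus>\<^bsub>quot_rep M N\<^esub> B \<in> carrier (quot_rep M N)" using x y by (simp add: coset_add)
    show "A \<oplus>\<^bsub>quot_rep M N\<^esub> B = B \<oplus>\<^bsub>quot_rep M N\<^esub> A" using x y by (simp add: coset_add M.a_comm)
    fix C assume "C \<in> carrier (quot_rep M N)"
    then obtain z where z: "z \<in> carrier M" "C = N +>\<^bsub>M\<^esub> z" by (rule quot_carrierE)
    show "A \<oplus>\<^bsub>quot_rep M N\<^esub> B \<oplus>\<^bsub>quot_rep M N\<^esub> C = A \<oplus>\<^bsub>quot_rep M N\<^esub> (B \<oplus>\<^bsub>quot_rep M N\<^esub> C)"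
      using x y z by (simp add: coset_add M.a_assoc)
  qed
  then show ?thesis
    by (intro representation.intro representation_axioms.intro; (elim quot_carrierE)?)
      (simp_all add: coset_add coset_smult coset_act M.smult_add M.act_add M.act_smult M.act_mult M.act_one M.H_GL2)
qed

lemma induced_coset:
  assumes x: "x \<in> carrier M" and f: "\<And>y. y \<in> carrier M \<Longrightarrow> \<phi> y = \<phi> x \<Longrightarrow> f y = f x"
  shows "induced M N f (N +>\<^bsub>M\<^esub> x) = f x"
proof -
  have "f ` (N +>\<^bsub>M\<^esub> x) = {f x}"
    unfolding coset_eq[OF x] using x by (auto intro: f)
  moreover have "N +>\<^bsub>M\<^esub> x \<in> a_rcosets\<^bsub>M\<^esub> N" using coset_carrier[OF x] by (simp add: quot_rep_def)
  ultimately show ?thesis by (simp add: induced_def)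
qed

lemma induced_hom_coset [simp]: "x \<in> carrier M \<Longrightarrow> induced M N \<phi> (N +>\<^bsub>M\<^esub> x) = \<phi> x"
  by (rule induced_coset)

lemma induced_rep_hom: "induced M N \<phi> \<in> rep_hom H (quot_rep M N) Q"
proof (rule rep_homI)
  show "induced M N \<phi> \<in> extensional (carrier (quot_rep M N))"
    by (simp add: induced_def quot_rep_def)
qed (auto simp: coset_add coset_smult coset_act rep_homD[OF hom] elim!: quot_carrierE)

lemma induced_rep_iso:
  assumes surj: "\<And>y. y \<in> carrier Q \<Longrightarrow> \<exists>x\<in>carrier M. \<phi> x = y"
  shows "induced M N \<phi> \<in> rep_iso H (quot_rep M N) Q"
proof -
  have "bij_betw (induced M N \<phi>) (carrier (quot_rep M N)) (carrier Q)"
    unfolding bij_betw_def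
  proof
    show "inj_on (induced M N \<phi>) (carrier (quot_rep M N))"
      by (rule inj_onI) (elim quot_carrierE, simp add: coset_eq_iff)
    show "induced M N \<phi> ` carrier (quot_rep M N) = carrier Q"
    proof (intro equalityI subsetI)
      fix y assume "y \<in> carrier Q"
      then obtain x where "x \<in> carrier M" "\<phi> x = y" using surj by blast
      then have "induced M N \<phi> (N +>\<^bsub>M\<^esub> x) = y" "N +>\<^bsub>M\<^esub> x \<in> carrier (quot_rep M N)" by simp_all
      then show "y \<in> induced M N \<phi> ` carrier (quot_rep M N)" by blast
    qed (use rep_homD(1)[OF induced_rep_hom] in blast)
  qed
  then show ?thesis using induced_rep_hom by (simp add: rep_iso_def)
qed

text \<open>The relation between S and T also makes the induced operator well defined: \<phi> (S x)
  depends on x only through \<phi> x.\<close>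

lemma induced_op_intertwines:
  assumes S: "\<And>x. x \<in> carrier M \<Longrightarrow> S x \<in> carrier M"
    and ST: "\<And>x. x \<in> carrier M \<Longrightarrow> \<phi> (S x) = T (\<phi> x)"
    and A: "A \<in> carrier (quot_rep M N)"
  shows "induced M N \<phi> (induced_op M N S A) = T (induced M N \<phi> A)"
proof -
  obtain x where x: "x \<in> carrier M" "A = N +>\<^bsub>M\<^esub> x" using A by (rule quot_carrierE)
  have "induced_op M N S A = N +>\<^bsub>M\<^esub> S x"
    unfolding induced_op_def x by (rule induced_coset) (use x S ST in \<open>auto simp: coset_eq_iff\<close>)
  then show ?thesis using x S ST by simp
qed

end

section \<open>Compactly induced representations\<close>

text \<open>Algebraic form of the support condition: the points where P holds lie in finitely many
  cosets of H.\<close>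

definition finite_mod :: "('p::prime_card padic ^ 2 ^ 2) set \<Rightarrow> ('p padic ^ 2 ^ 2 \<Rightarrow> bool) \<Rightarrow> bool" where
  "finite_mod H P \<longleftrightarrow> (\<exists>F\<subseteq>GL2. finite F \<and> (\<forall>x\<in>GL2. P x \<longrightarrow> (\<exists>h\<in>H. \<exists>y\<in>F. x = h ** y)))"

text \<open>Compactness gives finitely many cosets of \<open>IZ\<close>, hence of the larger group
  H; finitely many cosets of H lie in as many cosets of \<open>KZ\<close>, whose union is compact
  modulo the centre.\<close>

lemma finite_mod_iff_compact_mod_Z:
  assumes "IZ \<subseteq> H" "H \<subseteq> KZ"
  shows "compact_mod_Z {x \<in> GL2. P x} \<longleftrightarrow> finite_mod H P"
proof
  assume "compact_mod_Z {x \<in> GL2. P x}"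
  from compact_mod_Z_imp_finite[OF this] obtain F
    where F: "F \<subseteq> GL2" "finite F" "{x \<in> GL2. P x} \<subseteq> {h ** x |h x. h \<in> IZ \<and> x \<in> F}"
    by (elim exE conjE)
  have "\<exists>h\<in>H. \<exists>y\<in>F. x = h ** y" if "x \<in> GL2" "P x" for x
  proof -
    have "x \<in> {h ** x |h x. h \<in> IZ \<and> x \<in> F}" using that by (intro subsetD[OF F(3)]) simp
    then show ?thesis using assms(1) by blast
  qed
  then show "finite_mod H P" unfolding finite_mod_def using F by blast
next
  assume "finite_mod H P"
  then obtain F where F: "F \<subseteq> GL2" "finite F" "\<And>x. x \<in> GL2 \<Longrightarrow> P x \<Longrightarrow> \<exists>h\<in>H. \<exists>y\<in>F. x = h ** y"
    unfolding finite_mod_def by blast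
  have "{x \<in> GL2. P x} \<subseteq> {h ** x |h x. h \<in> KZ \<and> x \<in> F}"
  proof
    fix x assume "x \<in> {x \<in> GL2. P x}"
    then obtain h y where "h \<in> H" "y \<in> F" "x = h ** y" using F(3) by blast
    then show "x \<in> {h ** x |h x. h \<in> KZ \<and> x \<in> F}" using assms(2) by blast
  qed
  then show "compact_mod_Z {x \<in> GL2. P x}" using F by (intro finite_imp_compact_mod_Z[of F])
qed

lemma finite_mod_mono: "finite_mod H P \<Longrightarrow> (\<And>x. x \<in> GL2 \<Longrightarrow> Q x \<Longrightarrow> P x) \<Longrightarrow> finite_mod H Q"
  unfolding finite_mod_def by meson

text \<open>Both sides express the same compactness condition, so the index of \<open>IZ\<close> in
  \<open>KZ\<close> is never computed.\<close>

lemma finite_mod_IZ_iff_KZ: "finite_mod IZ P \<longleftrightarrow> finite_mod KZ P"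
proof -
  have "IZ \<subseteq> KZ" using IZ_KZ by blast
  then show ?thesis using finite_mod_iff_compact_mod_Z[of IZ P] finite_mod_iff_compact_mod_Z[of KZ P] by blast
qed

lemma finite_mod_disj:
  assumes "finite_mod H P" "finite_mod H Q"
  shows "finite_mod H (\<lambda>x. P x \<or> Q x)"
proof -
  obtain F where F: "F \<subseteq> GL2" "finite F" "\<And>x. x \<in> GL2 \<Longrightarrow> P x \<Longrightarrow> \<exists>h\<in>H. \<exists>y\<in>F. x = h ** y"
    using assms(1) unfolding finite_mod_def by blast
  obtain F' where F': "F' \<subseteq> GL2" "finite F'" "\<And>x. x \<in> GL2 \<Longrightarrow> Q x \<Longrightarrow> \<exists>h\<in>H. \<exists>y\<in>F'. x = h ** y"
    using assms(2) unfolding finite_mod_def by blast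
  show ?thesis unfolding finite_mod_def
    by (rule exI[of _ "F \<union> F'"]) (use F F' in \<open>auto; blast\<close>)
qed

lemma finite_mod_right_translate:
  assumes "finite_mod H P" and g: "g \<in> GL2"
  shows "finite_mod H (\<lambda>x. P (x ** g))"
proof -
  obtain F where F: "F \<subseteq> GL2" "finite F" "\<And>x. x \<in> GL2 \<Longrightarrow> P x \<Longrightarrow> \<exists>h\<in>H. \<exists>y\<in>F. x = h ** y"
    using assms(1) unfolding finite_mod_def by blast
  have "\<exists>h\<in>H. \<exists>y\<in>(\<lambda>y. y ** matrix_inv g) ` F. x = h ** y" if x: "x \<in> GL2" "P (x ** g)" for x
  proof -
    obtain h y where hy: "h \<in> H" "y \<in> F" "x ** g = h ** y" using F(3)[of "x ** g"] x g by auto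
    have "x = (x ** g) ** matrix_inv g" using g by simp
    also have "\<dots> = h ** (y ** matrix_inv g)" unfolding hy(3) by (simp only: matrix_mul_assoc)
    finally show ?thesis using hy by blast
  qed
  moreover have "(\<lambda>y. y ** matrix_inv g) ` F \<subseteq> GL2" using F(1) g by (auto intro!: GL2_mult simp: matrix_inv_GL2)
  ultimately show ?thesis unfolding finite_mod_def using F(2) by blast
qed

lemma ind_simps:
  "\<zero>\<^bsub>ind H \<sigma>\<^esub> = (\<lambda>x\<in>GL2. \<zero>\<^bsub>\<sigma>\<^esub>)"
  "f \<oplus>\<^bsub>ind H \<sigma>\<^esub> f' = (\<lambda>x\<in>GL2. f x \<oplus>\<^bsub>\<sigma>\<^esub> f' x)"
  "c \<odot>\<^bsub>ind H \<sigma>\<^esub> f = (\<lambda>x\<in>GL2. c \<odot>\<^bsub>\<sigma>\<^esub> f x)"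
  "act (ind H \<sigma>) g f = (\<lambda>x\<in>GL2. f (x ** g))"
  by (simp_all add: ind_def)

lemma ind_apply:
  assumes "x \<in> GL2"
  shows "\<zero>\<^bsub>ind H \<sigma>\<^esub> x = \<zero>\<^bsub>\<sigma>\<^esub>"
    "(f \<oplus>\<^bsub>ind H \<sigma>\<^esub> f') x = f x \<oplus>\<^bsub>\<sigma>\<^esub> f' x"
    "(c \<odot>\<^bsub>ind H \<sigma>\<^esub> f) x = c \<odot>\<^bsub>\<sigma>\<^esub> f x"
    "act (ind H \<sigma>) g f x = f (x ** g)"
  using assms by (simp_all add: ind_simps)

locale inducible = representation \<sigma> H
  for \<sigma> :: "('p::prime_card mod_ring, 'v, 'p padic ^ 2 ^ 2) rep" (structure) and H +
  assumes IZ_H: "IZ \<subseteq> H" and H_KZ: "H \<subseteq> KZ"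
begin

lemma ind_carrier_iff:
  "f \<in> carrier (ind H \<sigma>) \<longleftrightarrow> f \<in> extensional GL2 \<and> (\<forall>x\<in>GL2. f x \<in> carrier \<sigma>) \<and>
    (\<forall>h\<in>H. \<forall>x\<in>GL2. f (h ** x) = act \<sigma> h (f x)) \<and> finite_mod H (\<lambda>x. f x \<noteq> \<zero>)"
  unfolding ind_def finite_mod_iff_compact_mod_Z[OF IZ_H H_KZ, symmetric]
  by (auto simp: PiE_def Pi_def)

lemma ind_carrierD:
  assumes "f \<in> carrier (ind H \<sigma>)"
  shows "x \<in> GL2 \<Longrightarrow> f x \<in> carrier \<sigma>"
    and "h \<in> H \<Longrightarrow> x \<in> GL2 \<Longrightarrow> f (h ** x) = act \<sigma> h (f x)"
    and "finite_mod H (\<lambda>x. f x \<noteq> \<zero>)"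
    and "f \<in> extensional GL2"
  using assms by (simp_all add: ind_carrier_iff)

lemma ind_eqI:
  "f \<in> carrier (ind H \<sigma>) \<Longrightarrow> f' \<in> carrier (ind H \<sigma>) \<Longrightarrow> (\<And>x. x \<in> GL2 \<Longrightarrow> f x = f' x) \<Longrightarrow> f = f'"
  by (rule extensionalityI[of _ GL2]) (simp_all add: ind_carrierD)

lemma ind_carrierI:
  assumes "\<And>x. x \<in> GL2 \<Longrightarrow> f x \<in> carrier \<sigma>"
    and "\<And>h x :: 'p padic ^ 2 ^ 2. h \<in> H \<Longrightarrow> x \<in> GL2 \<Longrightarrow> f (h ** x) = act \<sigma> h (f x)"
    and "finite_mod H (\<lambda>x. f x \<noteq> \<zero>)"
  shows "(\<lambda>x\<in>GL2. f x) \<in> carrier (ind H \<sigma>)"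
  using assms finite_mod_mono[OF assms(3), of "\<lambda>x. (\<lambda>x\<in>GL2. f x) x \<noteq> \<zero>"] H_GL2
  by (auto simp: ind_carrier_iff)

lemma representation_ind: "representation (ind H \<sigma>) GL2"
proof -
  let ?I = "ind H \<sigma>"
  have cl_add: "f \<oplus>\<^bsub>?I\<^esub> f' \<in> carrier ?I" if f: "f \<in> carrier ?I" "f' \<in> carrier ?I" for f f'
    unfolding ind_simps
  proof (rule ind_carrierI)
    show "finite_mod H (\<lambda>x. f x \<oplus> f' x \<noteq> \<zero>)"
      by (rule finite_mod_mono[OF finite_mod_disj[OF ind_carrierD(3)[OF f(1)] ind_carrierD(3)[OF f(2)]]]) auto
  qed (simp_all add: ind_carrierD[OF f(1)] ind_carrierD[OF f(2)] act_add)
  have cl_smult: "c \<odot>\<^bsub>?I\<^esub> f \<in> carrier ?I" if f: "f \<in> carrier ?I" for c f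
    unfolding ind_simps
  proof (rule ind_carrierI)
    show "finite_mod H (\<lambda>x. c \<odot> f x \<noteq> \<zero>)"
      by (rule finite_mod_mono[OF ind_carrierD(3)[OF f]]) auto
  qed (simp_all add: ind_carrierD[OF f] act_smult)
  have cl_zero: "\<zero>\<^bsub>?I\<^esub> \<in> carrier ?I"
    unfolding ind_simps by (rule ind_carrierI) (auto simp: finite_mod_def)
  have cl_minus: "(\<lambda>x\<in>GL2. \<ominus> f x) \<in> carrier ?I" if f: "f \<in> carrier ?I" for f
  proof (rule ind_carrierI)
    show "finite_mod H (\<lambda>x. \<ominus> f x \<noteq> \<zero>)"
      by (rule finite_mod_mono[OF ind_carrierD(3)[OF f]]) auto
    fix h x :: "'p padic ^ 2 ^ 2" assume hx: "h \<in> H" "x \<in> GL2"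
    then have "act \<sigma> h (\<ominus> f x) \<oplus> act \<sigma> h (f x) = \<zero>"
      by (simp add: act_add[symmetric] ind_carrierD[OF f] l_neg)
    then show "\<ominus> f (h ** x) = act \<sigma> h (\<ominus> f x)"
      using hx by (simp add: ind_carrierD[OF f] minus_equality)
  qed (simp add: ind_carrierD[OF f])
  have cl_act: "act ?I g f \<in> carrier ?I" if g: "g \<in> GL2" and f: "f \<in> carrier ?I" for g f
    unfolding ind_simps
  proof (rule ind_carrierI)
    show "finite_mod H (\<lambda>x. f (x ** g) \<noteq> \<zero>)"
      by (rule finite_mod_right_translate[OF ind_carrierD(3)[OF f] g])
  qed (use g in \<open>simp_all add: ind_carrierD[OF f] matrix_mul_assoc[symmetric]\<close>)
  have "abelian_group ?I"
  proof (rule abelian_groupI)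
    fix f assume f: "f \<in> carrier ?I"
    show "\<exists>f'\<in>carrier ?I. f' \<oplus>\<^bsub>?I\<^esub> f = \<zero>\<^bsub>?I\<^esub>"
      by (rule bexI[OF _ cl_minus[OF f]]) (auto simp: ind_simps ind_carrierD[OF f] l_neg)
    show "\<zero>\<^bsub>?I\<^esub> \<oplus>\<^bsub>?I\<^esub> f = f"
      by (rule ind_eqI[OF cl_add[OF cl_zero f] f]) (simp add: ind_simps ind_carrierD[OF f])
    fix f' assume f': "f' \<in> carrier ?I"
    show "f \<oplus>\<^bsub>?I\<^esub> f' = f' \<oplus>\<^bsub>?I\<^esub> f"
      by (rule ind_eqI[OF cl_add[OF f f'] cl_add[OF f' f]])
        (simp add: ind_simps ind_carrierD[OF f] ind_carrierD[OF f'] a_comm)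
    fix f'' assume f'': "f'' \<in> carrier ?I"
    show "f \<oplus>\<^bsub>?I\<^esub> f' \<oplus>\<^bsub>?I\<^esub> f'' = f \<oplus>\<^bsub>?I\<^esub> (f' \<oplus>\<^bsub>?I\<^esub> f'')"
      by (rule ind_eqI[OF cl_add[OF cl_add[OF f f'] f''] cl_add[OF f cl_add[OF f' f'']]])
        (simp add: ind_simps ind_carrierD[OF f] ind_carrierD[OF f'] ind_carrierD[OF f''] a_assoc)
  qed (use cl_add cl_zero in auto)
  then show ?thesis
    unfolding representation_def representation_axioms_def
  proof (intro conjI allI impI)
    fix f assume f: "f \<in> carrier ?I"
    show "act ?I (mat 1) f = f"
      by (rule ind_eqI[OF cl_act[OF _ f] f]) (simp_all add: ind_simps)
  qed (use cl_smult cl_act in \<open>auto simp: matrix_inv_GL2 ind_simps ind_carrierD smult_add matrix_mul_assoc\<close>)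
qed

lemma ind_elem_apply:
  assumes "x \<in> GL2" "g \<in> GL2"
  shows "ind_elem H \<sigma> g v x = (if x ** g \<in> H then act \<sigma> (x ** g) v else \<zero>)"
proof -
  have "x \<in> {h ** matrix_inv g |h. h \<in> H} \<longleftrightarrow> x ** g \<in> H"
  proof
    assume "x \<in> {h ** matrix_inv g |h. h \<in> H}"
    then show "x ** g \<in> H" using assms by auto
  next
    assume "x ** g \<in> H"
    moreover have "x = (x ** g) ** matrix_inv g" using assms by simp
    ultimately show "x \<in> {h ** matrix_inv g |h. h \<in> H}" by blast
  qed
  then show ?thesis using assms by (simp add: ind_elem_def)
qed

lemma H_mult_iff: "h \<in> H \<Longrightarrow> h ** x \<in> H \<longleftrightarrow> x \<in> H"
  by (metis H_GL2 H_inv H_mult matrix_inv_cancel(4))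

lemma H_mult_iff': "h \<in> H \<Longrightarrow> x ** h \<in> H \<longleftrightarrow> x \<in> H"
  by (metis H_GL2 H_inv H_mult matrix_inv_cancel(1))

lemma ind_elem_carrier [simp, intro]:
  assumes g: "g \<in> GL2" and v: "v \<in> carrier \<sigma>"
  shows "ind_elem H \<sigma> g v \<in> carrier (ind H \<sigma>)"
proof -
  have "ind_elem H \<sigma> g v = (\<lambda>x\<in>GL2. if x ** g \<in> H then act \<sigma> (x ** g) v else \<zero>)"
    using g by (intro extensionalityI[of _ GL2]) (auto simp: ind_elem_apply, simp add: ind_elem_def)
  also have "\<dots> \<in> carrier (ind H \<sigma>)"
  proof (rule ind_carrierI)
    fix h x :: "'p padic ^ 2 ^ 2" assume hx: "h \<in> H" "x \<in> GL2"
    then show "(if h ** x ** g \<in> H then act \<sigma> (h ** x ** g) v else \<zero>)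
      = act \<sigma> h (if x ** g \<in> H then act \<sigma> (x ** g) v else \<zero>)"
      using v by (simp add: matrix_mul_assoc[symmetric] H_mult_iff act_mult)
  next
    have "\<exists>h\<in>H. x = h ** matrix_inv g" if "x ** g \<in> H" for x
      using that g matrix_inv_cancel(1)[OF g, of x] by metis
    then show "finite_mod H (\<lambda>x. (if x ** g \<in> H then act \<sigma> (x ** g) v else \<zero>) \<noteq> \<zero>)"
      unfolding finite_mod_def using g by (intro exI[of _ "{matrix_inv g}"]) (auto simp: matrix_inv_GL2)
  qed (use v in auto)
  finally show ?thesis .
qed

lemma act_ind_elem:
  assumes "g \<in> GL2" "g' \<in> GL2" "v \<in> carrier \<sigma>"
  shows "act (ind H \<sigma>) g' (ind_elem H \<sigma> g v) = ind_elem H \<sigma> (g' ** g) v"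
proof -
  interpret I: representation "ind H \<sigma>" GL2 by (rule representation_ind)
  show ?thesis
    by (rule ind_eqI) (use assms in \<open>auto simp: ind_elem_apply ind_apply matrix_mul_assoc\<close>)
qed

lemma ind_elem_mult:
  assumes "g \<in> GL2" "h \<in> H" "v \<in> carrier \<sigma>"
  shows "ind_elem H \<sigma> (g ** h) v = ind_elem H \<sigma> g (act \<sigma> h v)"
proof -
  have h: "h \<in> GL2" using assms H_GL2 by blast
  show ?thesis
    by (rule ind_eqI) (use assms h in \<open>auto simp: ind_elem_apply matrix_mul_assoc H_mult_iff' act_mult\<close>)
qed

lemma ind_elem_add:
  assumes "g \<in> GL2" "v \<in> carrier \<sigma>" "w \<in> carrier \<sigma>"
  shows "ind_elem H \<sigma> g (v \<oplus> w) = ind_elem H \<sigma> g v \<oplus>\<^bsub>ind H \<sigma>\<^esub> ind_elem H \<sigma> g w"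
proof -
  interpret I: representation "ind H \<sigma>" GL2 by (rule representation_ind)
  show ?thesis
    by (rule ind_eqI) (use assms in \<open>auto simp: ind_elem_apply ind_apply act_add\<close>)
qed

lemma ind_elem_smult:
  assumes "g \<in> GL2" "v \<in> carrier \<sigma>"
  shows "ind_elem H \<sigma> g (c \<odot> v) = c \<odot>\<^bsub>ind H \<sigma>\<^esub> ind_elem H \<sigma> g v"
proof -
  interpret I: representation "ind H \<sigma>" GL2 by (rule representation_ind)
  show ?thesis
    by (rule ind_eqI) (use assms in \<open>auto simp: ind_elem_apply ind_apply act_smult\<close>)
qed

lemma ind_elem_zero:
  assumes "g \<in> GL2"
  shows "ind_elem H \<sigma> g \<zero> = \<zero>\<^bsub>ind H \<sigma>\<^esub>"
proof -
  interpret I: representation "ind H \<sigma>" GL2 by (rule representation_ind)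
  show ?thesis
    by (rule ind_eqI) (use assms in \<open>auto simp: ind_elem_apply ind_apply\<close>)
qed

lemma finsum_ind_apply:
  assumes "finite A" "\<And>a. a \<in> A \<Longrightarrow> f a \<in> carrier (ind H \<sigma>)" "x \<in> GL2"
  shows "(\<Oplus>\<^bsub>ind H \<sigma>\<^esub>a\<in>A. f a) x = (\<Oplus>a\<in>A. f a x)"
proof -
  interpret I: representation "ind H \<sigma>" GL2 by (rule representation_ind)
  show ?thesis
    using assms(1,2)
  proof (induction A)
    case empty
    then show ?case using assms(3) by (simp add: ind_apply)
  next
    case (insert a A)
    then have "(\<Oplus>\<^bsub>ind H \<sigma>\<^esub>b\<in>insert a A. f b) = f a \<oplus>\<^bsub>ind H \<sigma>\<^esub> (\<Oplus>\<^bsub>ind H \<sigma>\<^esub>b\<in>A. f b)"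
      by (intro I.finsum_insert) auto
    moreover have "(\<Oplus>b\<in>insert a A. f b x) = f a x \<oplus> (\<Oplus>b\<in>A. f b x)"
      using insert assms(3) ind_carrierD(1) by (intro finsum_insert) blast+
    ultimately show ?case using insert assms(3) by (simp add: ind_apply)
  qed
qed

text \<open>Every function is a finite sum of functions [g, v]: the induction runs over a finite set
  of representatives for the cosets in the support and removes one coset at a time.\<close>

lemma ind_induct [consumes 1, case_names zero add elem]:
  assumes f: "f \<in> carrier (ind H \<sigma>)"
    and zero: "P \<zero>\<^bsub>ind H \<sigma>\<^esub>"
    and add: "\<And>f f'. f \<in> carrier (ind H \<sigma>) \<Longrightarrow> f' \<in> carrier (ind H \<sigma>) \<Longrightarrow> P f \<Longrightarrow> P f' \<Longrightarrow> P (f \<oplus>\<^bsub>ind H \<sigma>\<^esub> f')"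
    and elem: "\<And>g v. g \<in> GL2 \<Longrightarrow> v \<in> carrier \<sigma> \<Longrightarrow> P (ind_elem H \<sigma> g v)"
  shows "P f"
proof -
  interpret I: representation "ind H \<sigma>" GL2 by (rule representation_ind)
  obtain F where F: "F \<subseteq> GL2" "finite F" "\<forall>x\<in>GL2. f x \<noteq> \<zero> \<longrightarrow> (\<exists>h\<in>H. \<exists>y\<in>F. x = h ** y)"
    using ind_carrierD(3)[OF f] unfolding finite_mod_def by blast
  show ?thesis
    using F(2,1,3) f
  proof (induction F arbitrary: f)
    case empty
    then have "f = \<zero>\<^bsub>ind H \<sigma>\<^esub>" by (intro ind_eqI) (auto simp: ind_apply)
    then show ?case using zero by simp
  next
    case (insert y F)
    then have y: "y \<in> GL2" "matrix_inv y \<in> GL2" and f: "f \<in> carrier (ind H \<sigma>)" by (auto simp: matrix_inv_GL2)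
    \<comment> \<open>On the coset H y this function agrees with f, by equivariance of f; elsewhere
      it vanishes.\<close>
    define e where "e = ind_elem H \<sigma> (matrix_inv y) (f y)"
    define f' where "f' = f \<ominus>\<^bsub>ind H \<sigma>\<^esub> e"
    have e: "e \<in> carrier (ind H \<sigma>)" using y ind_carrierD(1)[OF f] by (simp add: e_def)
    have f': "f' \<in> carrier (ind H \<sigma>)" using e f by (simp add: f'_def)
    have fe: "f = f' \<oplus>\<^bsub>ind H \<sigma>\<^esub> e" using e f by (simp add: f'_def I.minus_eq I.a_assoc I.l_neg)
    have app: "f x = f' x \<oplus> e x" if "x \<in> GL2" for x using that unfolding fe by (simp add: ind_apply)
    have "\<exists>h\<in>H. \<exists>z\<in>F. x = h ** z" if x: "x \<in> GL2" "f' x \<noteq> \<zero>" for x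
    proof (rule ccontr)
      assume no: "\<not> (\<exists>h\<in>H. \<exists>z\<in>F. x = h ** z)"
      have c: "f' x \<in> carrier \<sigma>" "e x \<in> carrier \<sigma>" using f' e x ind_carrierD(1) by blast+
      show False
      proof (cases "x ** matrix_inv y \<in> H")
        case True
        then have "e x = f ((x ** matrix_inv y) ** y)"
          using x y ind_carrierD(2)[OF f True y(1)] by (simp add: e_def ind_elem_apply)
        then have "f' x \<oplus> e x = e x" using app[of x] x y by simp
        then have "f' x = \<zero>" using c by (simp add: add.r_cancel_one')
        then show False using x by simp
      next
        case False
        then have "e x = \<zero>" using x y by (simp add: e_def ind_elem_apply)
        then have "f x \<noteq> \<zero>" using app x c by simp
        then obtain h z where hz: "h \<in> H" "z \<in> insert y F" "x = h ** z" using insert.prems x by blast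
        then have "x = h ** y" using no by blast
        then have "x ** matrix_inv y = h" using y by simp
        then show False using False hz by simp
      qed
    qed
    then have "P f'" using insert.IH[of f'] insert.prems f' by blast
    moreover have "P e" unfolding e_def using y ind_carrierD(1)[OF f] by (intro elem) auto
    ultimately show ?case using add[OF f' e] fe by simp
  qed
qed

text \<open>Since [g, v] is the g-translate of [id, v], this is the uniqueness half of Frobenius
  reciprocity. It discharges the uniqueness part of the definite descriptions of the
  operators.\<close>

lemma ind_hom_eqI:
  assumes S: "S \<in> rep_hom GL2 (ind H \<sigma>) N" "S' \<in> rep_hom GL2 (ind H \<sigma>) N" and N: "representation N GL2"
    and eq: "\<And>v. v \<in> carrier \<sigma> \<Longrightarrow> S (ind_elem H \<sigma> (mat 1) v) = S' (ind_elem H \<sigma> (mat 1) v)"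
  shows "S = S'"
proof (rule extensionalityI[of _ "carrier (ind H \<sigma>)"])
  fix f assume "f \<in> carrier (ind H \<sigma>)"
  then show "S f = S' f"
  proof (induction rule: ind_induct)
    case zero
    show ?case using rep_hom_zero[OF S(1) representation_ind N] rep_hom_zero[OF S(2) representation_ind N] by simp
  next
    case (add f f')
    then show ?case by (simp add: rep_homD(2)[OF S(1)] rep_homD(2)[OF S(2)])
  next
    case (elem g v)
    then have "ind_elem H \<sigma> g v = act (ind H \<sigma>) g (ind_elem H \<sigma> (mat 1) v)" by (simp add: act_ind_elem)
    then show ?case using elem eq by (simp add: rep_homD(4)[OF S(1)] rep_homD(4)[OF S(2)])
  qed
qed (use rep_homD(5)[OF S(1)] rep_homD(5)[OF S(2)] in auto)

end

section \<open>Homogeneous polynomials and substitution\<close>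

lemma const2_hom [simp]:
  "const2 (a + b) = const2 a + (const2 b :: 'p::prime_card bipoly)"
  "const2 (a * b) = const2 a * (const2 b :: 'p::prime_card bipoly)"
  "const2 (- a) = - (const2 a :: 'p::prime_card bipoly)"
  "const2 (a - b) = const2 a - (const2 b :: 'p::prime_card bipoly)"
  "const2 0 = (0 :: 'p bipoly)" "const2 1 = (1 :: 'p bipoly)"
  by (simp_all add: const2_def pCons_one)

text \<open>The stage of the substitution that acts on the coefficients, which are polynomials in X.
  Each of the two stages is a ring homomorphism, and so is \<open>subst2\<close>.\<close>

definition subst_inner :: "'p::prime_card bipoly \<Rightarrow> 'p mod_ring poly \<Rightarrow> 'p bipoly" where
  "subst_inner U q = poly (map_poly const2 q) U"

lemma subst2_eq: "subst2 P U W = poly (map_poly (subst_inner U) P) W"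
  by (simp add: subst2_def subst_inner_def[abs_def])

lemma subst_inner_hom: "comm_ring_hom (subst_inner (U :: 'p::prime_card bipoly))"
proof -
  have "comm_ring_hom (const2 :: 'p mod_ring \<Rightarrow> 'p bipoly)" by unfold_locales simp_all
  then interpret c: map_poly_comm_ring_hom "const2 :: 'p mod_ring \<Rightarrow> 'p bipoly"
    by (simp add: map_poly_comm_ring_hom_def)
  show ?thesis by unfold_locales (simp_all add: subst_inner_def c.hom_add c.hom_mult)
qed

lemma subst2_hom: "comm_ring_hom (\<lambda>P. subst2 P U (W :: 'p::prime_card bipoly))"
proof -
  interpret c: map_poly_comm_ring_hom "subst_inner U"
    using subst_inner_hom[of U] by (simp add: map_poly_comm_ring_hom_def)
  show ?thesis by unfold_locales (simp_all add: subst2_eq c.hom_add c.hom_mult)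
qed

lemma subst2_simps [simp]:
  fixes U W :: "'p::prime_card bipoly"
  shows "subst2 (P + Q) U W = subst2 P U W + subst2 Q U W"
    "subst2 (P - Q) U W = subst2 P U W - subst2 Q U W"
    "subst2 (- P) U W = - subst2 P U W"
    "subst2 (P * Q) U W = subst2 P U W * subst2 Q U W"
    "subst2 (P ^ n) U W = subst2 P U W ^ n"
    "subst2 0 U W = 0" "subst2 1 U W = 1"
    "subst2 (sum f A) U W = (\<Sum>a\<in>A. subst2 (f a) U W)"
    "subst2 pX U W = U" "subst2 pY U W = W" "subst2 (const2 c) U W = const2 c"
proof -
  interpret h: comm_ring_hom "\<lambda>P. subst2 P U W" by (rule subst2_hom)
  interpret i: comm_ring_hom "subst_inner U" by (rule subst_inner_hom)
  show "subst2 (P + Q) U W = subst2 P U W + subst2 Q U W"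
    "subst2 (P - Q) U W = subst2 P U W - subst2 Q U W"
    "subst2 (- P) U W = - subst2 P U W"
    "subst2 (P * Q) U W = subst2 P U W * subst2 Q U W"
    "subst2 (P ^ n) U W = subst2 P U W ^ n"
    "subst2 0 U W = 0" "subst2 1 U W = 1"
    "subst2 (sum f A) U W = (\<Sum>a\<in>A. subst2 (f a) U W)"
    by (simp_all add: h.hom_add h.hom_minus h.hom_mult h.hom_power h.hom_uminus h.hom_sum)
  show "subst2 pX U W = U"
    by (simp add: subst2_eq pX_def Polynomial.map_poly_pCons subst_inner_def)
  show "subst2 pY U W = W"
    by (simp add: subst2_eq pY_def Polynomial.map_poly_pCons)
  show "subst2 (const2 c) U W = const2 c"
    by (simp add: subst2_eq const2_def[of c] Polynomial.map_poly_pCons subst_inner_def)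
qed

definition eval2 :: "'p::prime_card bipoly \<Rightarrow> 'p mod_ring \<Rightarrow> 'p mod_ring \<Rightarrow> 'p mod_ring" where
  "eval2 P x y = poly (poly P [:y:]) x"

lemma eval2_simps [simp]:
  "eval2 (P + Q) x y = eval2 P x y + eval2 Q x y"
  "eval2 (P - Q) x y = eval2 P x y - eval2 Q x y"
  "eval2 (- P) x y = - eval2 P x y"
  "eval2 (P * Q) x y = eval2 P x y * eval2 Q x y"
  "eval2 (P ^ n) x y = eval2 P x y ^ n"
  "eval2 0 x y = 0" "eval2 1 x y = 1"
  "eval2 (sum f A) x y = (\<Sum>a\<in>A. eval2 (f a) x y)"
  "eval2 pX x y = x" "eval2 pY x y = y" "eval2 (const2 c) x y = c"
  by (simp_all add: eval2_def poly_sum pX_def pY_def const2_def)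

text \<open>Dehomogenisation at X = 1. A form of known degree is recovered from it, so root counting
  in one variable applies to binary forms.\<close>

definition dehom :: "'p::prime_card bipoly \<Rightarrow> 'p mod_ring poly" where
  "dehom P = map_poly (\<lambda>q. poly q 1) P"

lemma coeff_dehom: "poly.coeff (dehom P) j = poly (poly.coeff P j) 1"
  by (simp add: dehom_def coeff_map_poly)

lemma dehom_mult: "dehom (P * Q) = dehom P * dehom (Q :: 'p::prime_card bipoly)"
proof -
  interpret c: comm_ring_hom "\<lambda>q :: 'p mod_ring poly. poly q 1" by unfold_locales simp_all
  interpret m: map_poly_comm_ring_hom "\<lambda>q :: 'p mod_ring poly. poly q 1" ..
  show ?thesis by (simp add: dehom_def m.hom_mult)
qed

lemma poly_dehom: "poly (dehom P) y = eval2 P 1 y"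
  by (induction P) (simp_all add: dehom_def eval2_def Polynomial.map_poly_pCons)

definition form :: "nat \<Rightarrow> (nat \<Rightarrow> 'p::prime_card mod_ring) \<Rightarrow> 'p bipoly" where
  "form r c = (\<Sum>j\<le>r. const2 (c j) * pX ^ (r - j) * pY ^ j)"

lemma coeff_const2_pX_pY:
  "poly.coeff (const2 c * pX ^ i * pY ^ j) n = (if n = j then Polynomial.monom c i else 0)"
proof -
  have "(pX ^ i :: 'a bipoly) = [:Polynomial.monom 1 i:]"
    by (induction i) (simp_all add: pX_def one_pCons Polynomial.monom_Suc monom_0)
  moreover have "(pY ^ j :: 'a bipoly) = Polynomial.monom 1 j"
    unfolding pY_def by (simp add: monom_altdef)
  ultimately show ?thesis by (simp add: const2_def smult_monom)
qed

lemma coeff_form: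
  "poly.coeff (form r c) n = (if n \<le> r then Polynomial.monom (c n) (r - n) else 0)"
  unfolding form_def coeff_sum coeff_const2_pX_pY by (simp add: sum.delta)

lemma homogeneous2_form: "homogeneous2 r (form r c)"
  by (auto simp: homogeneous2_def coeff_form split: if_splits)

lemma homogeneous2E:
  assumes "homogeneous2 r P"
  obtains c where "P = form r c"
proof -
  have "P = form r (\<lambda>j. poly.coeff (poly.coeff P j) (r - j))"
  proof (intro poly_eqI)
    fix i j
    show "poly.coeff (poly.coeff P j) i = poly.coeff (poly.coeff (form r (\<lambda>j. poly.coeff (poly.coeff P j) (r - j))) j) i"
      using assms unfolding homogeneous2_def coeff_form
      by (cases "i + j = r") (auto simp: coeff_monom)
  qed
  then show ?thesis using that by blast
qed

lemma homogeneous2_0 [simp]: "homogeneous2 r 0"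
  by (simp add: homogeneous2_def)

lemma homogeneous2_add: "homogeneous2 r P \<Longrightarrow> homogeneous2 r Q \<Longrightarrow> homogeneous2 r (P + Q)"
  unfolding homogeneous2_def by (metis add.right_neutral coeff_add)

lemma homogeneous2_minus: "homogeneous2 r P \<Longrightarrow> homogeneous2 r (- P)"
  unfolding homogeneous2_def by simp

lemma homogeneous2_diff: "homogeneous2 r P \<Longrightarrow> homogeneous2 r Q \<Longrightarrow> homogeneous2 r (P - Q)"
  using homogeneous2_add[of r P "- Q"] homogeneous2_minus[of r Q] by simp

lemma homogeneous2_sum: "(\<And>a. a \<in> A \<Longrightarrow> homogeneous2 r (f a)) \<Longrightarrow> homogeneous2 r (sum f A)"
  by (induction A rule: infinite_finite_induct) (simp_all add: homogeneous2_add)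

lemma homogeneous2_mult:
  assumes "homogeneous2 a P" "homogeneous2 b Q"
  shows "homogeneous2 (a + b) (P * Q)"
  unfolding homogeneous2_def
proof (intro allI impI)
  fix i j assume nz: "poly.coeff (poly.coeff (P * Q) j) i \<noteq> 0"
  have "poly.coeff (poly.coeff (P * Q) j) i =
      (\<Sum>k\<le>j. \<Sum>l\<le>i. poly.coeff (poly.coeff P k) l * poly.coeff (poly.coeff Q (j - k)) (i - l))"
    by (simp add: coeff_mult coeff_sum)
  with nz obtain k where "k \<le> j" and
    "(\<Sum>l\<le>i. poly.coeff (poly.coeff P k) l * poly.coeff (poly.coeff Q (j - k)) (i - l)) \<noteq> 0"
    by (metis (no_types, lifting) atMost_iff sum.neutral)
  then obtain l where kl: "k \<le> j" "l \<le> i"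
    "poly.coeff (poly.coeff P k) l * poly.coeff (poly.coeff Q (j - k)) (i - l) \<noteq> 0"
    by (metis (no_types, lifting) atMost_iff sum.neutral)
  then have "l + k = a" "(i - l) + (j - k) = b" using assms unfolding homogeneous2_def by auto
  then show "i + j = a + b" using kl by linarith
qed

lemma homogeneous2_const2 [simp]: "homogeneous2 0 (const2 c)"
  by (auto simp: homogeneous2_def const2_def coeff_pCons split: nat.splits)

lemma homogeneous2_const2_mult: "homogeneous2 r P \<Longrightarrow> homogeneous2 r (const2 c * P)"
  using homogeneous2_mult[of 0 "const2 c" r P] by simp

lemma homogeneous2_pX [simp]: "homogeneous2 (Suc 0) pX"
  by (auto simp: homogeneous2_def pX_def coeff_pCons split: nat.splits)

lemma homogeneous2_pY [simp]: "homogeneous2 (Suc 0) pY"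
  by (auto simp: homogeneous2_def pY_def coeff_pCons split: nat.splits)

lemma homogeneous2_1 [simp]: "homogeneous2 0 1"
  using homogeneous2_const2[of 1] by simp

lemma homogeneous2_power: "homogeneous2 (Suc 0) P \<Longrightarrow> homogeneous2 n (P ^ n)"
proof (induction n)
  case (Suc n)
  then show ?case using homogeneous2_mult[of "Suc 0" P n "P ^ n"] by simp
qed simp

lemma homogeneous2_subst2:
  assumes "homogeneous2 r P" "homogeneous2 (Suc 0) U" "homogeneous2 (Suc 0) W"
  shows "homogeneous2 r (subst2 P U W)"
proof -
  obtain c where c: "P = form r c" using assms(1) by (rule homogeneous2E)
  have "homogeneous2 r (const2 (c j) * U ^ (r - j) * W ^ j)" if "j \<le> r" for j
    using homogeneous2_mult[OF homogeneous2_power[OF assms(2), of "r - j"] homogeneous2_power[OF assms(3), of j]] that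
    by (simp add: mult.assoc homogeneous2_const2_mult)
  then show ?thesis unfolding c form_def by (auto intro: homogeneous2_sum)
qed

lemma subst2_subst2:
  assumes "homogeneous2 r P"
  shows "subst2 (subst2 P A B) C D = subst2 P (subst2 A C D) (subst2 B C D)"
proof -
  obtain c where c: "P = form r c" using assms by (rule homogeneous2E)
  show ?thesis unfolding c form_def by simp
qed

lemma subst2_id: "homogeneous2 r P \<Longrightarrow> subst2 P pX pY = P"
  by (elim homogeneous2E) (simp add: form_def)

lemma eval2_subst2:
  assumes "homogeneous2 r P"
  shows "eval2 (subst2 P U W) x y = eval2 P (eval2 U x y) (eval2 W x y)"
proof -
  obtain c where c: "P = form r c" using assms by (rule homogeneous2E)
  show ?thesis unfolding c form_def by simp
qed

lemma coeff_dehom_form: "poly.coeff (dehom (form r c)) j = (if j \<le> r then c j else 0)"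
  by (simp add: coeff_dehom coeff_form poly_monom)

lemma dehom_inj:
  assumes "homogeneous2 r P" "homogeneous2 r Q" "dehom P = dehom Q"
  shows "P = Q"
proof -
  obtain c where c: "P = form r c" using assms(1) by (rule homogeneous2E)
  obtain d where d: "Q = form r d" using assms(2) by (rule homogeneous2E)
  have "c j = d j" if "j \<le> r" for j
    using arg_cong[OF assms(3), of "\<lambda>q. poly.coeff q j"] that by (simp add: c d coeff_dehom_form)
  then show ?thesis unfolding c d form_def by simp
qed

lemma degree_dehom: "homogeneous2 r P \<Longrightarrow> degree (dehom P) \<le> r"
  by (elim homogeneous2E) (auto intro!: degree_le simp: coeff_dehom_form)

text \<open>The coefficient of Y^r records the value at (0:1), the one point of the line that the
  chart X = 1 misses.\<close>

lemma coeff_dehom_top: "homogeneous2 r P \<Longrightarrow> poly.coeff (dehom P) r = eval2 P 0 1"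
proof (elim homogeneous2E)
  fix c assume P: "P = form r c"
  have "eval2 P 0 1 = (\<Sum>j\<le>r. if j = r then c j else 0)"
    unfolding P form_def eval2_simps by (intro sum.cong refl) (auto simp: power_0_left)
  also have "\<dots> = c r" by (simp add: sum.delta')
  finally show "poly.coeff (dehom P) r = eval2 P 0 1" by (simp add: P coeff_dehom_form)
qed

lemma form_exists:
  assumes "degree q \<le> r"
  shows "\<exists>P. homogeneous2 r P \<and> dehom P = q"
proof -
  have "dehom (form r (poly.coeff q)) = q"
    using assms by (intro poly_eqI) (auto simp: coeff_dehom_form intro: coeff_eq_0)
  then show ?thesis using homogeneous2_form by blast
qed

section \<open>Forms as functions over the prime field\<close>

lemma fermat: "(x :: 'p::prime_card mod_ring) ^ CARD('p) = x"
  using finite_field_power_card_eq_same[of x] by simp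

lemma p_ge_2: "CARD('p::prime_card) \<ge> 2"
  using prime_card[where 'a='p] prime_ge_2_nat by blast

lemma fermat': "x \<noteq> 0 \<Longrightarrow> (x :: 'p::prime_card mod_ring) ^ (CARD('p) - 1) = 1"
proof -
  assume x: "x \<noteq> 0"
  have "x * x ^ (CARD('p) - 1) = x ^ CARD('p)"
    using p_ge_2[where 'p='p] by (simp flip: power_Suc)
  then show ?thesis using x by (simp add: fermat)
qed

lemma zero_power_card: "(0 :: 'p::prime_card mod_ring) ^ (CARD('p) - 1) = 0"
  using p_ge_2[where 'p='p] by (simp add: power_0_left)

lemma power_card_minus_1: "(x :: 'p::prime_card mod_ring) ^ (CARD('p) - 1) = (if x = 0 then 0 else 1)"
  using fermat' zero_power_card by auto

lemma power_card_minus_1_Suc0: "(x :: 'p::prime_card mod_ring) ^ (CARD('p) - Suc 0) = (if x = 0 then 0 else 1)"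
  using power_card_minus_1[of x] by simp

lemma power_2_card_minus_2: "(x :: 'p::prime_card mod_ring) ^ (2 * CARD('p) - 2) = (if x = 0 then 0 else 1)"
proof -
  have "2 * CARD('p) - 2 = (CARD('p) - 1) * 2" by simp
  then have "x ^ (2 * CARD('p) - 2) = (x ^ (CARD('p) - 1)) ^ 2" by (metis power_mult)
  then show ?thesis unfolding power_card_minus_1 by simp
qed

lemma poly_all_zero_imp_0:
  assumes "\<And>y. poly q y = 0" "degree q < CARD('p)"
  shows "(q :: 'p::prime_card mod_ring poly) = 0"
proof (rule ccontr)
  assume "q \<noteq> 0"
  then have "card {y. poly q y = 0} \<le> degree q" by (rule card_poly_roots_bound)
  then show False using assms by simp
qed

text \<open>The dehomogenised difference has degree at most p - 1 and vanishes at all p elements of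
  the field.\<close>

lemma eval2_inj:
  fixes P Q :: "'p::prime_card bipoly"
  assumes "homogeneous2 (CARD('p) - 1) P" "homogeneous2 (CARD('p) - 1) Q" "eval2 P = eval2 Q"
  shows "P = Q"
proof -
  have h: "homogeneous2 (CARD('p) - 1) (P - Q)" using assms by (intro homogeneous2_diff)
  have "dehom (P - Q) = 0"
  proof (rule poly_all_zero_imp_0)
    show "degree (dehom (P - Q)) < CARD('p)"
      using degree_dehom[OF h] p_ge_2[where 'p='p] by linarith
  qed (simp add: poly_dehom assms(3))
  then have "P - Q = 0" by (intro dehom_inj[OF h]) (simp_all add: dehom_def)
  then show ?thesis by simp
qed

text \<open>In the chart X = 1 the divisor becomes Y - Y^p, which vanishes on the whole field; the
  remainder of P has degree below p and p zeros, so it is 0. The remaining work is to homogenise the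
  quotient with the right degree.\<close>

lemma eval2_zero_iff_dvd:
  fixes P :: "'p::prime_card bipoly"
  assumes P: "homogeneous2 (2 * CARD('p) - 2) P"
  shows "(\<forall>x y. eval2 P x y = 0) \<longleftrightarrow> pX ^ CARD('p) * pY - pX * pY ^ CARD('p) dvd P"
proof
  assume "pX ^ CARD('p) * pY - pX * pY ^ CARD('p) dvd P"
  then show "\<forall>x y. eval2 P x y = 0" by (auto simp: fermat elim!: dvdE)
next
  assume z: "\<forall>x y. eval2 P x y = 0"
  let ?p = "CARD('p)"
  define f :: "'p mod_ring poly" where "f = Polynomial.monom 1 1 - Polynomial.monom 1 ?p"
  have f_roots: "poly f y = 0" for y by (simp add: f_def poly_monom fermat)
  have deg_f: "degree f = ?p"
  proof -
    have "degree (- (Polynomial.monom (1::'p mod_ring) ?p) + Polynomial.monom 1 1) = ?p"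
      by (subst degree_add_eq_left) (use p_ge_2[where 'p='p] in \<open>simp_all add: degree_monom_eq\<close>)
    then show ?thesis by (simp add: f_def)
  qed
  have "f \<noteq> 0" using deg_f p_ge_2[where 'p='p] by auto
  have "dehom P mod f = 0"
  proof (rule poly_all_zero_imp_0)
    show "degree (dehom P mod f) < ?p"
      using degree_mod_less[OF \<open>f \<noteq> 0\<close>, of "dehom P"] deg_f p_ge_2[where 'p='p] by auto
    fix y
    have "poly (dehom P) y = poly f y * poly (dehom P div f) y + poly (dehom P mod f) y"
      by (metis mult_div_mod_eq poly_add poly_mult)
    then show "poly (dehom P mod f) y = 0" using z by (simp add: f_roots poly_dehom)
  qed
  then have dq: "dehom P = f * (dehom P div f)" by (metis add.right_neutral mult_div_mod_eq)
  define q where "q = dehom P div f"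
  show "pX ^ ?p * pY - pX * pY ^ ?p dvd P"
  proof (cases "q = 0")
    case True
    then have "dehom P = dehom 0" using dq by (simp add: q_def dehom_def)
    then have "P = 0" using P by (intro dehom_inj) simp_all
    then show ?thesis by simp
  next
    case False
    \<comment> \<open>Vanishing at (0:1) removes the leading coefficient. Otherwise the quotient
      could have degree p - 2, too large for a cofactor of degree (2p - 2) - (p + 1) = p -
      3.\<close>
    have "degree (dehom P) \<le> 2 * ?p - 3"
    proof (rule degree_le, intro allI impI)
      fix i assume "2 * ?p - 3 < i"
      then have "i = 2 * ?p - 2 \<or> i > 2 * ?p - 2" by linarith
      then show "poly.coeff (dehom P) i = 0"
        using coeff_dehom_top[OF P] degree_dehom[OF P] z by (auto intro: coeff_eq_0)
    qed
    moreover have "degree (dehom P) = ?p + degree q"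
      using dq False \<open>f \<noteq> 0\<close> deg_f by (metis degree_mult_eq q_def)
    \<comment> \<open>A nonzero quotient needs p + \<open>degree q\<close> to be at most 2p - 3,
      which excludes p = 2; so the subtraction in p - 3 is not truncated.\<close>
    ultimately have d: "degree q \<le> ?p - 3" and p3: "?p \<ge> 3"
      using p_ge_2[where 'p='p] by arith+
    obtain Q where Q: "homogeneous2 (?p - 3) Q" "dehom Q = q" using form_exists[OF d] by blast
    let ?F = "pX ^ ?p * pY - pX * pY ^ ?p :: 'p bipoly"
    have F: "homogeneous2 (?p + 1) ?F"
      using homogeneous2_mult[OF homogeneous2_power[OF homogeneous2_pX, of ?p] homogeneous2_pY]
        homogeneous2_mult[OF homogeneous2_pX homogeneous2_power[OF homogeneous2_pY, of ?p]]
      by (intro homogeneous2_diff) simp_all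
    have "dehom ?F = f"
    proof (rule poly_eqI)
      fix j
      have "?F = const2 1 * pX ^ ?p * pY ^ 1 - const2 1 * pX ^ 1 * pY ^ ?p" by simp
      then have "poly.coeff (dehom ?F) j = poly.coeff f j"
        unfolding coeff_dehom f_def by (simp only: coeff_diff coeff_const2_pX_pY) (auto simp: poly_monom)
      then show "poly.coeff (dehom ?F) j = poly.coeff f j" .
    qed
    then have "dehom (?F * Q) = dehom P" by (simp add: dehom_mult Q dq[folded q_def])
    moreover have "homogeneous2 (2 * ?p - 2) (?F * Q)"
    proof -
      have "?p + 1 + (?p - 3) = 2 * ?p - 2" using p3 by linarith
      then show ?thesis using homogeneous2_mult[OF F Q(1)] by (simp only:)
    qed
    ultimately have "?F * Q = P" using P by (intro dehom_inj)
    then show ?thesis by (metis dvd_triv_left)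
  qed
qed

section \<open>The weights\<close>

definition mat_act :: "'p::prime_card mod_ring ^ 2 ^ 2 \<Rightarrow> 'p bipoly \<Rightarrow> 'p bipoly" where
  "mat_act A P = subst2 P (const2 (A $ 1 $ 1) * pX + const2 (A $ 2 $ 1) * pY)
      (const2 (A $ 1 $ 2) * pX + const2 (A $ 2 $ 2) * pY)"

lemma weight_act_eq: "weight_act g P = mat_act (red g) P"
  by (simp add: weight_act_def mat_act_def red_def Let_def)

lemma Wt_simps [simp]:
  "P \<in> carrier (Wt r) \<longleftrightarrow> homogeneous2 r P"
  "\<zero>\<^bsub>Wt r\<^esub> = 0" "P \<oplus>\<^bsub>Wt r\<^esub> Q = P + Q" "c \<odot>\<^bsub>Wt r\<^esub> P = const2 c * P"
  "act (Wt r) g P = mat_act (red g) P"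
  by (simp_all add: Wt_def weight_act_eq)

lemma mat_act_simps:
  "mat_act A (P + Q) = mat_act A P + mat_act A Q"
  "mat_act A (const2 c * P) = const2 c * mat_act A P"
  by (simp_all add: mat_act_def)

lemma homogeneous2_linear: "homogeneous2 (Suc 0) (const2 a * pX + const2 b * pY)"
  by (simp add: homogeneous2_add homogeneous2_const2_mult)

lemma homogeneous2_mat_act: "homogeneous2 r P \<Longrightarrow> homogeneous2 r (mat_act A P)"
  unfolding mat_act_def by (rule homogeneous2_subst2) (rule homogeneous2_linear | assumption)+

lemma mat_act_mult: "homogeneous2 r P \<Longrightarrow> mat_act (A ** B) P = mat_act A (mat_act B P)"
  unfolding mat_act_def by (simp add: subst2_subst2 matrix_mult_nth_2 algebra_simps)

lemma mat_act_1: "homogeneous2 r P \<Longrightarrow> mat_act (mat 1) P = P"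
  unfolding mat_act_def by (simp add: subst2_id)

lemma eval2_mat_act:
  "homogeneous2 r P \<Longrightarrow> eval2 (mat_act A P) x y = eval2 P (x * A $ 1 $ 1 + y * A $ 2 $ 1) (x * A $ 1 $ 2 + y * A $ 2 $ 2)"
  unfolding mat_act_def by (simp add: eval2_subst2 algebra_simps)

lemma representation_Wt: "representation (Wt r) (KZ :: ('p::prime_card padic ^ 2 ^ 2) set)"
proof -
  have "abelian_group (Wt r :: ('p mod_ring, 'p bipoly, 'p padic ^ 2 ^ 2) rep)"
  proof (rule abelian_groupI)
    fix P :: "'p bipoly" assume "P \<in> carrier (Wt r)"
    then show "\<exists>Q\<in>carrier (Wt r). Q \<oplus>\<^bsub>Wt r\<^esub> P = \<zero>\<^bsub>Wt r\<^esub>"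
      by (intro bexI[of _ "- P"]) (simp_all add: homogeneous2_minus)
  qed (simp_all add: homogeneous2_add)
  then show ?thesis
    by (intro representation.intro representation_axioms.intro)
      (simp_all add: KZ_sub_GL2 KZ_inv homogeneous2_const2_mult homogeneous2_mat_act mat_act_simps
        mat_act_mult mat_act_1 distrib_left)
qed

lemma inducible_Wt: "inducible (Wt r) (KZ :: ('p::prime_card padic ^ 2 ^ 2) set)"
  by (intro inducible.intro representation_Wt inducible_axioms.intro) (use IZ_KZ in auto)

lemma triv_simps [simp]:
  "carrier triv = UNIV" "\<zero>\<^bsub>triv\<^esub> = 0" "x \<oplus>\<^bsub>triv\<^esub> y = x + y" "c \<odot>\<^bsub>triv\<^esub> x = c * x" "act triv g x = x"
  by (simp_all add: triv_def)

lemma inducible_triv: "inducible triv (IZ :: ('p::prime_card padic ^ 2 ^ 2) set)"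
proof -
  have "abelian_group (triv :: ('p mod_ring, 'p mod_ring, 'p padic ^ 2 ^ 2) rep)"
    by (rule abelian_groupI) (simp_all add: add.assoc add.commute exI[of _ "- x" for x] eq_neg_iff_add_eq_0[symmetric])
  then have "representation triv (IZ :: ('p::prime_card padic ^ 2 ^ 2) set)"
    by (intro representation.intro representation_axioms.intro)
      (simp_all add: KZ_sub_GL2 IZ_KZ IZ_inv distrib_left)
  then show ?thesis
    by (intro inducible.intro inducible_axioms.intro) (use IZ_KZ in auto)
qed

text \<open>Functions on the projective line over the prime field, as functions of homogeneous
  coordinates; they vanish at the origin by convention.\<close>

definition line_rep ::
  "('p::prime_card mod_ring, 'p mod_ring \<Rightarrow> 'p mod_ring \<Rightarrow> 'p mod_ring, 'p padic ^ 2 ^ 2) rep" where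
  "line_rep = \<lparr>carrier = {h. h 0 0 = 0 \<and> (\<forall>t x y. t \<noteq> 0 \<longrightarrow> h (t * x) (t * y) = h x y)},
     mult = undefined, one = undefined, zero = (\<lambda>x y. 0), add = (\<lambda>h h' x y. h x y + h' x y),
     smult = (\<lambda>c h x y. c * h x y),
     act = (\<lambda>g h x y. h (x * red g $ 1 $ 1 + y * red g $ 2 $ 1) (x * red g $ 1 $ 2 + y * red g $ 2 $ 2))\<rparr>"

lemma line_rep_simps:
  "h \<in> carrier line_rep \<longleftrightarrow> h 0 0 = 0 \<and> (\<forall>t x y. t \<noteq> 0 \<longrightarrow> h (t * x) (t * y) = h x y)"
  "\<zero>\<^bsub>line_rep\<^esub> = (\<lambda>x y. 0)" "h \<oplus>\<^bsub>line_rep\<^esub> h' = (\<lambda>x y. h x y + h' x y)"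
  "c \<odot>\<^bsub>line_rep\<^esub> h = (\<lambda>x y. c * h x y)"
  "act line_rep g h = (\<lambda>x y. h (x * red g $ 1 $ 1 + y * red g $ 2 $ 1) (x * red g $ 1 $ 2 + y * red g $ 2 $ 2))"
  by (simp_all add: line_rep_def)

lemma line_repD:
  assumes "h \<in> carrier line_rep"
  shows "h 0 0 = 0" "t \<noteq> 0 \<Longrightarrow> h (t * x) (t * y) = h x y"
  using assms by (simp_all add: line_rep_simps)

lemma line_rep_scale:
  assumes "h \<in> carrier line_rep" "x \<noteq> 0"
  shows "h x y = h 1 (y / x)"
proof -
  have "h (x * 1) (x * (y / x)) = h 1 (y / x)" using assms by (rule line_repD(2))
  then show ?thesis using assms by simp
qed

lemma line_rep_scale_0:
  assumes "h \<in> carrier line_rep" "y \<noteq> 0"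
  shows "h 0 y = h 0 1"
proof -
  have "h (y * 0) (y * 1) = h 0 1" using assms by (rule line_repD(2))
  then show ?thesis by simp
qed

lemma representation_line_rep: "representation line_rep (KZ :: ('p::prime_card padic ^ 2 ^ 2) set)"
proof -
  have "abelian_group (line_rep :: ('p mod_ring, _, 'p padic ^ 2 ^ 2) rep)"
  proof (rule abelian_groupI)
    fix h :: "'p mod_ring \<Rightarrow> 'p mod_ring \<Rightarrow> 'p mod_ring" assume "h \<in> carrier line_rep"
    then show "\<exists>h'\<in>carrier line_rep. h' \<oplus>\<^bsub>line_rep\<^esub> h = \<zero>\<^bsub>line_rep\<^esub>"
      by (intro bexI[of _ "\<lambda>x y. - h x y"]) (simp_all add: line_rep_simps)
  qed (simp_all add: line_rep_simps ac_simps)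
  moreover have "act line_rep g h \<in> carrier line_rep" if h: "h \<in> carrier line_rep"
    for g :: "'p padic ^ 2 ^ 2" and h
  proof -
    have "h (t * x * a + t * y * b) (t * x * c + t * y * d) = h (x * a + y * b) (x * c + y * d)"
      if "t \<noteq> 0" for t x y a b c d
    proof -
      have "h (t * (x * a + y * b)) (t * (x * c + y * d)) = h (x * a + y * b) (x * c + y * d)"
        using h that by (rule line_repD(2))
      then show ?thesis by (simp only: distrib_left mult.assoc)
    qed
    then show ?thesis using h by (simp add: line_rep_simps)
  qed
  ultimately show ?thesis
    by (intro representation.intro representation_axioms.intro)
      (simp_all add: KZ_sub_GL2 KZ_inv, simp_all add: line_rep_simps matrix_mult_nth_2 algebra_simps)
qed

lemma eval2_scale:
  assumes "homogeneous2 r P"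
  shows "eval2 P (t * x) (t * y) = t ^ r * eval2 P x y"
proof -
  obtain c where c: "P = form r c" using assms by (rule homogeneous2E)
  have "(t * x) ^ (r - j) * (t * y) ^ j = t ^ r * (x ^ (r - j) * y ^ j)" if "j \<le> r" for j
  proof -
    have "(t * x) ^ (r - j) * (t * y) ^ j = t ^ (r - j + j) * (x ^ (r - j) * y ^ j)"
      unfolding power_mult_distrib power_add by (simp only: mult_ac)
    then show ?thesis using that by simp
  qed
  then show ?thesis unfolding c form_def by (auto simp: sum_distrib_left mult.left_commute mult.assoc intro!: sum.cong)
qed

lemma eval2_origin:
  assumes "homogeneous2 r P" "0 < r"
  shows "eval2 P 0 0 = 0"
  using eval2_scale[OF assms(1), of 0 0 0] assms(2) by (simp add: power_0_left)

text \<open>Both degrees are positive multiples of p - 1: Fermat gives invariance under scaling, and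
  positivity gives the value 0 at the origin.\<close>

lemma eval2_line_rep:
  assumes "homogeneous2 r P" "r = CARD('p) - 1 \<or> r = 2 * CARD('p) - 2"
  shows "eval2 (P :: 'p::prime_card bipoly) \<in> carrier line_rep"
proof -
  have "0 < r" using assms(2) p_ge_2[where 'p='p] by auto
  moreover have "t ^ r = 1" if "t \<noteq> 0" for t :: "'p mod_ring"
    using that assms(2) power_card_minus_1[of t] power_2_card_minus_2[of t] by auto
  ultimately show ?thesis using eval2_scale[OF assms(1)] eval2_origin[OF assms(1)] by (simp add: line_rep_simps)
qed

lemma eval2_rep_hom:
  assumes r: "r = CARD('p) - 1 \<or> r = 2 * CARD('p) - 2"
  shows "(\<lambda>P\<in>carrier (Wt r). eval2 P) \<in> rep_hom KZ (Wt r :: ('p::prime_card mod_ring, _, _) rep) line_rep"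
proof (rule rep_hom_restrictI[OF representation_Wt])
  fix P :: "'p bipoly" assume "P \<in> carrier (Wt r)"
  then show "eval2 P \<in> carrier line_rep" using r by (auto intro: eval2_line_rep)
qed (auto simp: line_rep_simps eval2_mat_act fun_eq_iff)

section \<open>The quotient weight as the space of functions on the projective line\<close>

abbreviation (input) big_wt :: "('p::prime_card mod_ring, 'p bipoly, 'p padic ^ 2 ^ 2) rep" where
  "big_wt \<equiv> Wt (2 * CARD('p) - 2)"

abbreviation (input) big_wt_star :: "'p::prime_card bipoly set" where
  "big_wt_star \<equiv> Wt_star (2 * CARD('p) - 2)"

lemma quotient_big_wt:
  "quotient_by_kernel (big_wt :: ('p::prime_card mod_ring, _, _) rep) line_rep KZ
    (\<lambda>P\<in>carrier big_wt. eval2 P) big_wt_star"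
proof (intro quotient_by_kernel.intro quotient_by_kernel_axioms.intro representation_Wt representation_line_rep)
  show "(\<lambda>P\<in>carrier big_wt. eval2 P) \<in> rep_hom KZ big_wt (line_rep :: ('p mod_ring, _, _) rep)"
    by (rule eval2_rep_hom) simp
  show "big_wt_star = {P \<in> carrier big_wt. (\<lambda>P\<in>carrier big_wt. eval2 P) P = \<zero>\<^bsub>line_rep :: ('p mod_ring, _, _) rep\<^esub>}"
    by (auto simp: Wt_star_def line_rep_simps fun_eq_iff eval2_zero_iff_dvd)
qed

text \<open>A right inverse of evaluation, built from indicator functions: the first form is 1 at
  (0:1) and 0 at the other points, and the form in the sum is 1 at (1:m) and 0 elsewhere.\<close>

definition poly_of_fun :: "('p::prime_card mod_ring \<Rightarrow> 'p mod_ring \<Rightarrow> 'p mod_ring) \<Rightarrow> 'p bipoly" where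
  "poly_of_fun h = const2 (h 0 1) * (pY ^ (CARD('p) - 1) * (pY ^ (CARD('p) - 1) - pX ^ (CARD('p) - 1))) +
    (\<Sum>m\<in>UNIV. const2 (h 1 m) * (pX ^ (CARD('p) - 1) *
      (pX ^ (CARD('p) - 1) - (pY + const2 (- m) * pX) ^ (CARD('p) - 1))))"

definition line_total :: "('p::prime_card mod_ring \<Rightarrow> 'p mod_ring \<Rightarrow> 'p mod_ring) \<Rightarrow> 'p mod_ring" where
  "line_total h = h 0 1 + (\<Sum>m\<in>UNIV. h 1 m)"

text \<open>The form -(Y - m X)^(p-1) is -1 at every point except (1:m), where it is 0; it is thus
  the indicator of that point minus the constant 1. The same holds for -X^(p-1) at (0:1). The
  weighted sum has the values of h minus the total of h.\<close>

definition interpolate :: "('p::prime_card mod_ring \<Rightarrow> 'p mod_ring \<Rightarrow> 'p mod_ring) \<Rightarrow> 'p bipoly" where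
  "interpolate h = const2 (- h 0 1) * pX ^ (CARD('p) - 1) +
    (\<Sum>m\<in>UNIV. const2 (- h 1 m) * (pY + const2 (- m) * pX) ^ (CARD('p) - 1))"

text \<open>A constant function on the line, under the convention that functions vanish at the
  origin.\<close>

definition punctured_const :: "'p::prime_card mod_ring \<Rightarrow> 'p mod_ring \<Rightarrow> 'p mod_ring \<Rightarrow> 'p mod_ring" where
  "punctured_const c x y = (if x = 0 \<and> y = 0 then 0 else c)"

lemma homogeneous2_linear': "homogeneous2 (Suc 0) (pY + const2 a * pX)"
  by (simp add: homogeneous2_add homogeneous2_const2_mult)

lemma homogeneous2_poly_of_fun: "homogeneous2 (2 * CARD('p) - 2) (poly_of_fun h :: 'p::prime_card bipoly)"
proof -
  let ?q = "CARD('p) - 1"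
  have "homogeneous2 (?q + ?q) (poly_of_fun h :: 'p bipoly)"
    unfolding poly_of_fun_def
    by (intro homogeneous2_add homogeneous2_sum homogeneous2_const2_mult homogeneous2_mult homogeneous2_diff
        homogeneous2_power homogeneous2_pX homogeneous2_pY homogeneous2_linear')
  moreover have "?q + ?q = 2 * CARD('p) - 2" by simp
  ultimately show ?thesis by (simp only:)
qed

lemma homogeneous2_interpolate: "homogeneous2 (CARD('p) - 1) (interpolate h :: 'p::prime_card bipoly)"
  unfolding interpolate_def
  by (intro homogeneous2_add homogeneous2_sum homogeneous2_const2_mult
        homogeneous2_power homogeneous2_pX homogeneous2_linear')

lemma eval2_poly_of_fun:
  assumes h: "h \<in> carrier line_rep"
  shows "eval2 (poly_of_fun h :: 'p::prime_card bipoly) = h"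
proof (intro ext)
  fix x y :: "'p mod_ring"
  have e: "eval2 (poly_of_fun h) x y = (if y = 0 \<or> x \<noteq> 0 then 0 else h 0 1) +
      (\<Sum>m\<in>UNIV. if x \<noteq> 0 \<and> y = m * x then h 1 m else 0)" for x y
    unfolding poly_of_fun_def eval2_simps power_card_minus_1
    by (intro arg_cong2[of _ _ _ _ "(+)"] sum.cong refl) auto
  show "eval2 (poly_of_fun h) x y = h x y"
  proof (cases "x = 0")
    case True
    then show ?thesis using h line_rep_scale_0[OF h, of y] by (auto simp: e line_rep_simps)
  next
    case False
    then have "y = m * x \<longleftrightarrow> m = y / x" for m by (auto simp: field_simps)
    then show ?thesis using False line_rep_scale[OF h False, of y] by (simp add: e)
  qed
qed

lemma eval2_interpolate:
  assumes h: "h \<in> carrier line_rep"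
  shows "eval2 (interpolate h :: 'p::prime_card bipoly) x y = h x y - punctured_const (line_total h) x y"
proof -
  have e: "eval2 (interpolate h) x y = - (if x = 0 then 0 else h 0 1) -
      (\<Sum>m\<in>UNIV. if y = m * x then 0 else h 1 m)" for x y
    unfolding interpolate_def eval2_simps power_card_minus_1 sum_negf[symmetric] diff_conv_add_uminus
    by (intro arg_cong2[of _ _ _ _ "(+)"] sum.cong refl) auto
  show ?thesis
  proof (cases "x = 0")
    case True
    show ?thesis
    proof (cases "y = 0")
      case True
      then show ?thesis using \<open>x = 0\<close> h by (simp add: e punctured_const_def line_rep_simps)
    next
      case False
      then show ?thesis using \<open>x = 0\<close> line_rep_scale_0[OF h False] by (simp add: e punctured_const_def line_total_def)
    qed
  next
    case False
    then have "y = m * x \<longleftrightarrow> m = y / x" for m by (auto simp: field_simps)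
    moreover have "(\<Sum>m\<in>UNIV. if m = y / x then 0 else h 1 m) = (\<Sum>m\<in>UNIV. h 1 m) - h 1 (y / x)"
    proof -
      have "(\<Sum>m\<in>UNIV. if m = y / x then 0 else h 1 m) = (\<Sum>m\<in>UNIV - {y / x}. h 1 m)"
        by (intro sum.mono_neutral_cong_right) auto
      then show ?thesis by (simp add: sum_diff1)
    qed
    ultimately show ?thesis using False line_rep_scale[OF h False, of y]
      by (simp add: e punctured_const_def line_total_def)
  qed
qed

lemma punctured_const_line_rep [simp]: "punctured_const c \<in> carrier line_rep"
  by (auto simp: line_rep_simps punctured_const_def)

lemma line_rep_add [simp]:
  "h \<in> carrier line_rep \<Longrightarrow> h' \<in> carrier line_rep \<Longrightarrow> (\<lambda>x y. h x y + h' x y) \<in> carrier line_rep"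
  by (simp add: line_rep_simps)

lemma total_add: "line_total (\<lambda>x y. h x y + h' x y) = line_total h + line_total h'"
  and total_smult: "line_total (\<lambda>x y. c * h x y) = c * line_total h"
  by (simp_all add: line_total_def sum.distrib sum_distrib_left distrib_left algebra_simps)

lemma total_punctured_const [simp]: "line_total (punctured_const c) = c"
  by (simp add: line_total_def punctured_const_def)

text \<open>Each point of the projective line has \<open>p - 1 = -1\<close> representatives.\<close>

lemma total_eq_sum:
  assumes h: "h \<in> carrier line_rep"
  shows "line_total h = - (\<Sum>x\<in>UNIV. \<Sum>y\<in>UNIV. h x (y :: 'p::prime_card mod_ring))"
proof -
  have c: "of_nat (card (UNIV - {0 :: 'p mod_ring})) = (- 1 :: 'p mod_ring)"
    using p_ge_2[where 'p='p] by (simp add: card_Diff_singleton of_nat_diff)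
  have "(\<Sum>y\<in>UNIV. h 0 y) = (\<Sum>y\<in>UNIV - {0 :: 'p mod_ring}. h 0 1)"
    by (intro sum.mono_neutral_cong_right) (auto simp: line_repD(1)[OF h] intro: line_rep_scale_0[OF h])
  also have "\<dots> = - h 0 1" unfolding sum_constant c by simp
  finally have 0: "(\<Sum>y\<in>UNIV. h 0 y) = - h 0 1" .
  have 1: "(\<Sum>y\<in>UNIV. h x y) = (\<Sum>m\<in>UNIV. h 1 m)" if x: "x \<noteq> 0" for x
    by (rule sum.reindex_bij_witness[where j="\<lambda>y. y / x" and i="\<lambda>m. m * x"])
      (auto simp: x line_rep_scale[OF h x, symmetric])
  have "(\<Sum>x\<in>UNIV. \<Sum>y\<in>UNIV. h x y) = (\<Sum>y\<in>UNIV. h 0 y) + (\<Sum>x\<in>UNIV - {0}. \<Sum>y\<in>UNIV. h x y)"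
    by (simp add: sum.remove[of UNIV 0])
  also have "(\<Sum>x\<in>UNIV - {0}. \<Sum>y\<in>UNIV. h x y) = (\<Sum>x\<in>UNIV - {0 :: 'p mod_ring}. \<Sum>m\<in>UNIV. h 1 m)"
    by (rule sum.cong) (auto intro: 1)
  also have "\<dots> = - (\<Sum>m\<in>UNIV. h 1 m)" unfolding sum_constant c by simp
  finally show ?thesis by (simp add: 0 line_total_def)
qed

text \<open>By \<open>total_eq_sum\<close> the total is minus the sum over the whole plane, which
  \<open>red g\<close> permutes linearly; the inverse permutation is the adjugate divided by
  D.\<close>

lemma total_act:
  assumes g: "g \<in> KZ" and h: "h \<in> carrier line_rep"
  shows "line_total (act line_rep g h) = line_total (h :: 'p::prime_card mod_ring \<Rightarrow> _)"
proof -
  interpret representation line_rep "KZ :: ('p padic ^ 2 ^ 2) set" by (rule representation_line_rep)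
  let ?r = "red g"
  define D where "D = det ?r"
  have D: "D \<noteq> 0" "D = ?r $ 1 $ 1 * ?r $ 2 $ 2 - ?r $ 1 $ 2 * ?r $ 2 $ 1"
    using det_red[OF g] by (simp_all add: D_def det_2)
  have "(\<Sum>x\<in>UNIV. \<Sum>y\<in>UNIV. act line_rep g h x y) = (\<Sum>(x, y)\<in>UNIV. act line_rep g h x y)"
    by (simp add: sum.cartesian_product)
  also have "\<dots> = (\<Sum>(x, y)\<in>UNIV. h x y)"
    by (rule sum.reindex_bij_witness[where
          j="\<lambda>(x, y). (x * ?r $ 1 $ 1 + y * ?r $ 2 $ 1, x * ?r $ 1 $ 2 + y * ?r $ 2 $ 2)" and
          i="\<lambda>(x, y). ((x * ?r $ 2 $ 2 - y * ?r $ 2 $ 1) / D, (y * ?r $ 1 $ 1 - x * ?r $ 1 $ 2) / D)"])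
      (use D(1) in \<open>auto simp: line_rep_simps field_simps\<close>, auto simp: D(2) algebra_simps)
  also have "\<dots> = (\<Sum>x\<in>UNIV. \<Sum>y\<in>UNIV. h x y)" by (simp add: sum.cartesian_product)
  finally show ?thesis using total_eq_sum[OF act_closed[OF g h]] total_eq_sum[OF h] by simp
qed

text \<open>The form v minus its interpolant takes the constant value t off the origin, so its
  dehomogenisation is the constant polynomial t. Its coefficient at Y^(p-1) is then 0, as p - 1 is
  positive, but it is also the value at (0:1), which is t.\<close>

lemma total_eval2:
  assumes v: "homogeneous2 (CARD('p) - 1) (v :: 'p::prime_card bipoly)"
  shows "line_total (eval2 v) = 0"
proof -
  have h: "eval2 v \<in> carrier line_rep" using v by (auto intro: eval2_line_rep)
  let ?t = "line_total (eval2 v)" and ?u = "v - interpolate (eval2 v)"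
  have u: "homogeneous2 (CARD('p) - 1) ?u" using v homogeneous2_interpolate by (rule homogeneous2_diff)
  have e: "eval2 ?u x y = punctured_const ?t x y" for x y by (simp add: eval2_interpolate[OF h])
  have "dehom ?u - [:?t:] = 0"
  proof (rule poly_all_zero_imp_0)
    have "degree (dehom ?u - [:?t:]) \<le> CARD('p) - 1"
      using degree_dehom[OF u] by (intro degree_diff_le) simp_all
    then show "degree (dehom ?u - [:?t:]) < CARD('p)" using p_ge_2[where 'p='p] by linarith
    show "poly (dehom ?u - [:?t:]) y = 0" for y unfolding poly_diff poly_dehom e by (simp add: punctured_const_def)
  qed
  then have d: "dehom ?u = [:?t:]" by simp
  have "poly.coeff (dehom ?u) (CARD('p) - 1) = 0"
    using p_ge_2[where 'p='p] unfolding d by (simp add: coeff_pCons split: nat.splits)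
  then show ?thesis unfolding coeff_dehom_top[OF u] e by (simp add: punctured_const_def)
qed

lemma interpolate_eval2:
  assumes v: "homogeneous2 (CARD('p) - 1) (v :: 'p::prime_card bipoly)"
  shows "interpolate (eval2 v) = v"
proof (rule eval2_inj[OF homogeneous2_interpolate v], intro ext)
  fix x y
  have h: "eval2 v \<in> carrier line_rep" using v by (auto intro: eval2_line_rep)
  show "eval2 (interpolate (eval2 v)) x y = eval2 v x y"
    by (simp add: eval2_interpolate[OF h] total_eval2[OF v] punctured_const_def)
qed

text \<open>Since v equals the interpolant of its own values, it is a combination of X^(p-1) and the
  forms (Y + c X)^(p-1). The zero form is covered by scalar multiplication with 0.\<close>

lemma Wt_top_induct [consumes 1, case_names X Y add smult]:
  assumes v: "homogeneous2 (CARD('p) - 1) (v :: 'p::prime_card bipoly)"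
    and X: "P (pX ^ (CARD('p) - 1))"
    and Y: "\<And>c. P ((pY + const2 c * pX) ^ (CARD('p) - 1))"
    and add: "\<And>v w. homogeneous2 (CARD('p) - 1) v \<Longrightarrow> homogeneous2 (CARD('p) - 1) w \<Longrightarrow> P v \<Longrightarrow> P w \<Longrightarrow> P (v + w)"
    and smult: "\<And>c v. homogeneous2 (CARD('p) - 1) v \<Longrightarrow> P v \<Longrightarrow> P (const2 c * v)"
  shows "P v"
proof -
  let ?h = "homogeneous2 (CARD('p) - 1) :: 'p bipoly \<Rightarrow> bool"
  have hX: "?h (pX ^ (CARD('p) - 1))" by (intro homogeneous2_power homogeneous2_pX)
  have hY: "?h ((pY + const2 c * pX) ^ (CARD('p) - 1))" for c by (intro homogeneous2_power homogeneous2_linear')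
  have "?h (\<Sum>m\<in>A. T m) \<and> P (\<Sum>m\<in>A. T m)"
    if "finite A" and T: "\<And>m. ?h (T m) \<and> P (T m)" for T :: "'p mod_ring \<Rightarrow> 'p bipoly" and A
    using that(1)
  proof (induction A)
    case empty
    then show ?case using smult[OF hX X, of 0] by simp
  next
    case (insert m A)
    then show ?case
      unfolding sum.insert[OF insert.hyps] using T[of m] by (blast intro: add homogeneous2_add)
  qed
  from this[OF finite, of "\<lambda>m. const2 (- eval2 v 1 m) * (pY + const2 (- m) * pX) ^ (CARD('p) - 1)"]
    smult[OF hY Y] homogeneous2_const2_mult[OF hY]
  have "?h (\<Sum>m\<in>UNIV. const2 (- eval2 v 1 m) * (pY + const2 (- m) * pX) ^ (CARD('p) - 1)) \<and>
    P (\<Sum>m\<in>UNIV. const2 (- eval2 v 1 m) * (pY + const2 (- m) * pX) ^ (CARD('p) - 1))" by blast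
  then have "P (interpolate (eval2 v))"
    unfolding interpolate_def using add smult[OF hX X] homogeneous2_const2_mult[OF hX] by blast
  then show ?thesis using interpolate_eval2[OF v] by simp
qed

section \<open>The quotient weight and its two summands\<close>

text \<open>The inverse of evaluation on the quotient weight. Later computations in the quotient are
  carried out with functions on the line and moved through this map.\<close>

definition class_of_fun :: "('p::prime_card mod_ring \<Rightarrow> 'p mod_ring \<Rightarrow> 'p mod_ring) \<Rightarrow> 'p bipoly set" where
  "class_of_fun h = to_Wt_quot (poly_of_fun h)"

lemma to_Wt_quot_eq:
  assumes P: "homogeneous2 (2 * CARD('p) - 2) (P :: 'p::prime_card bipoly)"
  shows "to_Wt_quot P = class_of_fun (eval2 P)"
proof -
  interpret quotient_by_kernel "big_wt :: ('p mod_ring, _, _) rep" line_rep KZ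
    "\<lambda>P\<in>carrier big_wt. eval2 P" big_wt_star by (rule quotient_big_wt)
  have h: "eval2 P \<in> carrier line_rep" using P by (auto intro: eval2_line_rep)
  show ?thesis
    using coset_eq_iff[of P "poly_of_fun (eval2 P)"] P homogeneous2_poly_of_fun[of "eval2 P"]
    by (simp add: class_of_fun_def to_Wt_quot_def eval2_poly_of_fun[OF h])
qed

lemma representation_Wt_quot: "representation Wt_quot (KZ :: ('p::prime_card padic ^ 2 ^ 2) set)"
proof -
  interpret quotient_by_kernel "big_wt :: ('p mod_ring, _, _) rep" line_rep KZ
    "\<lambda>P\<in>carrier big_wt. eval2 P" big_wt_star by (rule quotient_big_wt)
  show ?thesis unfolding Wt_quot_def by (rule representation_quot)
qed

lemma inducible_Wt_quot: "inducible Wt_quot (KZ :: ('p::prime_card padic ^ 2 ^ 2) set)"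
  by (intro inducible.intro representation_Wt_quot inducible_axioms.intro) (use IZ_KZ in auto)

lemma class_of_fun_eq_iff:
  fixes h h' :: "'p::prime_card mod_ring \<Rightarrow> 'p mod_ring \<Rightarrow> 'p mod_ring"
  assumes h: "h \<in> carrier line_rep" "h' \<in> carrier line_rep"
  shows "class_of_fun h = class_of_fun h' \<longleftrightarrow> h = h'"
proof -
  interpret quotient_by_kernel "big_wt :: ('p mod_ring, _, _) rep" line_rep KZ
    "\<lambda>P\<in>carrier big_wt. eval2 P" big_wt_star by (rule quotient_big_wt)
  show ?thesis
    using coset_eq_iff[of "poly_of_fun h" "poly_of_fun h'"] homogeneous2_poly_of_fun[of h] homogeneous2_poly_of_fun[of h']
    by (simp add: class_of_fun_def to_Wt_quot_def eval2_poly_of_fun h)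
qed

lemma class_of_fun_rep_hom:
  "(\<lambda>h\<in>carrier line_rep. class_of_fun h) \<in> rep_hom KZ line_rep (Wt_quot :: ('p::prime_card mod_ring, _, _) rep)"
proof -
  interpret quotient_by_kernel "big_wt :: ('p mod_ring, _, _) rep" line_rep KZ
    "\<lambda>P\<in>carrier big_wt. eval2 P" big_wt_star by (rule quotient_big_wt)
  have c: "class_of_fun h = big_wt_star +>\<^bsub>big_wt\<^esub> poly_of_fun h" for h :: "'p mod_ring \<Rightarrow> 'p mod_ring \<Rightarrow> 'p mod_ring"
    by (simp add: class_of_fun_def to_Wt_quot_def)
  have P: "poly_of_fun h \<in> carrier big_wt" for h :: "'p mod_ring \<Rightarrow> 'p mod_ring \<Rightarrow> 'p mod_ring"
    by (simp add: homogeneous2_poly_of_fun)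
  show ?thesis
  proof (rule rep_hom_restrictI[OF representation_line_rep])
    fix h h' :: "'p mod_ring \<Rightarrow> 'p mod_ring \<Rightarrow> 'p mod_ring" and k and g :: "'p padic ^ 2 ^ 2"
    assume h: "h \<in> carrier line_rep"
    show "class_of_fun h \<in> carrier Wt_quot" unfolding c Wt_quot_def by (rule coset_carrier[OF P])
    have "eval2 (const2 k * poly_of_fun h) = k \<odot>\<^bsub>line_rep :: ('p mod_ring, _, 'p padic ^ 2 ^ 2) rep\<^esub> h"
      by (intro ext) (simp add: eval2_poly_of_fun[OF h] line_rep_simps)
    then have "class_of_fun (k \<odot>\<^bsub>line_rep :: ('p mod_ring, _, 'p padic ^ 2 ^ 2) rep\<^esub> h) = to_Wt_quot (const2 k * poly_of_fun h)"
      by (simp add: to_Wt_quot_eq homogeneous2_const2_mult homogeneous2_poly_of_fun)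
    also have "\<dots> = k \<odot>\<^bsub>Wt_quot\<^esub> class_of_fun h"
      using coset_smult[OF P, of k h] unfolding Wt_quot_def c to_Wt_quot_def by simp
    finally show "class_of_fun (k \<odot>\<^bsub>line_rep :: ('p mod_ring, _, 'p padic ^ 2 ^ 2) rep\<^esub> h) = k \<odot>\<^bsub>Wt_quot\<^esub> class_of_fun h" .
    {
      assume h': "h' \<in> carrier line_rep"
      have "eval2 (poly_of_fun h + poly_of_fun h') = h \<oplus>\<^bsub>line_rep :: ('p mod_ring, _, 'p padic ^ 2 ^ 2) rep\<^esub> h'"
        by (intro ext) (simp add: eval2_poly_of_fun[OF h] eval2_poly_of_fun[OF h'] line_rep_simps)
      then have "class_of_fun (h \<oplus>\<^bsub>line_rep :: ('p mod_ring, _, 'p padic ^ 2 ^ 2) rep\<^esub> h') = to_Wt_quot (poly_of_fun h + poly_of_fun h')"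
        by (simp add: to_Wt_quot_eq homogeneous2_add homogeneous2_poly_of_fun)
      also have "\<dots> = class_of_fun h \<oplus>\<^bsub>Wt_quot\<^esub> class_of_fun h'"
        using coset_add[OF P P, of h h'] unfolding Wt_quot_def c to_Wt_quot_def by simp
      finally show "class_of_fun (h \<oplus>\<^bsub>line_rep :: ('p mod_ring, _, 'p padic ^ 2 ^ 2) rep\<^esub> h')
        = class_of_fun h \<oplus>\<^bsub>Wt_quot\<^esub> class_of_fun h'" .
    next
      assume g: "g \<in> KZ"
      have "eval2 (mat_act (red g) (poly_of_fun h)) = act line_rep g h"
        by (intro ext) (simp add: eval2_mat_act[OF homogeneous2_poly_of_fun] eval2_poly_of_fun[OF h] line_rep_simps)
      then have "class_of_fun (act line_rep g h) = to_Wt_quot (mat_act (red g) (poly_of_fun h))"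
        by (simp add: to_Wt_quot_eq homogeneous2_mat_act homogeneous2_poly_of_fun)
      also have "\<dots> = act Wt_quot g (class_of_fun h)"
        using coset_act[OF g P, of h] unfolding Wt_quot_def c to_Wt_quot_def by simp
      finally show "class_of_fun (act line_rep g h) = act Wt_quot g (class_of_fun h)" .
    }
  qed
qed

lemma class_of_fun_simps:
  fixes h :: "'p::prime_card mod_ring \<Rightarrow> 'p mod_ring \<Rightarrow> 'p mod_ring"
  assumes h: "h \<in> carrier line_rep"
  shows "class_of_fun h \<in> carrier Wt_quot"
    "h' \<in> carrier line_rep \<Longrightarrow> class_of_fun h \<oplus>\<^bsub>Wt_quot\<^esub> class_of_fun h' = class_of_fun (\<lambda>x y. h x y + h' x y)"
    "c \<odot>\<^bsub>Wt_quot\<^esub> class_of_fun h = class_of_fun (\<lambda>x y. c * h x y)"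
    "g \<in> KZ \<Longrightarrow> act Wt_quot g (class_of_fun h) = class_of_fun (act line_rep g h)"
proof -
  interpret representation line_rep "KZ :: ('p padic ^ 2 ^ 2) set" by (rule representation_line_rep)
  note hom = rep_homD[OF class_of_fun_rep_hom[where 'p='p]]
  show "class_of_fun h \<in> carrier Wt_quot" using hom(1)[OF h] h by simp
  show "h' \<in> carrier line_rep \<Longrightarrow> class_of_fun h \<oplus>\<^bsub>Wt_quot\<^esub> class_of_fun h' = class_of_fun (\<lambda>x y. h x y + h' x y)"
    using hom(2)[OF h, of h'] h by (simp add: line_rep_simps(3))
  show "c \<odot>\<^bsub>Wt_quot\<^esub> class_of_fun h = class_of_fun (\<lambda>x y. c * h x y)"
    using hom(3)[OF h, of c] smult_closed[OF h, of c] h by (simp add: line_rep_simps(4))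
  show "act Wt_quot g (class_of_fun h) = class_of_fun (act line_rep g h)" if "g \<in> KZ"
    using hom(4)[OF that h] act_closed[OF that h] h by simp
qed

lemma class_of_fun_zero: "class_of_fun (\<lambda>x y. 0 :: 'p::prime_card mod_ring) = \<zero>\<^bsub>Wt_quot\<^esub>"
  using rep_hom_zero[OF class_of_fun_rep_hom representation_line_rep representation_Wt_quot]
  by (simp add: line_rep_simps)

lemma mat_act_pX: "mat_act (mat2 c 1 1 0) (pX ^ n) = (pY + const2 c * pX) ^ n"
  by (simp add: mat_act_def add.commute)

text \<open>The forms (Y + c X)^(p-1) are translates of X^(p-1) under \<open>KZ\<close>, so X^(p-1)
  generates the weight. This gives the uniqueness that \<open>incl_top\<close> requires.\<close>

lemma Wt_top_hom_eqI:
  assumes i: "\<iota> \<in> rep_hom KZ (Wt (CARD('p) - 1) :: ('p::prime_card mod_ring, _, _) rep) N"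
      "\<iota>' \<in> rep_hom KZ (Wt (CARD('p) - 1)) N"
    and X: "\<iota> (pX ^ (CARD('p) - 1)) = \<iota>' (pX ^ (CARD('p) - 1))"
  shows "\<iota> = \<iota>'"
proof (rule extensionalityI[OF rep_homD(5)[OF i(1)] rep_homD(5)[OF i(2)]])
  fix v :: "'p bipoly" assume "v \<in> carrier (Wt (CARD('p) - 1))"
  then have "homogeneous2 (CARD('p) - 1) v" by simp
  then show "\<iota> v = \<iota>' v"
  proof (induction rule: Wt_top_induct)
    case (Y c)
    have "det (mat2 c 1 1 0) \<noteq> 0" by (simp add: det_2)
    then obtain k :: "'p padic ^ 2 ^ 2" where k: "k \<in> KZ" "red k = mat2 c 1 1 0" using red_surj by blast
    have h: "pX ^ (CARD('p) - 1) \<in> carrier (Wt (CARD('p) - 1))"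
      by (simp add: homogeneous2_power del: One_nat_def)
    have "(pY + const2 c * pX) ^ (CARD('p) - 1) = act (Wt (CARD('p) - 1)) k (pX ^ (CARD('p) - 1))"
      by (simp add: k mat_act_pX)
    then show ?case using rep_homD(4)[OF i(1) k(1) h] rep_homD(4)[OF i(2) k(1) h] X by simp
  next
    case (add v w)
    then show ?case using rep_homD(2)[OF i(1), of v w] rep_homD(2)[OF i(2), of v w] by simp
  next
    case (smult c v)
    then show ?case using rep_homD(3)[OF i(1), of v c] rep_homD(3)[OF i(2), of v c] by simp
  qed (rule X)
qed

lemma homogeneous2_0_iff: "homogeneous2 0 P \<longleftrightarrow> (\<exists>c. P = const2 c)"
proof
  assume "homogeneous2 0 P"
  then obtain c where "P = form 0 c" by (rule homogeneous2E)
  then show "\<exists>c. P = const2 c" by (auto simp: form_def)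
qed auto

lemma const2_inj [simp]: "const2 a = const2 b \<longleftrightarrow> a = b"
  by (simp add: const2_def)

text \<open>X^(p-1) and X^(2p-2) are the same function on the plane, so the prescribed inclusion
  preserves values: it sends a form to the class with the same evaluation.\<close>

lemma incl_top_eq:
  "incl_top = (\<lambda>v\<in>carrier (Wt (CARD('p) - 1)). class_of_fun (eval2 (v :: 'p::prime_card bipoly)))"
proof -
  let ?W = "Wt (CARD('p) - 1) :: ('p mod_ring, _, _) rep"
  let ?i = "\<lambda>v\<in>carrier ?W. class_of_fun (eval2 v)"
  interpret W: representation ?W KZ by (rule representation_Wt)
  have hX: "homogeneous2 (CARD('p) - 1) (pX ^ (CARD('p) - 1) :: 'p bipoly)"
    "homogeneous2 (2 * CARD('p) - 2) (pX ^ (2 * CARD('p) - 2) :: 'p bipoly)"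
    by (intro homogeneous2_power homogeneous2_pX)+
  have "eval2 (pX ^ (CARD('p) - 1) :: 'p bipoly) = eval2 (pX ^ (2 * CARD('p) - 2))"
    by (intro ext) (simp only: eval2_simps power_card_minus_1 power_2_card_minus_2)
  then have X: "?i (pX ^ (CARD('p) - 1)) = to_Wt_quot (pX ^ (2 * CARD('p) - 2))"
    using hX by (simp add: to_Wt_quot_eq)
  have hom: "?i \<in> rep_hom KZ ?W Wt_quot"
  proof -
    have "compose (carrier ?W) (\<lambda>h\<in>carrier line_rep. class_of_fun h) (\<lambda>P\<in>carrier ?W. eval2 P) \<in> rep_hom KZ ?W Wt_quot"
      by (rule rep_hom_compose[OF eval2_rep_hom class_of_fun_rep_hom representation_Wt]) simp
    also have "compose (carrier ?W) (\<lambda>h\<in>carrier line_rep. class_of_fun h) (\<lambda>P\<in>carrier ?W. eval2 P) = ?i"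
      by (auto simp: compose_def fun_eq_iff restrict_def eval2_line_rep)
    finally show ?thesis .
  qed
  show ?thesis
    unfolding incl_top_def
  proof (rule the_equality)
    show "?i \<in> rep_hom KZ ?W Wt_quot \<and> ?i (pX ^ (CARD('p) - 1)) = to_Wt_quot (pX ^ (2 * CARD('p) - 2))"
      using hom X by (rule conjI)
  next
    fix \<iota> assume i: "\<iota> \<in> rep_hom KZ ?W Wt_quot \<and> \<iota> (pX ^ (CARD('p) - 1)) = to_Wt_quot (pX ^ (2 * CARD('p) - 2))"
    show "\<iota> = ?i"
      by (rule Wt_top_hom_eqI[OF conjunct1[OF i] hom]) (simp only: conjunct2[OF i] X)
  qed
qed

text \<open>Explains the spanning vector of the small summand: it is the constant function 1 on the
  line, which is why it is invariant.\<close>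

lemma punctured_const_eval2:
  "eval2 (pX ^ (2 * CARD('p) - 2) - pX ^ (CARD('p) - 1) * pY ^ (CARD('p) - 1) + pY ^ (2 * CARD('p) - 2))
    = punctured_const (1 :: 'p::prime_card mod_ring)"
  by (intro ext) (simp add: punctured_const_def power_2_card_minus_2 power_card_minus_1_Suc0)

lemma homogeneous2_XY: "homogeneous2 (2 * CARD('p) - 2) (pX ^ (CARD('p) - 1) * pY ^ (CARD('p) - 1) :: 'p::prime_card bipoly)"
proof -
  have "homogeneous2 (CARD('p) - 1 + (CARD('p) - 1)) (pX ^ (CARD('p) - 1) * pY ^ (CARD('p) - 1) :: 'p bipoly)"
    by (intro homogeneous2_mult homogeneous2_power homogeneous2_pX homogeneous2_pY)
  moreover have "CARD('p) - 1 + (CARD('p) - 1) = 2 * CARD('p) - 2" by simp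
  ultimately show ?thesis by (simp only:)
qed

lemma punctured_const_mult: "(\<lambda>x y. c * punctured_const d x y) = punctured_const (c * d)"
  and punctured_const_add: "(\<lambda>x y. punctured_const c x y + punctured_const d x y) = punctured_const (c + d)"
  by (auto simp: punctured_const_def fun_eq_iff)

lemma punctured_const_act:
  assumes g: "g \<in> KZ"
  shows "act line_rep g (punctured_const c) = (punctured_const c :: 'p::prime_card mod_ring \<Rightarrow> _)"
proof (intro ext)
  fix x y :: "'p mod_ring"
  let ?r = "red g"
  have "x = 0 \<and> y = 0" if "x * ?r $ 1 $ 1 + y * ?r $ 2 $ 1 = 0" "x * ?r $ 1 $ 2 + y * ?r $ 2 $ 2 = 0"
  proof -
    have "x * det ?r = (x * ?r $ 1 $ 1 + y * ?r $ 2 $ 1) * ?r $ 2 $ 2 - (x * ?r $ 1 $ 2 + y * ?r $ 2 $ 2) * ?r $ 2 $ 1"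
      by (simp add: det_2 algebra_simps)
    also have "\<dots> = 0" unfolding that by simp
    finally have x: "x = 0" using det_red[OF g] by simp
    have "y * det ?r = (x * ?r $ 1 $ 2 + y * ?r $ 2 $ 2) * ?r $ 1 $ 1 - (x * ?r $ 1 $ 1 + y * ?r $ 2 $ 1) * ?r $ 1 $ 2"
      by (simp add: det_2 algebra_simps)
    also have "\<dots> = 0" unfolding that by simp
    finally show ?thesis using x det_red[OF g] by simp
  qed
  then show "act line_rep g (punctured_const c) x y = punctured_const c x y"
    by (auto simp: line_rep_simps punctured_const_def)
qed

lemma incl_0_eq:
  "incl_0 (const2 c) = class_of_fun (punctured_const (c :: 'p::prime_card mod_ring))"
proof -
  let ?W = "Wt 0 :: ('p mod_ring, 'p bipoly, 'p padic ^ 2 ^ 2) rep"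
  \<comment> \<open>A form of degree 0 is a constant; evaluating it at the origin reads that
    constant off.\<close>
  let ?i = "\<lambda>v\<in>carrier ?W. class_of_fun (punctured_const (eval2 v 0 0))"
  let ?B = "pX ^ (2 * CARD('p) - 2) - pX ^ (CARD('p) - 1) * pY ^ (CARD('p) - 1) + pY ^ (2 * CARD('p) - 2) :: 'p bipoly"
  have hB: "homogeneous2 (2 * CARD('p) - 2) ?B"
    by (intro homogeneous2_add homogeneous2_diff homogeneous2_XY homogeneous2_power homogeneous2_pX homogeneous2_pY)
  have B: "to_Wt_quot ?B = class_of_fun (punctured_const 1)"
    unfolding to_Wt_quot_eq[OF hB] punctured_const_eval2 ..
  have hom: "?i \<in> rep_hom KZ ?W Wt_quot"
  proof (rule rep_hom_restrictI[OF representation_Wt])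
    fix g :: "'p padic ^ 2 ^ 2" and v :: "'p bipoly" assume "g \<in> KZ" "v \<in> carrier ?W"
    then show "class_of_fun (punctured_const (eval2 (act ?W g v) 0 0)) = act Wt_quot g (class_of_fun (punctured_const (eval2 v 0 0)))"
      by (auto simp: homogeneous2_0_iff mat_act_def class_of_fun_simps punctured_const_act)
  qed (auto simp: class_of_fun_simps punctured_const_mult punctured_const_add)
  have "incl_0 = ?i"
    unfolding incl_0_def
  proof (rule the_equality)
    show "?i \<in> rep_hom KZ (Wt 0) Wt_quot \<and> ?i 1 = to_Wt_quot ?B" using hom B by simp
  next
    fix \<iota> assume i: "\<iota> \<in> rep_hom KZ ?W Wt_quot \<and> \<iota> 1 = to_Wt_quot ?B"
    show "\<iota> = ?i"
    proof (rule extensionalityI[OF rep_homD(5)[OF conjunct1[OF i]] rep_homD(5)[OF hom]])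
      fix v :: "'p bipoly" assume "v \<in> carrier ?W"
      then obtain c where v: "v = c \<odot>\<^bsub>?W\<^esub> 1" by (auto simp: homogeneous2_0_iff)
      have "1 \<in> carrier ?W" by simp
      then show "\<iota> v = ?i v"
        unfolding v rep_homD(3)[OF hom \<open>1 \<in> carrier ?W\<close>] rep_homD(3)[OF conjunct1[OF i] \<open>1 \<in> carrier ?W\<close>]
        using i B by simp
    qed
  qed
  then have "incl_0 (const2 c) = ?i (const2 c)" by (rule fun_cong)
  then show ?thesis by simp
qed

text \<open>Existence and uniqueness of the decomposition at once. Forms of degree p - 1 have total
  0 and the constant c has total (p + 1) c = c, so totals determine the constant part; the values
  that remain determine the form.\<close>

lemma class_of_fun_decomp_iff:
  fixes h :: "'p::prime_card mod_ring \<Rightarrow> 'p mod_ring \<Rightarrow> 'p mod_ring"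
  assumes h: "h \<in> carrier line_rep" and v: "v \<in> carrier (Wt (CARD('p) - 1))" and w: "w \<in> carrier (Wt 0)"
  shows "class_of_fun h = incl_top v \<oplus>\<^bsub>Wt_quot\<^esub> incl_0 w \<longleftrightarrow> v = interpolate h \<and> w = const2 (line_total h)"
proof -
  obtain c where c: "w = const2 c" using w by (auto simp: homogeneous2_0_iff)
  have hv: "eval2 v \<in> carrier line_rep" "line_total (eval2 v) = 0"
    using v by (auto intro: eval2_line_rep total_eval2)
  have "incl_top v \<oplus>\<^bsub>Wt_quot\<^esub> incl_0 w = class_of_fun (\<lambda>x y. eval2 v x y + punctured_const c x y)"
    using v hv by (simp add: incl_top_eq c incl_0_eq class_of_fun_simps del: One_nat_def)
  then have "class_of_fun h = incl_top v \<oplus>\<^bsub>Wt_quot\<^esub> incl_0 w \<longleftrightarrow> h = (\<lambda>x y. eval2 v x y + punctured_const c x y)"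
    using hv h by (simp add: class_of_fun_eq_iff)
  also have "\<dots> \<longleftrightarrow> v = interpolate h \<and> w = const2 (line_total h)"
  proof
    assume e: "h = (\<lambda>x y. eval2 v x y + punctured_const c x y)"
    then have t: "line_total h = c" using hv by (simp add: total_add)
    have "eval2 (interpolate h) = eval2 v"
      by (intro ext) (simp add: eval2_interpolate[OF h] t, simp add: e)
    then have "interpolate h = v" using v by (intro eval2_inj homogeneous2_interpolate) auto
    then show "v = interpolate h \<and> w = const2 (line_total h)" using t c by simp
  next
    assume "v = interpolate h \<and> w = const2 (line_total h)"
    then show "h = (\<lambda>x y. eval2 v x y + punctured_const c x y)"
      by (intro ext) (simp add: eval2_interpolate[OF h] c)
  qed
  finally show ?thesis .
qed

lemma proj_top_class:
  assumes h: "h \<in> carrier line_rep"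
  shows "proj_top (class_of_fun h) = interpolate (h :: 'p::prime_card mod_ring \<Rightarrow> _)"
  unfolding proj_top_def
proof (rule the_equality)
  have "interpolate h \<in> carrier (Wt (CARD('p) - 1))" "const2 (line_total h) \<in> carrier (Wt 0)"
    using homogeneous2_interpolate by simp_all
  then show "interpolate h \<in> carrier (Wt (CARD('p) - 1)) \<and>
    (\<exists>w\<in>carrier (Wt 0). class_of_fun h = incl_top (interpolate h) \<oplus>\<^bsub>Wt_quot\<^esub> incl_0 w)"
    using class_of_fun_decomp_iff[OF h] by blast
qed (use class_of_fun_decomp_iff[OF h] in blast)

lemma proj_0_class:
  assumes h: "h \<in> carrier line_rep"
  shows "proj_0 (class_of_fun h) = const2 (line_total (h :: 'p::prime_card mod_ring \<Rightarrow> _))"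
  unfolding proj_0_def
proof (rule the_equality)
  have "interpolate h \<in> carrier (Wt (CARD('p) - 1))" "const2 (line_total h) \<in> carrier (Wt 0)"
    using homogeneous2_interpolate by simp_all
  then show "const2 (line_total h) \<in> carrier (Wt 0) \<and>
    (\<exists>v\<in>carrier (Wt (CARD('p) - 1)). class_of_fun h = incl_top v \<oplus>\<^bsub>Wt_quot\<^esub> incl_0 (const2 (line_total h)))"
    using class_of_fun_decomp_iff[OF h] by blast
qed (use class_of_fun_decomp_iff[OF h] in blast)

section \<open>Fibres of functions over the projective line\<close>

lemma ind_triv_carrier_iff:
  "f \<in> carrier (ind_triv :: ('p::prime_card mod_ring, _, _) rep) \<longleftrightarrow> f \<in> extensional GL2 \<and>
    (\<forall>h\<in>IZ. \<forall>x\<in>GL2. f (h ** x) = f x) \<and> finite_mod IZ (\<lambda>x. f x \<noteq> 0)"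
  unfolding ind_triv_def inducible.ind_carrier_iff[OF inducible_triv] by simp

lemma ind_triv_carrierD:
  assumes "f \<in> carrier (ind_triv :: ('p::prime_card mod_ring, _, _) rep)"
  shows "h \<in> IZ \<Longrightarrow> x \<in> GL2 \<Longrightarrow> f (h ** x) = f x"
    and "finite_mod IZ (\<lambda>x. f x \<noteq> 0)"
    and "f \<in> extensional GL2"
  using assms by (simp_all add: ind_triv_carrier_iff)

lemma ind_triv_carrierI:
  fixes f :: "'p::prime_card padic ^ 2 ^ 2 \<Rightarrow> 'p mod_ring"
  assumes "\<And>h x :: 'p padic ^ 2 ^ 2. h \<in> IZ \<Longrightarrow> x \<in> GL2 \<Longrightarrow> f (h ** x) = f x"
    and "finite_mod IZ (\<lambda>x. f x \<noteq> 0)"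
  shows "(\<lambda>x\<in>GL2. f x) \<in> carrier ind_triv"
  unfolding ind_triv_def by (rule inducible.ind_carrierI[OF inducible_triv]) (use assms in auto)

lemma ind_triv_eqI:
  fixes f :: "'p::prime_card padic ^ 2 ^ 2 \<Rightarrow> 'p mod_ring"
  assumes "f \<in> carrier ind_triv" "f' \<in> carrier ind_triv" "\<And>x. x \<in> GL2 \<Longrightarrow> f x = f' x"
  shows "f = f'"
  using assms unfolding ind_triv_def by (rule inducible.ind_eqI[OF inducible_triv])

lemma ind_triv_apply:
  assumes "x \<in> GL2"
  shows "\<zero>\<^bsub>ind_triv\<^esub> x = 0"
    "(f \<oplus>\<^bsub>ind_triv\<^esub> f') x = f x + f' x"
    "(c \<odot>\<^bsub>ind_triv\<^esub> f) x = c * f x"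
    "act ind_triv g f x = f (x ** g)"
  using assms unfolding ind_triv_def by (simp_all add: ind_apply)

lemma representation_ind_triv: "representation (ind_triv :: ('p::prime_card mod_ring, _, _) rep) GL2"
  unfolding ind_triv_def by (rule inducible.representation_ind[OF inducible_triv])

lemma ind_elem_IZ_carrier [simp]: "g \<in> GL2 \<Longrightarrow> ind_elem_IZ g \<in> carrier (ind_triv :: ('p::prime_card mod_ring, _, _) rep)"
  unfolding ind_triv_def by (rule inducible.ind_elem_carrier[OF inducible_triv]) simp_all

lemma ind_elem_IZ_apply:
  "x \<in> GL2 \<Longrightarrow> g \<in> GL2 \<Longrightarrow> ind_elem_IZ g x = (if x ** g \<in> IZ then 1 else (0 :: 'p::prime_card mod_ring))"
  by (simp add: inducible.ind_elem_apply[OF inducible_triv])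

lemma act_ind_elem_IZ:
  "g \<in> GL2 \<Longrightarrow> g' \<in> GL2 \<Longrightarrow> act ind_triv g' (ind_elem_IZ g) = ind_elem_IZ (g' ** g :: 'p::prime_card padic ^ 2 ^ 2)"
  unfolding ind_triv_def by (rule inducible.act_ind_elem[OF inducible_triv]) simp_all

lemma ind_triv_hom_eqI:
  assumes S: "S \<in> rep_hom GL2 (ind_triv :: ('p::prime_card mod_ring, _, _) rep) N" "S' \<in> rep_hom GL2 ind_triv N"
    and N: "representation N GL2" and eq: "S (ind_elem_IZ (mat 1)) = S' (ind_elem_IZ (mat 1))"
  shows "S = S'"
proof (rule inducible.ind_hom_eqI[OF inducible_triv S[unfolded ind_triv_def] N])
  fix v :: "'p mod_ring"
  have "ind_elem IZ triv (mat 1) v = v \<odot>\<^bsub>ind_triv\<^esub> ind_elem_IZ (mat 1 :: 'p padic ^ 2 ^ 2)"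
    using inducible.ind_elem_smult[OF inducible_triv, of "mat 1" 1 v] by (simp add: ind_triv_def)
  then show "S (ind_elem IZ triv (mat 1) v) = S' (ind_elem IZ triv (mat 1) v)"
    using rep_homD(3)[OF S(1)] rep_homD(3)[OF S(2)] eq by simp
qed

text \<open>An arbitrary choice. Another choice differs by a left factor in \<open>IZ\<close>, which
  functions in \<open>ind_triv\<close> do not see.\<close>

definition bottom_lift :: "'p::prime_card mod_ring \<Rightarrow> 'p mod_ring \<Rightarrow> 'p padic ^ 2 ^ 2" where
  "bottom_lift x z = (SOME k. k \<in> KZ \<and> red k $ 2 $ 1 = x \<and> red k $ 2 $ 2 = z)"

text \<open>The function \<open>f\<close> on the coset \<open>KZ y\<close>, viewed as a function on \<open>IZ \<setminus> KZ\<close>, which is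
  the projective line by way of bottom rows.\<close>

definition line_fun ::
  "('p::prime_card padic ^ 2 ^ 2 \<Rightarrow> 'p mod_ring) \<Rightarrow> 'p padic ^ 2 ^ 2 \<Rightarrow> 'p mod_ring \<Rightarrow> 'p mod_ring \<Rightarrow> 'p mod_ring" where
  "line_fun f y x z = (if x = 0 \<and> z = 0 then 0 else f (bottom_lift x z ** y))"

lemma bottom_lift:
  assumes "x \<noteq> 0 \<or> z \<noteq> 0"
  shows "bottom_lift x z \<in> KZ" "red (bottom_lift x z) $ 2 $ 1 = x" "red (bottom_lift x z) $ 2 $ 2 = z"
proof -
  define A where "A = (if z = 0 then mat2 0 1 x z else mat2 1 0 x z)"
  have "det A \<noteq> 0" using assms by (auto simp: A_def det_2)
  then obtain k :: "'a padic ^ 2 ^ 2" where "k \<in> KZ" "red k = A" using red_surj by blast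
  then have "\<exists>k :: 'a padic ^ 2 ^ 2. k \<in> KZ \<and> red k $ 2 $ 1 = x \<and> red k $ 2 $ 2 = z"
    by (auto simp: A_def)
  then have "bottom_lift x z \<in> KZ \<and> red (bottom_lift x z) $ 2 $ 1 = x \<and> red (bottom_lift x z) $ 2 $ 2 = z"
    unfolding bottom_lift_def by (rule someI_ex)
  then show "bottom_lift x z \<in> KZ" "red (bottom_lift x z) $ 2 $ 1 = x" "red (bottom_lift x z) $ 2 $ 2 = z"
    by blast+
qed

lemma bottom_row_nonzero: "k \<in> KZ \<Longrightarrow> red k $ 2 $ 1 \<noteq> 0 \<or> red k $ 2 $ 2 \<noteq> 0"
  using det_red[of k] by (auto simp: det_2)

text \<open>Independence of the chosen lift: by \<open>KZ_same_bottom_row\<close>, proportional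
  bottom rows come from the same coset of \<open>IZ\<close>. The factor t also gives invariance
  under scaling.\<close>

lemma line_fun_KZ:
  assumes f: "f \<in> carrier (ind_triv :: ('p::prime_card mod_ring, _, _) rep)" and y: "y \<in> GL2" and k: "k \<in> KZ"
  shows "line_fun f y (t * red k $ 2 $ 1) (t * red k $ 2 $ 2) = (if t = 0 then 0 else f (k ** y))"
proof (cases "t = 0")
  case False
  let ?x = "t * red k $ 2 $ 1" and ?z = "t * red k $ 2 $ 2"
  have nz: "?x \<noteq> 0 \<or> ?z \<noteq> 0" using False bottom_row_nonzero[OF k] by simp
  obtain i where "i \<in> IZ" "bottom_lift ?x ?z = i ** k"
    using KZ_same_bottom_row[OF bottom_lift(1)[OF nz] k, of t] bottom_lift(2,3)[OF nz] by blast
  then have "f (bottom_lift ?x ?z ** y) = f (k ** y)"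
    using ind_triv_carrierD(1)[OF f, of i "k ** y"] y k by (simp add: matrix_mul_assoc[symmetric] KZ_sub_GL2)
  then show ?thesis using nz False by (auto simp: line_fun_def)
qed (simp add: line_fun_def)

lemma line_funI:
  assumes "h 0 0 = 0" "h' 0 0 = 0"
    and "\<And>k :: 'p::prime_card padic ^ 2 ^ 2. k \<in> KZ \<Longrightarrow> h (red k $ 2 $ 1) (red k $ 2 $ 2) = h' (red k $ 2 $ 1) (red k $ 2 $ 2)"
  shows "h = h'"
proof (intro ext)
  fix x z
  show "h x z = h' x z"
  proof (cases "x = 0 \<and> z = 0")
    case False
    then show ?thesis using assms(3)[OF bottom_lift(1)[of x z]] bottom_lift(2,3)[of x z] by simp
  qed (use assms in simp)
qed

lemma line_fun_bottom:
  assumes "f \<in> carrier (ind_triv :: ('p::prime_card mod_ring, _, _) rep)" "y \<in> GL2" "k \<in> KZ"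
  shows "line_fun f y (red k $ 2 $ 1) (red k $ 2 $ 2) = f (k ** y)"
  using line_fun_KZ[OF assms, of 1] by simp

lemma line_fun_0 [simp]: "line_fun f y 0 0 = 0"
  by (simp add: line_fun_def)

lemma line_fun_0_1:
  assumes "f \<in> carrier (ind_triv :: ('p::prime_card mod_ring, _, _) rep)" "y \<in> GL2"
  shows "line_fun f y 0 1 = f y"
  using line_fun_bottom[OF assms, of "mat 1"] by simp

lemma line_fun_line_rep:
  assumes f: "f \<in> carrier (ind_triv :: ('p::prime_card mod_ring, _, _) rep)" and y: "y \<in> GL2"
  shows "line_fun f y \<in> carrier line_rep"
proof -
  have "line_fun f y (t * x) (t * z) = line_fun f y x z" if t: "t \<noteq> 0" for t x z
  proof (cases "x = 0 \<and> z = 0")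
    case False
    then have nz: "x \<noteq> 0 \<or> z \<noteq> 0" by blast
    show ?thesis
      using line_fun_KZ[OF f y bottom_lift(1)[OF nz], of t] line_fun_bottom[OF f y bottom_lift(1)[OF nz]] t
      by (simp add: bottom_lift[OF nz])
  qed simp
  then show ?thesis by (simp add: line_rep_simps)
qed

text \<open>Multiplying k' by k on the right multiplies the bottom row of k' by
  \<open>red k\<close>, and this substitution in the row is how \<open>line_rep\<close> is acted
  on.\<close>

lemma line_fun_left_mult:
  assumes f: "f \<in> carrier (ind_triv :: ('p::prime_card mod_ring, _, _) rep)" and y: "y \<in> GL2" and k: "k \<in> KZ"
  shows "line_fun f (k ** y) = act line_rep k (line_fun f y)"
proof (rule line_funI)
  fix k' :: "'p padic ^ 2 ^ 2" assume k': "k' \<in> KZ"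
  have "line_fun f (k ** y) (red k' $ 2 $ 1) (red k' $ 2 $ 2) = f ((k' ** k) ** y)"
    using line_fun_bottom[OF f _ k', of "k ** y"] k y by (simp add: KZ_sub_GL2 matrix_mul_assoc)
  also have "\<dots> = line_fun f y (red (k' ** k) $ 2 $ 1) (red (k' ** k) $ 2 $ 2)"
    using line_fun_bottom[OF f y, of "k' ** k"] k k' by simp
  finally show "line_fun f (k ** y) (red k' $ 2 $ 1) (red k' $ 2 $ 2)
      = act line_rep k (line_fun f y) (red k' $ 2 $ 1) (red k' $ 2 $ 2)"
    using k k' by (simp add: line_rep_simps matrix_mult_nth_2)
qed (simp_all add: line_rep_simps)

lemma line_fun_add:
  assumes "y \<in> GL2"
  shows "line_fun (f \<oplus>\<^bsub>ind_triv\<^esub> f') y = (\<lambda>x z. line_fun f y x z + line_fun f' y x z)"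
  using assms by (intro ext) (auto simp: line_fun_def ind_triv_apply KZ_sub_GL2 bottom_lift)

lemma line_fun_smult:
  assumes "y \<in> GL2"
  shows "line_fun (c \<odot>\<^bsub>ind_triv\<^esub> f) y = (\<lambda>x z. c * line_fun f y x z)"
  using assms by (intro ext) (auto simp: line_fun_def ind_triv_apply KZ_sub_GL2 bottom_lift)

lemma line_fun_act:
  assumes "y \<in> GL2"
  shows "line_fun (act ind_triv g f) y = line_fun f (y ** g)"
  using assms by (intro ext) (auto simp: line_fun_def ind_triv_apply KZ_sub_GL2 bottom_lift matrix_mul_assoc)

text \<open>A nonzero fibre over y means a nonzero value of f somewhere on KZ y, and only finitely
  many cosets of \<open>KZ\<close> carry such values.\<close>

lemma finite_mod_line_fun:
  assumes f: "f \<in> carrier (ind_triv :: ('p::prime_card mod_ring, _, _) rep)"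
  shows "finite_mod KZ (\<lambda>y. line_fun f y \<noteq> (\<lambda>x z. 0))"
proof -
  have "finite_mod KZ (\<lambda>y. f y \<noteq> 0)" using ind_triv_carrierD(2)[OF f] finite_mod_IZ_iff_KZ by blast
  then obtain F where F: "F \<subseteq> GL2" "finite F" "\<And>x. x \<in> GL2 \<Longrightarrow> f x \<noteq> 0 \<Longrightarrow> \<exists>h\<in>KZ. \<exists>y\<in>F. x = h ** y"
    unfolding finite_mod_def by blast
  have "\<exists>h\<in>KZ. \<exists>w\<in>F. y = h ** w" if y: "y \<in> GL2" "line_fun f y \<noteq> (\<lambda>x z. 0)" for y
  proof -
    obtain x z where xz: "line_fun f y x z \<noteq> 0" using y(2) by (auto simp: fun_eq_iff)
    then have nz: "x \<noteq> 0 \<or> z \<noteq> 0" by auto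
    let ?k = "bottom_lift x z"
    have k: "?k \<in> KZ" by (rule bottom_lift(1)[OF nz])
    have "f (?k ** y) \<noteq> 0" using xz nz by (auto simp: line_fun_def)
    then obtain h w where hw: "h \<in> KZ" "w \<in> F" "?k ** y = h ** w"
      using F(3)[of "?k ** y"] GL2_mult[OF KZ_sub_GL2[OF k] y(1)] by blast
    have "y = matrix_inv ?k ** (?k ** y)" using k by (simp add: KZ_sub_GL2)
    also have "\<dots> = (matrix_inv ?k ** h) ** w" unfolding hw(3) by (simp only: matrix_mul_assoc)
    finally show ?thesis using hw k KZ_inv by blast
  qed
  then show ?thesis unfolding finite_mod_def using F by blast
qed

text \<open>Behind this is transitivity of induction: inducing the trivial character from
  \<open>IZ\<close> to \<open>KZ\<close> gives the functions on the line, so a \<open>KZ\<close>-map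
  b out of \<open>line_rep\<close> induces a map between the compactly induced
  representations.\<close>

definition fibrewise ::
  "(('p::prime_card mod_ring \<Rightarrow> 'p mod_ring \<Rightarrow> 'p mod_ring) \<Rightarrow> 'v) \<Rightarrow>
    ('p padic ^ 2 ^ 2 \<Rightarrow> 'p mod_ring) \<Rightarrow> 'p padic ^ 2 ^ 2 \<Rightarrow> 'v" where
  "fibrewise b = (\<lambda>f\<in>carrier ind_triv. \<lambda>y\<in>GL2. b (line_fun f y))"

lemma fibrewise_rep_hom:
  fixes \<sigma> :: "('p::prime_card mod_ring, 'v, 'p padic ^ 2 ^ 2) rep"
  assumes b: "(\<lambda>h\<in>carrier line_rep. b h) \<in> rep_hom KZ line_rep \<sigma>" and \<sigma>: "inducible \<sigma> KZ"
  shows "fibrewise b \<in> rep_hom GL2 ind_triv (ind KZ \<sigma>)"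
proof -
  interpret inducible \<sigma> KZ by (rule \<sigma>)
  interpret L: representation line_rep "KZ :: ('p padic ^ 2 ^ 2) set" by (rule representation_line_rep)
  interpret I: representation "ind_triv :: ('p mod_ring, _, 'p padic ^ 2 ^ 2) rep" GL2 by (rule representation_ind_triv)
  interpret J: representation "ind KZ \<sigma>" GL2 by (rule representation_ind)
  have bc: "b h \<in> carrier \<sigma>" if "h \<in> carrier line_rep" for h
    using rep_homD(1)[OF b that] that by simp
  have ba: "b (\<lambda>x y. h x y + h' x y) = b h \<oplus>\<^bsub>\<sigma>\<^esub> b h'" if "h \<in> carrier line_rep" "h' \<in> carrier line_rep" for h h'
    using rep_homD(2)[OF b that] that by (simp add: line_rep_simps(3))
  have bs: "b (\<lambda>x y. c * h x y) = c \<odot>\<^bsub>\<sigma>\<^esub> b h" if "h \<in> carrier line_rep" for c h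
    using rep_homD(3)[OF b that, of c] L.smult_closed[OF that, of c] that by (simp add: line_rep_simps(4))
  have bg: "b (act line_rep g h) = act \<sigma> g (b h)" if "g \<in> KZ" "h \<in> carrier line_rep" for g h
    using rep_homD(4)[OF b that] L.act_closed[OF that] that by simp
  have b0: "b (\<lambda>x y. 0) = \<zero>\<^bsub>\<sigma>\<^esub>"
    using rep_hom_zero[OF b representation_line_rep representation_axioms] by (simp add: line_rep_simps)
  show ?thesis
    unfolding fibrewise_def
  proof (rule rep_hom_restrictI[OF representation_ind_triv])
    show cl: "(\<lambda>y\<in>GL2. b (line_fun f y)) \<in> carrier (ind KZ \<sigma>)" if f: "f \<in> carrier ind_triv" for f
    proof (rule ind_carrierI)
      show "finite_mod KZ (\<lambda>y. b (line_fun f y) \<noteq> \<zero>\<^bsub>\<sigma>\<^esub>)"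
        by (rule finite_mod_mono[OF finite_mod_line_fun[OF f]]) (use b0 in auto)
    qed (use f in \<open>auto intro: bc line_fun_line_rep simp: line_fun_left_mult bg line_fun_line_rep\<close>)
    fix f :: "'p padic ^ 2 ^ 2 \<Rightarrow> 'p mod_ring" assume f: "f \<in> carrier ind_triv"
    show "(\<lambda>y\<in>GL2. b (line_fun (c \<odot>\<^bsub>ind_triv\<^esub> f) y)) = c \<odot>\<^bsub>ind KZ \<sigma>\<^esub> (\<lambda>y\<in>GL2. b (line_fun f y))" for c
      using f by (auto simp: ind_simps line_fun_smult bs line_fun_line_rep)
    show "(\<lambda>y\<in>GL2. b (line_fun (act ind_triv g f) y)) = act (ind KZ \<sigma>) g (\<lambda>y\<in>GL2. b (line_fun f y))"
      if "g \<in> GL2" for g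
      using f that by (auto simp: ind_simps line_fun_act)
    fix f' :: "'p padic ^ 2 ^ 2 \<Rightarrow> 'p mod_ring" assume f': "f' \<in> carrier ind_triv"
    show "(\<lambda>y\<in>GL2. b (line_fun (f \<oplus>\<^bsub>ind_triv\<^esub> f') y))
        = (\<lambda>y\<in>GL2. b (line_fun f y)) \<oplus>\<^bsub>ind KZ \<sigma>\<^esub> (\<lambda>y\<in>GL2. b (line_fun f' y))"
      using f f' by (auto simp: ind_simps line_fun_add ba line_fun_line_rep)
  qed
qed

lemma fibrewise_apply: "f \<in> carrier ind_triv \<Longrightarrow> y \<in> GL2 \<Longrightarrow> fibrewise b f y = b (line_fun f y)"
  by (simp add: fibrewise_def)

text \<open>The indicator of the point (0:1), which is the fibre of the generator [[id, 1]] over the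
  identity.\<close>

definition point_fun :: "'p::prime_card mod_ring \<Rightarrow> 'p mod_ring \<Rightarrow> 'p mod_ring" where
  "point_fun x z = (if x = 0 \<and> z \<noteq> 0 then 1 else 0)"

lemma point_fun_line_rep [simp]: "point_fun \<in> carrier line_rep"
  by (auto simp: line_rep_simps point_fun_def)

lemma line_fun_ind_elem:
  assumes y: "y \<in> GL2"
  shows "line_fun (ind_elem_IZ (mat 1)) y =
    (if y \<in> KZ then act line_rep y point_fun else (\<lambda>x z. 0 :: 'p::prime_card mod_ring))"
proof (cases "y \<in> KZ")
  case True
  let ?e = "ind_elem_IZ (mat 1) :: 'p padic ^ 2 ^ 2 \<Rightarrow> 'p mod_ring"
  have "line_fun ?e (mat 1) = point_fun"
  proof (rule line_funI)
    fix k :: "'p padic ^ 2 ^ 2" assume k: "k \<in> KZ"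
    then show "line_fun ?e (mat 1) (red k $ 2 $ 1) (red k $ 2 $ 2) = point_fun (red k $ 2 $ 1) (red k $ 2 $ 2)"
      using line_fun_bottom[of ?e "mat 1" k] bottom_row_nonzero[OF k]
      by (auto simp: ind_elem_IZ_apply KZ_sub_GL2 point_fun_def IZ_iff)
  qed (simp_all add: point_fun_def)
  then show ?thesis using line_fun_left_mult[of ?e "mat 1" y] True by simp
next
  case False
  have "y \<in> KZ" if "k ** y \<in> IZ" "k \<in> KZ" for k
    using that KZ_mult_closed[OF KZ_inv[OF that(2)] IZ_KZ[OF that(1)]] by (simp add: KZ_sub_GL2)
  then have "bottom_lift x z ** y \<notin> IZ" if "x \<noteq> 0 \<or> z \<noteq> 0" for x z
    using False bottom_lift(1)[OF that] by blast
  then show ?thesis using False y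
    by (intro ext) (auto simp: line_fun_def ind_elem_IZ_apply KZ_sub_GL2 bottom_lift)
qed

lemma total_hom: "(\<lambda>h\<in>carrier line_rep. const2 (line_total h)) \<in> rep_hom KZ line_rep (Wt 0 :: ('p::prime_card mod_ring, _, _) rep)"
  by (rule rep_hom_restrictI[OF representation_line_rep])
    (simp_all add: total_act, simp_all add: line_rep_simps total_add total_smult mat_act_def)

lemma interpolate_hom:
  "(\<lambda>h\<in>carrier line_rep. interpolate h) \<in> rep_hom KZ line_rep (Wt (CARD('p) - 1) :: ('p::prime_card mod_ring, _, _) rep)"
proof (rule rep_hom_restrictI[OF representation_line_rep])
  interpret representation line_rep "KZ :: ('p padic ^ 2 ^ 2) set" by (rule representation_line_rep)
  let ?W = "Wt (CARD('p) - 1) :: ('p mod_ring, _, 'p padic ^ 2 ^ 2) rep"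
  let ?L = "line_rep :: ('p mod_ring, _, 'p padic ^ 2 ^ 2) rep"
  fix h h' :: "'p mod_ring \<Rightarrow> 'p mod_ring \<Rightarrow> 'p mod_ring" assume h: "h \<in> carrier line_rep"
  show "interpolate h \<in> carrier ?W" using homogeneous2_interpolate by simp
  show "interpolate (c \<odot>\<^bsub>?L\<^esub> h) = c \<odot>\<^bsub>?W\<^esub> interpolate h" for c
    by (simp add: interpolate_def line_rep_simps(4) sum_distrib_left algebra_simps)
  show "interpolate (h \<oplus>\<^bsub>?L\<^esub> h') = interpolate h \<oplus>\<^bsub>?W\<^esub> interpolate h'"
    by (simp add: interpolate_def line_rep_simps(3) sum.distrib sum_subtractf algebra_simps sum_negf)
  fix g :: "'p padic ^ 2 ^ 2" assume g: "g \<in> KZ"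
  \<comment> \<open>The formula for \<open>interpolate\<close> treats (0:1) separately and does not
    show equivariance. The values do: they are h minus a constant, and both the total and the
    constants are invariant.\<close>
  have "interpolate (act ?L g h) = mat_act (red g) (interpolate h)"
  proof (rule eval2_inj[OF homogeneous2_interpolate homogeneous2_mat_act[OF homogeneous2_interpolate]], intro ext)
    fix x y
    have "punctured_const (line_total h) x y = act ?L g (punctured_const (line_total h)) x y"
      using punctured_const_act[OF g] by simp
    then show "eval2 (interpolate (act ?L g h)) x y = eval2 (mat_act (red g) (interpolate h)) x y"
      unfolding eval2_mat_act[OF homogeneous2_interpolate] eval2_interpolate[OF act_closed[OF g h]]
        eval2_interpolate[OF h] total_act[OF g h]
      by (simp add: line_rep_simps(5))
  qed
  then show "interpolate (act ?L g h) = act ?W g (interpolate h)" by simp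
qed

lemma interpolate_zero: "interpolate (\<lambda>x y. 0) = 0"
  by (simp add: interpolate_def)

text \<open>The section of both projections: a form of degree \<open>0\<close> or \<open>p - 1\<close> is evaluated at the
  point \<open>(0 : 1)\<close>, which is fixed by the Iwahori subgroup.\<close>

definition section_fun ::
  "nat \<Rightarrow> ('p::prime_card padic ^ 2 ^ 2 \<Rightarrow> 'p bipoly) \<Rightarrow> 'p padic ^ 2 ^ 2 \<Rightarrow> 'p mod_ring" where
  "section_fun r = (\<lambda>F\<in>carrier (ind KZ (Wt r)). \<lambda>y\<in>GL2. eval2 (F y) 0 1)"

lemma ind_Wt_left_mult:
  assumes F: "F \<in> carrier (ind KZ (Wt r))" and y: "y \<in> GL2" and k: "k \<in> (KZ :: ('p::prime_card padic ^ 2 ^ 2) set)"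
  shows "homogeneous2 r (F y)"
    "eval2 (F (k ** y)) 0 1 = eval2 (F y) (red k $ 2 $ 1) (red k $ 2 $ 2)"
proof -
  show h: "homogeneous2 r (F y)" using inducible.ind_carrierD(1)[OF inducible_Wt F y] by simp
  show "eval2 (F (k ** y)) 0 1 = eval2 (F y) (red k $ 2 $ 1) (red k $ 2 $ 2)"
    using inducible.ind_carrierD(2)[OF inducible_Wt F k y] by (simp add: eval2_mat_act[OF h])
qed

lemma section_fun_rep_hom:
  assumes r: "r = 0 \<or> r = CARD('p) - 1"
  shows "section_fun r \<in> rep_hom GL2 (ind KZ (Wt r)) (ind_triv :: ('p::prime_card mod_ring, _, _) rep)"
  unfolding section_fun_def
proof (rule rep_hom_restrictI[OF inducible.representation_ind[OF inducible_Wt]])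
  \<comment> \<open>An element of \<open>IZ\<close> has reduced bottom row (0, d) with d nonzero; in
    degree 0 or p - 1 the factor d^r is 1.\<close>
  have scale: "eval2 P 0 d = eval2 P 0 1" if "homogeneous2 r P" "d \<noteq> 0" for P and d :: "'p mod_ring"
    using eval2_scale[OF that(1), of d 0 1] that(2) r power_card_minus_1[of d] by auto
  show "(\<lambda>y\<in>GL2. eval2 (F y) 0 1) \<in> carrier ind_triv" if F: "F \<in> carrier (ind KZ (Wt r))"
    for F :: "'p padic ^ 2 ^ 2 \<Rightarrow> 'p bipoly"
  proof (rule ind_triv_carrierI)
    fix i y :: "'p padic ^ 2 ^ 2" assume i: "i \<in> IZ" and y: "y \<in> GL2"
    have k: "i \<in> KZ" "red i $ 2 $ 1 = 0" using i by (simp_all add: IZ_iff)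
    then have "red i $ 2 $ 2 \<noteq> 0" using bottom_row_nonzero by blast
    from scale[OF ind_Wt_left_mult(1)[OF F y k(1)] this]
    show "eval2 (F (i ** y)) 0 1 = eval2 (F y) 0 1"
      unfolding ind_Wt_left_mult(2)[OF F y k(1)] k(2) .
  next
    show "finite_mod IZ (\<lambda>y. eval2 (F y) 0 1 \<noteq> 0)"
      unfolding finite_mod_IZ_iff_KZ
      by (rule finite_mod_mono[OF inducible.ind_carrierD(3)[OF inducible_Wt F]]) auto
  qed
qed (auto simp: ind_simps ind_triv_def)

section \<open>The operators on \<open>ind_triv\<close>\<close>

lemma finite_I1 [simp]: "finite (I1 :: 'p::prime_card padic_int set)"
  by (simp add: I1_def)

lemma sum_I1: "(\<Sum>l\<in>I1. f l) = (\<Sum>x\<in>UNIV. f (teich (x :: 'p::prime_card mod_ring)))"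
  unfolding I1_def by (subst sum.reindex) (simp_all add: inj_teich)

lemma finsum_triv: "finite A \<Longrightarrow> finsum (triv :: ('p::prime_card mod_ring, _, 'p padic ^ 2 ^ 2) rep) f A = sum f A"
proof (induction A rule: finite_induct)
  interpret inducible triv "IZ :: ('p padic ^ 2 ^ 2) set" by (rule inducible_triv)
  case empty
  show ?case by simp
next
  interpret inducible triv "IZ :: ('p padic ^ 2 ^ 2) set" by (rule inducible_triv)
  case (insert a A)
  then show ?case by (simp add: finsum_insert)
qed

lemma finsum_Wt:
  assumes "finite A" "\<And>a. a \<in> A \<Longrightarrow> homogeneous2 r (f a)"
  shows "finsum (Wt r :: ('p::prime_card mod_ring, _, 'p padic ^ 2 ^ 2) rep) f A = sum f A"
  using assms
proof (induction A rule: finite_induct)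
  interpret representation "Wt r" "KZ :: ('p padic ^ 2 ^ 2) set" by (rule representation_Wt)
  case empty
  show ?case by simp
next
  interpret representation "Wt r" "KZ :: ('p padic ^ 2 ^ 2) set" by (rule representation_Wt)
  case (insert a A)
  then have "f \<in> A \<rightarrow> carrier (Wt r)" "f a \<in> carrier (Wt r)" by simp_all
  then show ?case using insert by (simp add: finsum_insert)
qed

lemma finsum_ind_triv_apply:
  assumes "\<And>l. F l \<in> carrier (ind_triv :: ('p::prime_card mod_ring, _, _) rep)" "y \<in> GL2"
  shows "(\<Oplus>\<^bsub>ind_triv\<^esub>l\<in>I1. F l) y = (\<Sum>x\<in>UNIV. F (teich (x :: 'p mod_ring)) y)"
  using inducible.finsum_ind_apply[OF inducible_triv, of "I1 :: 'p padic_int set" F y] assms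
  by (simp add: ind_triv_def finsum_triv sum_I1)

lemma finsum_ind_Wt_apply:
  assumes "\<And>l. F l \<in> carrier (ind KZ (Wt r) :: ('p::prime_card mod_ring, _, _) rep)" "y \<in> GL2"
  shows "(\<Oplus>\<^bsub>ind KZ (Wt r)\<^esub>l\<in>I1. F l) y = (\<Sum>x\<in>UNIV. F (teich (x :: 'p mod_ring)) y)"
proof -
  have "homogeneous2 r (F l y)" for l
    using inducible.ind_carrierD(1)[OF inducible_Wt assms(1) assms(2)] by simp
  then show ?thesis
    using inducible.finsum_ind_apply[OF inducible_Wt, of "I1 :: 'p padic_int set" F r y] assms
    by (simp add: finsum_Wt sum_I1)
qed

lemma finsum_ind_triv_carrier:
  assumes "\<And>l. F l \<in> carrier (ind_triv :: ('p::prime_card mod_ring, _, _) rep)"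
  shows "(\<Oplus>\<^bsub>ind_triv\<^esub>l\<in>(I1 :: 'p padic_int set). F l) \<in> carrier ind_triv"
proof -
  interpret representation "ind_triv :: ('p mod_ring, _, _) rep" GL2 by (rule representation_ind_triv)
  show ?thesis using assms by (intro finsum_closed) simp
qed

lemma finsum_ind_Wt_carrier:
  assumes "\<And>l. F l \<in> carrier (ind KZ (Wt r) :: ('p::prime_card mod_ring, _, _) rep)"
  shows "(\<Oplus>\<^bsub>ind KZ (Wt r)\<^esub>l\<in>(I1 :: 'p padic_int set). F l) \<in> carrier (ind KZ (Wt r))"
proof -
  interpret representation "ind KZ (Wt r) :: ('p mod_ring, _, _) rep" GL2
    by (rule inducible.representation_ind[OF inducible_Wt])
  show ?thesis using assms by (intro finsum_closed) simp
qed

section \<open>The projections on functions, and fibrewise summation\<close>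

abbreviation (input) proj_const :: "('p::prime_card padic ^ 2 ^ 2 \<Rightarrow> 'p mod_ring) \<Rightarrow> 'p padic ^ 2 ^ 2 \<Rightarrow> 'p bipoly" where
  "proj_const \<equiv> fibrewise (\<lambda>h. const2 (line_total h))"

abbreviation (input) proj_interp :: "('p::prime_card padic ^ 2 ^ 2 \<Rightarrow> 'p mod_ring) \<Rightarrow> 'p padic ^ 2 ^ 2 \<Rightarrow> 'p bipoly" where
  "proj_interp \<equiv> fibrewise interpolate"

lemma proj_const_hom: "proj_const \<in> rep_hom GL2 ind_triv (ind KZ (Wt 0) :: ('p::prime_card mod_ring, _, _) rep)"
  by (rule fibrewise_rep_hom[OF total_hom inducible_Wt])

lemma proj_interp_hom: "proj_interp \<in> rep_hom GL2 ind_triv (ind KZ (Wt (CARD('p) - 1)) :: ('p::prime_card mod_ring, _, _) rep)"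
  by (rule fibrewise_rep_hom[OF interpolate_hom inducible_Wt])

text \<open>Summation over \<open>IZ \<setminus> KZ\<close>. It is idempotent because the projective line has
  \<open>p + 1 = 1\<close> points.\<close>

definition average :: "('p::prime_card padic ^ 2 ^ 2 \<Rightarrow> 'p mod_ring) \<Rightarrow> 'p padic ^ 2 ^ 2 \<Rightarrow> 'p mod_ring" where
  "average = compose (carrier ind_triv) (section_fun 0) proj_const"

lemma average_hom: "average \<in> rep_hom GL2 ind_triv (ind_triv :: ('p::prime_card mod_ring, _, _) rep)"
  unfolding average_def
  by (rule rep_hom_compose[OF proj_const_hom section_fun_rep_hom representation_ind_triv]) simp

lemma section_fun_apply: "F \<in> carrier (ind KZ (Wt r)) \<Longrightarrow> y \<in> GL2 \<Longrightarrow> section_fun r F y = eval2 (F y) 0 1"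
  by (simp add: section_fun_def)

lemma average_apply:
  assumes "f \<in> carrier (ind_triv :: ('p::prime_card mod_ring, _, _) rep)" "y \<in> GL2"
  shows "average f y = line_total (line_fun f y)"
  using assms rep_homD(1)[OF proj_const_hom assms(1)]
  by (simp add: average_def compose_def section_fun_apply fibrewise_apply)

lemma line_fun_average:
  assumes f: "f \<in> carrier (ind_triv :: ('p::prime_card mod_ring, _, _) rep)" and y: "y \<in> GL2"
  shows "line_fun (average f) y = punctured_const (line_total (line_fun f y))"
proof (rule line_funI)
  fix k :: "'p padic ^ 2 ^ 2" assume k: "k \<in> KZ"
  have "line_fun (average f) y (red k $ 2 $ 1) (red k $ 2 $ 2) = line_total (line_fun f (k ** y))"
    using line_fun_bottom[OF rep_homD(1)[OF average_hom f] y k] f y k by (simp add: average_apply KZ_sub_GL2)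
  also have "\<dots> = line_total (line_fun f y)"
    using f y k by (simp add: line_fun_left_mult total_act line_fun_line_rep)
  finally show "line_fun (average f) y (red k $ 2 $ 1) (red k $ 2 $ 2)
      = punctured_const (line_total (line_fun f y)) (red k $ 2 $ 1) (red k $ 2 $ 2)"
    using bottom_row_nonzero[OF k] by (auto simp: punctured_const_def)
qed (simp_all add: punctured_const_def)

lemma ind_triv_minus_apply:
  assumes f: "f \<in> carrier (ind_triv :: ('p::prime_card mod_ring, _, _) rep)" "f' \<in> carrier ind_triv" and y: "y \<in> GL2"
  shows "(f \<ominus>\<^bsub>ind_triv\<^esub> f') y = f y - f' y"
proof -
  interpret representation "ind_triv :: ('p mod_ring, _, _) rep" GL2 by (rule representation_ind_triv)
  have "f = (f \<ominus>\<^bsub>ind_triv\<^esub> f') \<oplus>\<^bsub>ind_triv\<^esub> f'" using f by (simp add: minus_eq a_assoc l_neg)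
  then have "f y = (f \<ominus>\<^bsub>ind_triv\<^esub> f') y + f' y" using y by (metis ind_triv_apply(2))
  then show ?thesis by simp
qed

text \<open>At y this is the sum of f over the p points of the fibre through y other than the point
  of y itself; it is the operator U = E - 1.\<close>

definition off_diag :: "('p::prime_card padic ^ 2 ^ 2 \<Rightarrow> 'p mod_ring) \<Rightarrow> 'p padic ^ 2 ^ 2 \<Rightarrow> 'p mod_ring" where
  "off_diag = (\<lambda>f\<in>carrier ind_triv. average f \<ominus>\<^bsub>ind_triv\<^esub> f)"

lemma off_diag_apply:
  assumes "f \<in> carrier (ind_triv :: ('p::prime_card mod_ring, _, _) rep)" "y \<in> GL2"
  shows "off_diag f y = line_total (line_fun f y) - f y"
  using assms rep_homD(1)[OF average_hom assms(1)]
  by (simp add: off_diag_def ind_triv_minus_apply average_apply)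

lemma off_diag_hom: "off_diag \<in> rep_hom GL2 ind_triv (ind_triv :: ('p::prime_card mod_ring, _, _) rep)"
proof -
  interpret representation "ind_triv :: ('p mod_ring, _, _) rep" GL2 by (rule representation_ind_triv)
  have cl: "average f \<ominus>\<^bsub>ind_triv\<^esub> f \<in> carrier ind_triv"
    if "f \<in> carrier ind_triv" for f :: "'p padic ^ 2 ^ 2 \<Rightarrow> 'p mod_ring"
    using that rep_homD(1)[OF average_hom that] by simp
  have av: "average f \<in> carrier ind_triv"
    if "f \<in> carrier ind_triv" for f :: "'p padic ^ 2 ^ 2 \<Rightarrow> 'p mod_ring"
    using that rep_homD(1)[OF average_hom that] by simp
  show ?thesis
    unfolding off_diag_def
  proof (rule rep_hom_restrictI[OF representation_ind_triv cl])
    fix f :: "'p padic ^ 2 ^ 2 \<Rightarrow> 'p mod_ring" assume f: "f \<in> carrier ind_triv"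
    show "average (c \<odot>\<^bsub>ind_triv\<^esub> f) \<ominus>\<^bsub>ind_triv\<^esub> (c \<odot>\<^bsub>ind_triv\<^esub> f) = c \<odot>\<^bsub>ind_triv\<^esub> (average f \<ominus>\<^bsub>ind_triv\<^esub> f)" for c
      unfolding rep_homD(3)[OF average_hom f]
      by (rule ind_triv_eqI) (use f av in \<open>simp_all add: ind_triv_apply ind_triv_minus_apply right_diff_distrib\<close>)
    show "average (act ind_triv g f) \<ominus>\<^bsub>ind_triv\<^esub> (act ind_triv g f) = act ind_triv g (average f \<ominus>\<^bsub>ind_triv\<^esub> f)"
      if g: "g \<in> GL2" for g
      unfolding rep_homD(4)[OF average_hom g f]
      by (rule ind_triv_eqI) (use f av g in \<open>simp_all add: ind_triv_apply ind_triv_minus_apply\<close>)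
    fix f' :: "'p padic ^ 2 ^ 2 \<Rightarrow> 'p mod_ring" assume f': "f' \<in> carrier ind_triv"
    show "average (f \<oplus>\<^bsub>ind_triv\<^esub> f') \<ominus>\<^bsub>ind_triv\<^esub> (f \<oplus>\<^bsub>ind_triv\<^esub> f')
        = (average f \<ominus>\<^bsub>ind_triv\<^esub> f) \<oplus>\<^bsub>ind_triv\<^esub> (average f' \<ominus>\<^bsub>ind_triv\<^esub> f')"
      unfolding rep_homD(2)[OF average_hom f f']
      by (rule ind_triv_eqI) (use f f' av in \<open>simp_all add: ind_triv_apply ind_triv_minus_apply\<close>)
  qed
qed

section \<open>Left translation by \<open>beta\<close>\<close>

lemma beta_GL2 [simp]: "beta \<in> (GL2 :: ('p::prime_card padic ^ 2 ^ 2) set)"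
  by (simp add: GL2_iff det_2 beta_def)

lemma beta_beta: "beta ** beta = (mat p_adic :: 'p::prime_card padic ^ 2 ^ 2)"
  by (rule mat2_eqI) (simp_all add: matrix_mult_nth_2 beta_def)

lemma mat_p_adic: "mat p_adic \<in> (IZ :: ('p::prime_card padic ^ 2 ^ 2) set)" "mat p_adic \<in> (GL2 :: ('p padic ^ 2 ^ 2) set)"
  using p_scalar_KZ(3)[of 1] by (simp_all add: mat_GL2)

lemma beta_normalizes:
  assumes "i \<in> (IZ :: ('p::prime_card padic ^ 2 ^ 2) set)"
  shows "\<exists>i'\<in>IZ. beta ** i = i' ** beta"
proof -
  obtain n k where i: "i = p_scalar n ** embed_mat k" and k: "det (residue_mat k) \<noteq> 0" "residue (k $ 2 $ 1) = 0"
    using assms by (auto simp: IZ_eq)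
  obtain m where m: "k $ 2 $ 1 = pint * m" using k(2) by (auto simp: residue_eq_0_iff elim: dvdE)
  \<comment> \<open>Conjugation by \<open>beta\<close> swaps the diagonal entries and sends the
    off-diagonal pair b, p m to m, p b.\<close>
  define k' where "k' = mat2 (k $ 2 $ 2) m (pint * k $ 1 $ 2) (k $ 1 $ 1)"
  have "det (residue_mat k') \<noteq> 0" "residue (k' $ 2 $ 1) = 0"
    using k by (simp_all add: k'_def det_2 residue_mult)
  then have "p_scalar n ** embed_mat k' \<in> IZ" by (auto simp: IZ_eq)
  moreover have "beta ** i = (p_scalar n ** embed_mat k') ** beta"
    unfolding i by (rule mat2_eqI) (simp_all add: matrix_mult_nth_2 beta_def k'_def m p_adic_def)
  ultimately show ?thesis by blast
qed

text \<open>\<open>beta\<close> normalises \<open>IZ\<close> and its square, the scalar p, lies in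
  \<open>IZ\<close>. Conjugating by \<open>beta\<close> therefore exchanges the two
  products.\<close>

lemma beta_IZ_iff:
  assumes y: "y \<in> (GL2 :: ('p::prime_card padic ^ 2 ^ 2) set)"
  shows "beta ** y \<in> IZ \<longleftrightarrow> y ** beta \<in> IZ"
proof
  assume "y ** beta \<in> IZ"
  then obtain i where i: "i \<in> IZ" "beta ** (y ** beta) = i ** beta" using beta_normalizes by blast
  then have "((beta ** y) ** beta) ** matrix_inv beta = (i ** beta) ** matrix_inv beta"
    by (simp only: matrix_mul_assoc)
  then have "beta ** y = i" by simp
  then show "beta ** y \<in> IZ" using i by simp
next
  assume "beta ** y \<in> IZ"
  then obtain i where i: "i \<in> IZ" "beta ** (beta ** y) = i ** beta" using beta_normalizes by blast
  have "mat p_adic ** (y ** beta) = (beta ** (beta ** y)) ** beta"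
    unfolding beta_beta[symmetric] by (simp only: matrix_mul_assoc)
  also have "\<dots> = i ** mat p_adic" unfolding i(2) beta_beta[symmetric] by (simp only: matrix_mul_assoc)
  also have "\<dots> = mat p_adic ** i" by (simp only: mat_mult_commute)
  finally have "matrix_inv (mat p_adic) ** (mat p_adic ** (y ** beta)) = matrix_inv (mat p_adic) ** (mat p_adic ** i)"
    by (rule arg_cong)
  then have "y ** beta = i" by (simp only: matrix_inv_cancel[OF mat_p_adic(2)])
  then show "y ** beta \<in> IZ" using i by simp
qed

definition flip :: "('p::prime_card padic ^ 2 ^ 2 \<Rightarrow> 'p mod_ring) \<Rightarrow> 'p padic ^ 2 ^ 2 \<Rightarrow> 'p mod_ring" where
  "flip = (\<lambda>f\<in>carrier ind_triv. \<lambda>y\<in>GL2. f (beta ** y))"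

lemma flip_apply: "f \<in> carrier ind_triv \<Longrightarrow> y \<in> GL2 \<Longrightarrow> flip f y = f (beta ** y)"
  by (simp add: flip_def)

text \<open>Left translation commutes with the action by right translation; since
  \<open>beta\<close> normalises \<open>IZ\<close>, it also preserves left invariance and the
  finiteness of the support.\<close>

lemma flip_hom: "flip \<in> rep_hom GL2 ind_triv (ind_triv :: ('p::prime_card mod_ring, _, _) rep)"
  unfolding flip_def
proof (rule rep_hom_restrictI[OF representation_ind_triv])
  show "(\<lambda>y\<in>GL2. f (beta ** y)) \<in> carrier ind_triv" if f: "f \<in> carrier ind_triv"
    for f :: "'p padic ^ 2 ^ 2 \<Rightarrow> 'p mod_ring"
  proof (rule ind_triv_carrierI)
    fix i y :: "'p padic ^ 2 ^ 2" assume "i \<in> IZ" and y: "y \<in> GL2"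
    then obtain i' where i': "i' \<in> IZ" "beta ** i = i' ** beta" using beta_normalizes by blast
    have "f (beta ** (i ** y)) = f (i' ** (beta ** y))" by (simp only: matrix_mul_assoc i')
    then show "f (beta ** (i ** y)) = f (beta ** y)" using ind_triv_carrierD(1)[OF f i'(1)] y by simp
  next
    obtain F where F: "F \<subseteq> GL2" "finite F" "\<And>x. x \<in> GL2 \<Longrightarrow> f x \<noteq> 0 \<Longrightarrow> \<exists>h\<in>IZ. \<exists>y\<in>F. x = h ** y"
      using ind_triv_carrierD(2)[OF f] unfolding finite_mod_def by blast
    have "\<exists>h\<in>IZ. \<exists>w\<in>(\<lambda>w. beta ** w) ` F. y = h ** w" if y: "y \<in> GL2" "f (beta ** y) \<noteq> 0" for y
    proof -
      obtain h w where hw: "h \<in> IZ" "w \<in> F" "beta ** y = h ** w" using F(3)[of "beta ** y"] y by auto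
      obtain h' where h': "h' \<in> IZ" "beta ** h = h' ** beta" using hw beta_normalizes by blast
      have "mat p_adic ** y = h' ** (beta ** w)"
        unfolding beta_beta[symmetric] by (metis h'(2) hw(3) matrix_mul_assoc)
      then have "matrix_inv (mat p_adic) ** (mat p_adic ** y) = (matrix_inv (mat p_adic) ** h') ** (beta ** w)"
        by (simp only: matrix_mul_assoc)
      then have "y = (matrix_inv (mat p_adic) ** h') ** (beta ** w)"
        by (simp only: matrix_inv_cancel[OF mat_p_adic(2)])
      then show ?thesis using h' hw IZ_inv[OF mat_p_adic(1)] by blast
    qed
    moreover have "(\<lambda>w. beta ** w) ` F \<subseteq> GL2" using F(1) by (auto intro!: GL2_mult)
    ultimately show "finite_mod IZ (\<lambda>y. f (beta ** y) \<noteq> 0)"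
      unfolding finite_mod_def using F(2) by blast
  qed
qed (auto simp: ind_simps ind_triv_def matrix_mul_assoc)

lemma flip_flip:
  assumes f: "f \<in> carrier (ind_triv :: ('p::prime_card mod_ring, _, _) rep)"
  shows "flip (flip f) = f"
proof (rule ind_triv_eqI)
  have c: "flip f \<in> carrier ind_triv" using rep_homD(1)[OF flip_hom f] .
  then show "flip (flip f) \<in> carrier ind_triv" by (rule rep_homD(1)[OF flip_hom])
  fix y :: "'p padic ^ 2 ^ 2" assume y: "y \<in> GL2"
  have "flip (flip f) y = f (mat p_adic ** y)"
    using f c y by (simp add: flip_apply matrix_mul_assoc beta_beta)
  then show "flip (flip f) y = f y" using ind_triv_carrierD(1)[OF f mat_p_adic(1) y] by simp
qed (rule f)

text \<open>By \<open>beta_IZ_iff\<close> the factor \<open>beta\<close> moves from the left of y g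
  to its right, so left translation of functions becomes right multiplication of the label
  g.\<close>

lemma flip_ind_elem:
  assumes g: "g \<in> GL2"
  shows "flip (ind_elem_IZ g) = ind_elem_IZ (g ** beta :: 'p::prime_card padic ^ 2 ^ 2)"
proof (rule ind_triv_eqI)
  show "flip (ind_elem_IZ g) \<in> carrier (ind_triv :: ('p mod_ring, _, _) rep)"
    using g by (intro rep_homD(1)[OF flip_hom]) simp
  fix y :: "'p padic ^ 2 ^ 2" assume y: "y \<in> GL2"
  show "flip (ind_elem_IZ g) y = ind_elem_IZ (g ** beta) y"
    using g y beta_IZ_iff[of "y ** g"] by (simp add: flip_apply ind_elem_IZ_apply matrix_mul_assoc)
qed (use g in simp)

lemma T_1_0_eq: "T_1_0 = (flip :: _ \<Rightarrow> 'p::prime_card padic ^ 2 ^ 2 \<Rightarrow> 'p mod_ring)"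
  unfolding T_1_0_def
proof (rule the_equality)
  show *: "flip \<in> rep_hom GL2 ind_triv (ind_triv :: ('p mod_ring, _, _) rep) \<and>
    flip (ind_elem_IZ (mat 1)) = (ind_elem_IZ beta :: 'p padic ^ 2 ^ 2 \<Rightarrow> 'p mod_ring)"
    using flip_hom flip_ind_elem[of "mat 1"] by simp
qed (metis flip_hom flip_ind_elem GL2_1 matrix_mul_lid ind_triv_hom_eqI representation_ind_triv)

text \<open>As l runs through the Teichmueller representatives, these matrices represent the p
  cosets in KZ / IZ other than that of the identity.\<close>

abbreviation (input) weyl_mat :: "'p::prime_card padic_int \<Rightarrow> 'p padic ^ 2 ^ 2" where
  "weyl_mat l \<equiv> mat2 (of_padic_int l) 1 1 0"

lemma weyl_mat_KZ: "weyl_mat l \<in> KZ" "red (weyl_mat l) = mat2 (residue l) 1 1 0"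
proof -
  have "weyl_mat l = embed_mat (mat2 l 1 1 0)" by (rule mat2_eqI) simp_all
  moreover have "residue_mat (mat2 l 1 1 0) = mat2 (residue l) 1 1 0" by (rule mat2_eqI) simp_all
  ultimately show "weyl_mat l \<in> KZ" "red (weyl_mat l) = mat2 (residue l) 1 1 0"
    using embed_mat_KZ[of "mat2 l 1 1 0"] by (simp_all add: det_2)
qed

lemma total_point_fun [simp]: "line_total point_fun = (1 :: 'p::prime_card mod_ring)"
  by (simp add: line_total_def point_fun_def)

text \<open>For y in \<open>KZ\<close> with reduced bottom row (c, d), the product of y with the
  matrix for x lies in \<open>IZ\<close> iff c x + d = 0. This has one solution if c is nonzero and
  none if c = 0, since then d is nonzero; the count agrees with 1 - [c = 0].\<close>

lemma off_diag_ind_elem: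
  "off_diag (ind_elem_IZ (mat 1)) = (\<Oplus>\<^bsub>ind_triv\<^esub>l\<in>(I1 :: 'p::prime_card padic_int set). ind_elem_IZ (weyl_mat l))"
proof (rule ind_triv_eqI)
  have w: "weyl_mat l \<in> GL2" for l :: "'p padic_int" by (rule KZ_sub_GL2[OF weyl_mat_KZ(1)])
  show "off_diag (ind_elem_IZ (mat 1)) \<in> carrier (ind_triv :: ('p mod_ring, _, _) rep)"
    by (intro rep_homD(1)[OF off_diag_hom]) simp
  show "(\<Oplus>\<^bsub>ind_triv\<^esub>l\<in>(I1 :: 'p padic_int set). ind_elem_IZ (weyl_mat l)) \<in> carrier ind_triv"
    by (rule finsum_ind_triv_carrier) (simp add: w)
  fix y :: "'p padic ^ 2 ^ 2" assume y: "y \<in> GL2"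
  have sum: "(\<Oplus>\<^bsub>ind_triv\<^esub>l\<in>(I1 :: 'p padic_int set). ind_elem_IZ (weyl_mat l)) y
      = (\<Sum>x\<in>UNIV. if y ** weyl_mat (teich (x :: 'p mod_ring)) \<in> IZ then 1 else 0)"
    using y w by (subst finsum_ind_triv_apply) (simp_all add: ind_elem_IZ_apply)
  show "off_diag (ind_elem_IZ (mat 1)) y = (\<Oplus>\<^bsub>ind_triv\<^esub>l\<in>(I1 :: 'p padic_int set). ind_elem_IZ (weyl_mat l)) y"
  proof (cases "y \<in> KZ")
    case True
    let ?c = "red y $ 2 $ 1" and ?d = "red y $ 2 $ 2"
    have "off_diag (ind_elem_IZ (mat 1)) y = 1 - (if ?c = 0 then 1 else 0 :: 'p mod_ring)"
      using y True by (simp add: off_diag_apply line_fun_ind_elem total_act ind_elem_IZ_apply IZ_iff)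
    also have "\<dots> = (\<Sum>x\<in>UNIV. if ?c * x + ?d = 0 then 1 else 0)"
    proof (cases "?c = 0")
      case True
      then show ?thesis using bottom_row_nonzero[OF \<open>y \<in> KZ\<close>] by simp
    next
      case False
      then have "?c * x + ?d = ?c * (x - - ?d / ?c)" for x by (simp add: distrib_left)
      then have "?c * x + ?d = 0 \<longleftrightarrow> x = - ?d / ?c" for x
        using False by (simp only: mult_eq_0_iff right_minus_eq) blast
      then show ?thesis using False by simp
    qed
    also have "\<dots> = (\<Sum>x\<in>UNIV. if y ** weyl_mat (teich (x :: 'p mod_ring)) \<in> IZ then 1 else 0)"
      using True by (simp add: IZ_iff weyl_mat_KZ matrix_mult_nth_2)
    finally show ?thesis unfolding sum .
  next
    case False
    have "y ** weyl_mat l \<notin> KZ" for l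
    proof
      assume "y ** weyl_mat l \<in> KZ"
      from KZ_mult_closed[OF this KZ_inv[OF weyl_mat_KZ(1)[of l]]] show False
        using False w by simp
    qed
    then have "y ** weyl_mat l \<notin> IZ" for l using IZ_KZ by blast
    moreover have "y \<notin> IZ" using False IZ_KZ by blast
    ultimately show ?thesis unfolding sum using y False
      by (simp add: off_diag_apply line_fun_ind_elem ind_elem_IZ_apply) (simp add: line_total_def)
  qed
qed

text \<open>On the generator, \<open>flip\<close> has the effect of acting by \<open>beta\<close>,
  so equivariance of \<open>off_diag\<close> pulls \<open>beta\<close> out in front;
  \<open>beta\<close> times \<open>weyl_mat l\<close> is the matrix in the definition of
  \<open>T_1_2\<close>.\<close>

lemma T_1_2_eq: "T_1_2 = (compose (carrier ind_triv) off_diag flip :: _ \<Rightarrow> 'p::prime_card padic ^ 2 ^ 2 \<Rightarrow> 'p mod_ring)"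
proof -
  let ?S = "compose (carrier ind_triv) off_diag flip :: _ \<Rightarrow> 'p padic ^ 2 ^ 2 \<Rightarrow> 'p mod_ring"
  let ?v = "\<Oplus>\<^bsub>ind_triv\<^esub>l\<in>(I1 :: 'p padic_int set). ind_elem_IZ (mat2 1 0 (p_adic * of_padic_int l) p_adic)"
  have hom: "?S \<in> rep_hom GL2 ind_triv ind_triv"
    by (rule rep_hom_compose[OF flip_hom off_diag_hom representation_ind_triv])
  have w: "weyl_mat l \<in> GL2" for l :: "'p padic_int" by (rule KZ_sub_GL2[OF weyl_mat_KZ(1)])
  have e: "beta ** weyl_mat l = mat2 1 0 (p_adic * of_padic_int l) p_adic" for l :: "'p padic_int"
    by (rule mat2_eqI) (simp_all add: matrix_mult_nth_2 beta_def)
  have g: "mat2 1 0 (p_adic * of_padic_int l) p_adic \<in> GL2" for l :: "'p padic_int"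
    using GL2_mult[OF beta_GL2 w] unfolding e .
  have "?S (ind_elem_IZ (mat 1)) = off_diag (act ind_triv beta (ind_elem_IZ (mat 1)))"
    by (simp add: compose_def flip_ind_elem act_ind_elem_IZ)
  also have "\<dots> = act ind_triv beta (off_diag (ind_elem_IZ (mat 1)))"
    by (rule rep_homD(4)[OF off_diag_hom]) simp_all
  also have "\<dots> = ?v"
  proof (rule ind_triv_eqI)
    interpret representation "ind_triv :: ('p mod_ring, _, _) rep" GL2 by (rule representation_ind_triv)
    show "act ind_triv beta (off_diag (ind_elem_IZ (mat 1))) \<in> carrier (ind_triv :: ('p mod_ring, _, _) rep)"
      by (intro act_closed rep_homD(1)[OF off_diag_hom]) simp_all
    show "?v \<in> carrier ind_triv" by (rule finsum_ind_triv_carrier) (simp add: g)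
    fix y :: "'p padic ^ 2 ^ 2" assume y: "y \<in> GL2"
    have yb: "y ** beta \<in> GL2" using y by simp
    show "act ind_triv beta (off_diag (ind_elem_IZ (mat 1))) y = ?v y"
      unfolding off_diag_ind_elem ind_triv_apply(4)[OF y]
      using y yb w g
      by (simp add: finsum_ind_triv_apply ind_elem_IZ_apply e[symmetric] matrix_mul_assoc)
  qed
  finally have v: "?S (ind_elem_IZ (mat 1)) = ?v" .
  show ?thesis
    unfolding T_1_2_def
  proof (rule the_equality)
    show "?S \<in> rep_hom GL2 ind_triv ind_triv \<and> ?S (ind_elem_IZ (mat 1)) = ?v" using hom v by (rule conjI)
    fix S assume S: "S \<in> rep_hom GL2 ind_triv ind_triv \<and> S (ind_elem_IZ (mat 1)) = ?v"
    show "S = ?S"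
      by (rule ind_triv_hom_eqI[OF conjunct1[OF S] hom representation_ind_triv]) (simp only: conjunct2[OF S] v)
  qed
qed

text \<open>In this order \<open>flip\<close> multiplies each label \<open>weyl_mat l\<close> by
  \<open>beta\<close> on the right, which gives the upper triangular matrices of the definition. The
  value on the generator is kept because both projections are applied to it later.\<close>

lemma T_m1_0_eq_and_value:
  "T_m1_0 = (compose (carrier ind_triv) flip off_diag :: _ \<Rightarrow> 'p::prime_card padic ^ 2 ^ 2 \<Rightarrow> 'p mod_ring) \<and>
   T_m1_0 (ind_elem_IZ (mat 1)) = (\<Oplus>\<^bsub>ind_triv\<^esub>l\<in>(I1 :: 'p padic_int set). ind_elem_IZ (mat2 p_adic (of_padic_int l) 0 1))"
proof -
  let ?S = "compose (carrier ind_triv) flip off_diag :: _ \<Rightarrow> 'p padic ^ 2 ^ 2 \<Rightarrow> 'p mod_ring"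
  let ?v = "\<Oplus>\<^bsub>ind_triv\<^esub>l\<in>(I1 :: 'p padic_int set). ind_elem_IZ (mat2 p_adic (of_padic_int l) 0 1)"
  have hom: "?S \<in> rep_hom GL2 ind_triv ind_triv"
    by (rule rep_hom_compose[OF off_diag_hom flip_hom representation_ind_triv])
  have w: "weyl_mat l \<in> GL2" for l :: "'p padic_int" by (rule KZ_sub_GL2[OF weyl_mat_KZ(1)])
  have e: "weyl_mat l ** beta = mat2 p_adic (of_padic_int l) 0 1" for l :: "'p padic_int"
    by (rule mat2_eqI) (simp_all add: matrix_mult_nth_2 beta_def)
  have "?S (ind_elem_IZ (mat 1)) = flip (\<Oplus>\<^bsub>ind_triv\<^esub>l\<in>(I1 :: 'p padic_int set). ind_elem_IZ (weyl_mat l))"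
    by (simp add: compose_def off_diag_ind_elem)
  also have "\<dots> = (\<Oplus>\<^bsub>ind_triv\<^esub>l\<in>(I1 :: 'p padic_int set). flip (ind_elem_IZ (weyl_mat l)))"
    by (rule rep_hom_finsum[OF flip_hom representation_ind_triv representation_ind_triv]) (simp_all add: w)
  also have "\<dots> = ?v" by (simp add: flip_ind_elem w e)
  finally have v: "?S (ind_elem_IZ (mat 1)) = ?v" .
  have "T_m1_0 = ?S"
    unfolding T_m1_0_def
  proof (rule the_equality)
    show "?S \<in> rep_hom GL2 ind_triv ind_triv \<and> ?S (ind_elem_IZ (mat 1)) = ?v" using hom v by (rule conjI)
    fix S assume S: "S \<in> rep_hom GL2 ind_triv ind_triv \<and> S (ind_elem_IZ (mat 1)) = ?v"
    show "S = ?S"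
      by (rule ind_triv_hom_eqI[OF conjunct1[OF S] hom representation_ind_triv]) (simp only: conjunct2[OF S] v)
  qed
  then show ?thesis using v by simp
qed

lemmas T_m1_0_eq = conjunct1[OF T_m1_0_eq_and_value]
lemmas T_m1_0_ind_elem = conjunct2[OF T_m1_0_eq_and_value]

section \<open>The Hecke operators on the weights \<open>0\<close> and \<open>p - 1\<close>\<close>

abbreviation (input) hecke_mat :: "'p::prime_card padic_int \<Rightarrow> 'p padic ^ 2 ^ 2" where
  "hecke_mat l \<equiv> mat2 p_adic (of_padic_int l) 0 1"

text \<open>The right-hand side of the formula for \<open>T\<close> after setting p = 0 in the
  coefficients: the second argument of P becomes a multiple of X alone, and the term at
  \<open>alpha\<close> becomes P(0, Y).\<close>

definition hecke_rhs :: "nat \<Rightarrow> 'p::prime_card bipoly \<Rightarrow> 'p padic ^ 2 ^ 2 \<Rightarrow> 'p bipoly" where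
  "hecke_rhs r P = (\<Oplus>\<^bsub>ind KZ (Wt r)\<^esub>l\<in>I1. ind_elem KZ (Wt r) (hecke_mat l)
        (subst2 P pX (const2 (- residue l) * pX))) \<oplus>\<^bsub>ind KZ (Wt r)\<^esub> ind_elem KZ (Wt r) alpha (subst2 P 0 pY)"

lemma const2_power: "const2 a ^ n = const2 (a ^ n)"
  by (induction n) simp_all

lemma of_nat_card_bipoly [simp]: "(of_nat CARD('p) :: 'p::prime_card bipoly) = 0"
  by (simp add: of_nat_poly)

lemma hecke_mat_GL2 [simp]: "hecke_mat l \<in> (GL2 :: ('p::prime_card padic ^ 2 ^ 2) set)"
  and alpha_GL2 [simp]: "alpha \<in> (GL2 :: ('p::prime_card padic ^ 2 ^ 2) set)"
  by (simp_all add: GL2_iff det_2 alpha_def)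

text \<open>Resolves the definite description: uniqueness follows from generation by [id, P], so any
  equivariant map with the prescribed values is \<open>T\<close>.\<close>

lemma Hecke_T_eqI:
  assumes S: "S \<in> rep_hom GL2 (ind KZ (Wt r)) (ind KZ (Wt r) :: ('p::prime_card mod_ring, _, _) rep)"
    and val: "\<And>P. homogeneous2 r P \<Longrightarrow> S (ind_elem KZ (Wt r) (mat 1) P) = hecke_rhs r P"
  shows "Hecke_T r = S"
  unfolding Hecke_T_def
proof (rule the_equality)
  have r: "(\<Oplus>\<^bsub>ind KZ (Wt r)\<^esub>l\<in>I1. ind_elem KZ (Wt r) (mat2 p_adic (of_padic_int l) 0 1)
             (subst2 P pX (- const2 (residue l) * pX + of_nat CARD('p) * pY)))
        \<oplus>\<^bsub>ind KZ (Wt r)\<^esub> ind_elem KZ (Wt r) alpha (subst2 P (of_nat CARD('p) * pX) pY) = hecke_rhs r P"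
    for P :: "'p bipoly" unfolding hecke_rhs_def by simp
  show "S \<in> rep_hom GL2 (ind KZ (Wt r)) (ind KZ (Wt r)) \<and>
     (\<forall>P\<in>carrier (Wt r). S (ind_elem KZ (Wt r) (mat 1) P) =
        (\<Oplus>\<^bsub>ind KZ (Wt r)\<^esub>l\<in>I1. ind_elem KZ (Wt r) (mat2 p_adic (of_padic_int l) 0 1)
             (subst2 P pX (- const2 (residue l) * pX + of_nat CARD('p) * pY)))
        \<oplus>\<^bsub>ind KZ (Wt r)\<^esub> ind_elem KZ (Wt r) alpha (subst2 P (of_nat CARD('p) * pX) pY))"
    unfolding r using S val by simp
  fix S' :: "('p padic ^ 2 ^ 2 \<Rightarrow> 'p bipoly) \<Rightarrow> 'p padic ^ 2 ^ 2 \<Rightarrow> 'p bipoly"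
  assume "S' \<in> rep_hom GL2 (ind KZ (Wt r)) (ind KZ (Wt r)) \<and>
     (\<forall>P\<in>carrier (Wt r). S' (ind_elem KZ (Wt r) (mat 1) P) =
        (\<Oplus>\<^bsub>ind KZ (Wt r)\<^esub>l\<in>I1. ind_elem KZ (Wt r) (mat2 p_adic (of_padic_int l) 0 1)
             (subst2 P pX (- const2 (residue l) * pX + of_nat CARD('p) * pY)))
        \<oplus>\<^bsub>ind KZ (Wt r)\<^esub> ind_elem KZ (Wt r) alpha (subst2 P (of_nat CARD('p) * pX) pY))"
  then have S': "S' \<in> rep_hom GL2 (ind KZ (Wt r)) (ind KZ (Wt r))"
    "\<And>P. homogeneous2 r P \<Longrightarrow> S' (ind_elem KZ (Wt r) (mat 1) P) = hecke_rhs r P"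
    unfolding r by simp_all
  show "S' = S"
    by (rule inducible.ind_hom_eqI[OF inducible_Wt S'(1) S inducible.representation_ind[OF inducible_Wt]])
      (simp add: S'(2) val)
qed

lemma ind_elem_Wt_carrier: "g \<in> GL2 \<Longrightarrow> homogeneous2 r v \<Longrightarrow>
    ind_elem KZ (Wt r) g v \<in> carrier (ind KZ (Wt r) :: ('p::prime_card mod_ring, _, _) rep)"
  using inducible.ind_elem_carrier[OF inducible_Wt] by simp

lemma ind_elem_Wt_apply: "x \<in> GL2 \<Longrightarrow> g \<in> GL2 \<Longrightarrow>
    ind_elem KZ (Wt r) g v x = (if x ** g \<in> KZ then mat_act (red (x ** g :: 'p::prime_card padic ^ 2 ^ 2)) v else 0)"
  by (simp add: inducible.ind_elem_apply[OF inducible_Wt])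

lemma ind_Wt_eqI:
  assumes "f \<in> carrier (ind KZ (Wt r) :: ('p::prime_card mod_ring, _, _) rep)" "f' \<in> carrier (ind KZ (Wt r))"
    "\<And>x. x \<in> GL2 \<Longrightarrow> f x = f' x"
  shows "f = f'"
  using assms by (rule inducible.ind_eqI[OF inducible_Wt])

lemma homogeneous2_hecke:
  assumes "homogeneous2 r P"
  shows "homogeneous2 r (subst2 P pX (const2 c * pX))" "homogeneous2 r (subst2 P 0 pY)"
  using assms by (auto intro!: homogeneous2_subst2 homogeneous2_const2_mult)

lemma hecke_rhs_carrier:
  assumes P: "homogeneous2 r (P :: 'p::prime_card bipoly)"
  shows "hecke_rhs r P \<in> carrier (ind KZ (Wt r))"
proof -
  interpret representation "ind KZ (Wt r) :: ('p mod_ring, _, _) rep" GL2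
    by (rule inducible.representation_ind[OF inducible_Wt])
  show ?thesis unfolding hecke_rhs_def
    by (intro a_closed finsum_ind_Wt_carrier ind_elem_Wt_carrier homogeneous2_hecke P) simp_all
qed

lemma hecke_rhs_apply:
  assumes P: "homogeneous2 r (P :: 'p::prime_card bipoly)" and y: "y \<in> GL2"
  shows "hecke_rhs r P y = (\<Sum>x\<in>UNIV. ind_elem KZ (Wt r) (hecke_mat (teich x)) (subst2 P pX (const2 (- x) * pX)) y)
      + ind_elem KZ (Wt r) alpha (subst2 P 0 pY) y"
proof -
  have c: "ind_elem KZ (Wt r) (hecke_mat l) (subst2 P pX (const2 (- residue l) * pX)) \<in> carrier (ind KZ (Wt r))"
    for l :: "'p padic_int" by (intro ind_elem_Wt_carrier homogeneous2_hecke P) simp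
  show ?thesis unfolding hecke_rhs_def ind_apply(2)[OF y] finsum_ind_Wt_apply[OF c y] residue_teich
    by (rule Wt_simps(3))
qed

lemma ind_elem_Wt_linear:
  assumes "x \<in> GL2" "g \<in> (GL2 :: ('p::prime_card padic ^ 2 ^ 2) set)"
  shows "ind_elem KZ (Wt r) g (v + w) x = ind_elem KZ (Wt r) g v x + ind_elem KZ (Wt r) g w x"
    "ind_elem KZ (Wt r) g (const2 c * v) x = const2 c * ind_elem KZ (Wt r) g v x"
  using assms by (simp_all add: ind_elem_Wt_apply mat_act_simps)

lemma hecke_rhs_add:
  assumes P: "homogeneous2 r (P :: 'p::prime_card bipoly)" "homogeneous2 r Q"
  shows "hecke_rhs r (P + Q) = hecke_rhs r P \<oplus>\<^bsub>ind KZ (Wt r)\<^esub> hecke_rhs r Q"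
proof (rule ind_Wt_eqI)
  interpret representation "ind KZ (Wt r) :: ('p mod_ring, _, _) rep" GL2
    by (rule inducible.representation_ind[OF inducible_Wt])
  show "hecke_rhs r P \<oplus>\<^bsub>ind KZ (Wt r)\<^esub> hecke_rhs r Q \<in> carrier (ind KZ (Wt r))"
    using P by (intro a_closed hecke_rhs_carrier)
  show "hecke_rhs r (P + Q) \<in> carrier (ind KZ (Wt r))"
    using P by (intro hecke_rhs_carrier homogeneous2_add)
  fix y :: "'p padic ^ 2 ^ 2" assume y: "y \<in> GL2"
  show "hecke_rhs r (P + Q) y = (hecke_rhs r P \<oplus>\<^bsub>ind KZ (Wt r)\<^esub> hecke_rhs r Q) y"
    using P y by (simp add: hecke_rhs_apply homogeneous2_add ind_apply ind_elem_Wt_linear sum.distrib)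
qed

lemma hecke_rhs_smult:
  assumes P: "homogeneous2 r (P :: 'p::prime_card bipoly)"
  shows "hecke_rhs r (const2 c * P) = c \<odot>\<^bsub>ind KZ (Wt r)\<^esub> hecke_rhs r P"
proof (rule ind_Wt_eqI)
  interpret representation "ind KZ (Wt r) :: ('p mod_ring, _, _) rep" GL2
    by (rule inducible.representation_ind[OF inducible_Wt])
  show "c \<odot>\<^bsub>ind KZ (Wt r)\<^esub> hecke_rhs r P \<in> carrier (ind KZ (Wt r))"
    using P by (intro smult_closed hecke_rhs_carrier)
  show "hecke_rhs r (const2 c * P) \<in> carrier (ind KZ (Wt r))"
    using P by (intro hecke_rhs_carrier homogeneous2_const2_mult)
  fix y :: "'p padic ^ 2 ^ 2" assume y: "y \<in> GL2"
  show "hecke_rhs r (const2 c * P) y = (c \<odot>\<^bsub>ind KZ (Wt r)\<^esub> hecke_rhs r P) y"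
    using P y by (simp add: hecke_rhs_apply homogeneous2_const2_mult ind_apply ind_elem_Wt_linear
        sum_distrib_left distrib_left)
qed

lemma ind_elem_Wt_smult:
  assumes "g \<in> (GL2 :: ('p::prime_card padic ^ 2 ^ 2) set)" "homogeneous2 r v"
  shows "ind_elem KZ (Wt r) g (const2 c * v) = c \<odot>\<^bsub>ind KZ (Wt r)\<^esub> ind_elem KZ (Wt r) g v"
  using inducible.ind_elem_smult[OF inducible_Wt, of g v r c] assms by simp

lemma ind_elem_Wt_act:
  assumes "g \<in> GL2" "g' \<in> (GL2 :: ('p::prime_card padic ^ 2 ^ 2) set)" "homogeneous2 r v"
  shows "act (ind KZ (Wt r)) g' (ind_elem KZ (Wt r) g v) = ind_elem KZ (Wt r) (g' ** g) v"
  using inducible.act_ind_elem[OF inducible_Wt] assms by simp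

lemma ind_elem_Wt_mult:
  assumes "g \<in> GL2" "k \<in> (KZ :: ('p::prime_card padic ^ 2 ^ 2) set)" "homogeneous2 r v"
  shows "ind_elem KZ (Wt r) (g ** k) v = ind_elem KZ (Wt r) g (mat_act (red k) v)"
  using inducible.ind_elem_mult[OF inducible_Wt] assms by simp

lemma proj_const_ind_elem:
  assumes g: "g \<in> (GL2 :: ('p::prime_card padic ^ 2 ^ 2) set)"
  shows "proj_const (ind_elem_IZ g) = ind_elem KZ (Wt 0) g 1"
proof -
  have "proj_const (ind_elem_IZ (mat 1)) = ind_elem KZ (Wt 0) (mat 1 :: 'p padic ^ 2 ^ 2) 1"
  proof (rule ind_Wt_eqI)
    show "proj_const (ind_elem_IZ (mat 1 :: 'p padic ^ 2 ^ 2)) \<in> carrier (ind KZ (Wt 0))"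
      by (rule rep_homD(1)[OF proj_const_hom]) simp
    fix y :: "'p padic ^ 2 ^ 2" assume y: "y \<in> GL2"
    show "proj_const (ind_elem_IZ (mat 1)) y = ind_elem KZ (Wt 0) (mat 1) 1 y"
      using y by (simp add: fibrewise_apply line_fun_ind_elem ind_elem_Wt_apply total_act mat_act_def)
        (simp add: line_total_def)
  qed (simp add: ind_elem_Wt_carrier)
  then have "act (ind KZ (Wt 0)) g (proj_const (ind_elem_IZ (mat 1))) = ind_elem KZ (Wt 0) g 1"
    using g by (simp add: ind_elem_Wt_act)
  then show ?thesis
    using rep_homD(4)[OF proj_const_hom g, of "ind_elem_IZ (mat 1)"] g by (simp add: act_ind_elem_IZ)
qed

abbreviation (input) Xtop :: "'p::prime_card bipoly" where
  "Xtop \<equiv> pX ^ (CARD('p) - 1)"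

lemma homogeneous2_Xtop: "homogeneous2 (CARD('p) - 1) (Xtop :: 'p::prime_card bipoly)"
  by (intro homogeneous2_power homogeneous2_pX)

text \<open>Origin of the sign in what follows: Y^(2p-2) - X^(p-1) Y^(p-1) is the spanning vector of
  the small summand minus X^(2p-2), so the top component of the generator is -X^(p-1).\<close>

lemma interpolate_point_fun: "interpolate point_fun = const2 (- 1) * (Xtop :: 'p::prime_card bipoly)"
  by (simp add: interpolate_def point_fun_def)

lemma interpolate_act:
  assumes "g \<in> KZ" "h \<in> carrier (line_rep :: ('p::prime_card mod_ring, _, 'p padic ^ 2 ^ 2) rep)"
  shows "interpolate (act line_rep g h) = mat_act (red g) (interpolate h)"
proof -
  interpret representation line_rep "KZ :: ('p padic ^ 2 ^ 2) set" by (rule representation_line_rep)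
  show ?thesis using rep_homD(4)[OF interpolate_hom assms] act_closed[OF assms] assms(2) by simp
qed

lemma proj_interp_ind_elem:
  assumes g: "g \<in> (GL2 :: ('p::prime_card padic ^ 2 ^ 2) set)"
  shows "proj_interp (ind_elem_IZ g) = ind_elem KZ (Wt (CARD('p) - 1)) g (const2 (- 1) * Xtop)"
proof -
  have h: "homogeneous2 (CARD('p) - 1) (const2 (- 1) * Xtop :: 'p bipoly)"
    by (intro homogeneous2_const2_mult homogeneous2_Xtop)
  have "proj_interp (ind_elem_IZ (mat 1)) = ind_elem KZ (Wt (CARD('p) - 1)) (mat 1 :: 'p padic ^ 2 ^ 2) (const2 (- 1) * Xtop)"
  proof (rule ind_Wt_eqI)
    show "proj_interp (ind_elem_IZ (mat 1 :: 'p padic ^ 2 ^ 2)) \<in> carrier (ind KZ (Wt (CARD('p) - 1)))"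
      by (rule rep_homD(1)[OF proj_interp_hom]) simp
    fix y :: "'p padic ^ 2 ^ 2" assume y: "y \<in> GL2"
    show "proj_interp (ind_elem_IZ (mat 1)) y = ind_elem KZ (Wt (CARD('p) - 1)) (mat 1) (const2 (- 1) * Xtop) y"
      unfolding fibrewise_apply[OF ind_elem_IZ_carrier[OF GL2_1] y] line_fun_ind_elem[OF y]
        ind_elem_Wt_apply[OF y GL2_1] matrix_mul_rid
    proof (cases "y \<in> KZ")
      case True
      then show "interpolate (if y \<in> KZ then act line_rep y point_fun else (\<lambda>x z. 0))
          = (if y \<in> KZ then mat_act (red y) (const2 (- 1) * Xtop) else 0)"
        using interpolate_act[OF True point_fun_line_rep] by (simp only: if_True interpolate_point_fun)
    qed (simp add: interpolate_zero)
  qed (rule ind_elem_Wt_carrier[OF GL2_1 h])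
  then have "act (ind KZ (Wt (CARD('p) - 1))) g (proj_interp (ind_elem_IZ (mat 1)))
      = ind_elem KZ (Wt (CARD('p) - 1)) g (const2 (- 1) * Xtop)"
    using g ind_elem_Wt_act[OF _ g h, of "mat 1"] by simp
  then show ?thesis
    using rep_homD(4)[OF proj_interp_hom g, of "ind_elem_IZ (mat 1)"] g by (simp add: act_ind_elem_IZ)
qed

section \<open>The section against the two projections\<close>

lemma section_const_proj:
  "f \<in> carrier ind_triv \<Longrightarrow> section_fun 0 (proj_const f) = average f"
  by (simp add: average_def compose_def)

lemma section_interp_proj:
  assumes f: "f \<in> carrier (ind_triv :: ('p::prime_card mod_ring, _, _) rep)"
  shows "section_fun (CARD('p) - 1) (proj_interp f) = f \<ominus>\<^bsub>ind_triv\<^esub> average f"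
proof (rule ind_triv_eqI)
  interpret representation "ind_triv :: ('p mod_ring, _, _) rep" GL2 by (rule representation_ind_triv)
  have p: "proj_interp f \<in> carrier (ind KZ (Wt (CARD('p) - 1)))" by (rule rep_homD(1)[OF proj_interp_hom f])
  show "section_fun (CARD('p) - 1) (proj_interp f) \<in> carrier ind_triv"
    by (rule rep_homD(1)[OF section_fun_rep_hom p]) simp
  have a: "average f \<in> carrier ind_triv" by (rule rep_homD(1)[OF average_hom f])
  then show "f \<ominus>\<^bsub>ind_triv\<^esub> average f \<in> carrier ind_triv" using f by simp
  fix y :: "'p padic ^ 2 ^ 2" assume y: "y \<in> GL2"
  have "section_fun (CARD('p) - 1) (proj_interp f) y = eval2 (interpolate (line_fun f y)) 0 1"
    using f y by (simp only: section_fun_apply[OF p] fibrewise_apply)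
  also have "\<dots> = f y - line_total (line_fun f y)"
    using f y by (simp add: eval2_interpolate line_fun_line_rep line_fun_0_1 punctured_const_def)
  finally show "section_fun (CARD('p) - 1) (proj_interp f) y = (f \<ominus>\<^bsub>ind_triv\<^esub> average f) y"
    using f a y by (simp only: ind_triv_minus_apply average_apply)
qed

text \<open>The value at the origin is set to 0 separately because a nonzero form of degree 0 does
  not vanish there.\<close>

lemma line_fun_section:
  assumes r: "r = 0 \<or> r = CARD('p) - 1"
    and F: "F \<in> carrier (ind KZ (Wt r) :: ('p::prime_card mod_ring, _, _) rep)" and y: "y \<in> GL2"
  shows "line_fun (section_fun r F) y = (\<lambda>x z. if x = 0 \<and> z = 0 then 0 else eval2 (F y) x z)"
proof (rule line_funI)
  fix k :: "'p padic ^ 2 ^ 2" assume k: "k \<in> KZ"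
  have "line_fun (section_fun r F) y (red k $ 2 $ 1) (red k $ 2 $ 2) = eval2 (F (k ** y)) 0 1"
    using line_fun_bottom[OF rep_homD(1)[OF section_fun_rep_hom[OF r] F] y k] F y k
    by (simp add: section_fun_apply KZ_sub_GL2)
  then show "line_fun (section_fun r F) y (red k $ 2 $ 1) (red k $ 2 $ 2)
      = (if red k $ 2 $ 1 = 0 \<and> red k $ 2 $ 2 = 0 then 0 else eval2 (F y) (red k $ 2 $ 1) (red k $ 2 $ 2))"
    using ind_Wt_left_mult(2)[OF F y k] bottom_row_nonzero[OF k] by auto
qed simp_all

lemma proj_const_section:
  assumes F: "F \<in> carrier (ind KZ (Wt 0) :: ('p::prime_card mod_ring, _, _) rep)"
  shows "proj_const (section_fun 0 F) = F"
proof (rule ind_Wt_eqI)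
  have s: "section_fun 0 F \<in> carrier ind_triv" by (rule rep_homD(1)[OF section_fun_rep_hom F]) simp
  then show "proj_const (section_fun 0 F) \<in> carrier (ind KZ (Wt 0))" by (rule rep_homD(1)[OF proj_const_hom])
  fix y :: "'p padic ^ 2 ^ 2" assume y: "y \<in> GL2"
  obtain c where c: "F y = const2 c" using ind_Wt_left_mult(1)[OF F y KZ_1(1)] by (auto simp: homogeneous2_0_iff)
  have "line_fun (section_fun 0 F) y = punctured_const c"
    unfolding line_fun_section[OF disjI1[OF refl] F y] c by (simp add: punctured_const_def fun_eq_iff)
  then show "proj_const (section_fun 0 F) y = F y" using s y c by (simp add: fibrewise_apply)
qed (rule F)

lemma proj_interp_section:
  assumes F: "F \<in> carrier (ind KZ (Wt (CARD('p) - 1)) :: ('p::prime_card mod_ring, _, _) rep)"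
  shows "proj_interp (section_fun (CARD('p) - 1) F) = F"
proof (rule ind_Wt_eqI)
  have s: "section_fun (CARD('p) - 1) F \<in> carrier ind_triv" by (rule rep_homD(1)[OF section_fun_rep_hom F]) simp
  then show "proj_interp (section_fun (CARD('p) - 1) F) \<in> carrier (ind KZ (Wt (CARD('p) - 1)))"
    by (rule rep_homD(1)[OF proj_interp_hom])
  fix y :: "'p padic ^ 2 ^ 2" assume y: "y \<in> GL2"
  have h: "homogeneous2 (CARD('p) - 1) (F y)" using ind_Wt_left_mult(1)[OF F y KZ_1(1)] .
  have "eval2 (F y) 0 0 = 0" using h p_ge_2[where 'p='p] by (intro eval2_origin[OF h]) simp
  then have "line_fun (section_fun (CARD('p) - 1) F) y = eval2 (F y)"
    unfolding line_fun_section[OF disjI2[OF refl] F y] by (auto simp: fun_eq_iff)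
  then show "proj_interp (section_fun (CARD('p) - 1) F) y = F y"
    using interpolate_eval2[OF h] by (simp only: fibrewise_apply[OF s y])
qed (rule F)

lemma average_average:
  assumes f: "f \<in> carrier (ind_triv :: ('p::prime_card mod_ring, _, _) rep)"
  shows "average (average f) = average f"
proof (rule ind_triv_eqI)
  have a: "average f \<in> carrier ind_triv" by (rule rep_homD(1)[OF average_hom f])
  then show "average (average f) \<in> carrier ind_triv" by (rule rep_homD(1)[OF average_hom])
  show "average (average f) y = average f y" if "y \<in> GL2" for y
    using f a that by (simp add: average_apply line_fun_average)
qed (rule rep_homD(1)[OF average_hom f])

lemma off_diag_average:
  assumes f: "f \<in> carrier (ind_triv :: ('p::prime_card mod_ring, _, _) rep)"
  shows "off_diag (average f) = \<zero>\<^bsub>ind_triv\<^esub>"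
proof (rule ind_triv_eqI)
  interpret representation "ind_triv :: ('p mod_ring, _, _) rep" GL2 by (rule representation_ind_triv)
  have a: "average f \<in> carrier ind_triv" by (rule rep_homD(1)[OF average_hom f])
  then show "off_diag (average f) \<in> carrier ind_triv" by (rule rep_homD(1)[OF off_diag_hom])
  show "off_diag (average f) y = \<zero>\<^bsub>ind_triv\<^esub> y" if "y \<in> GL2" for y
    using f a that by (simp add: off_diag_apply line_fun_average average_apply ind_triv_apply)
  show "\<zero>\<^bsub>ind_triv\<^esub> \<in> carrier (ind_triv :: ('p mod_ring, _, _) rep)" by simp
qed

definition S_const :: "('p::prime_card padic ^ 2 ^ 2 \<Rightarrow> 'p mod_ring) \<Rightarrow> 'p padic ^ 2 ^ 2 \<Rightarrow> 'p mod_ring" where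
  "S_const f = T_m1_0 f \<oplus>\<^bsub>ind_triv\<^esub> T_1_0 f"

lemma S_const_eq:
  assumes f: "f \<in> carrier (ind_triv :: ('p::prime_card mod_ring, _, _) rep)"
  shows "S_const f = flip (average f)"
proof -
  have a: "average f \<in> carrier ind_triv" and o: "off_diag f \<in> carrier ind_triv"
    by (rule rep_homD(1)[OF average_hom f], rule rep_homD(1)[OF off_diag_hom f])
  have "off_diag f \<oplus>\<^bsub>ind_triv\<^esub> f = average f"
  proof (rule ind_triv_eqI)
    interpret representation "ind_triv :: ('p mod_ring, _, _) rep" GL2 by (rule representation_ind_triv)
    show "off_diag f \<oplus>\<^bsub>ind_triv\<^esub> f \<in> carrier ind_triv" using f o by simp
  qed (use f a in \<open>simp_all add: ind_triv_apply off_diag_apply average_apply\<close>)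
  then show ?thesis
    unfolding S_const_def T_m1_0_eq T_1_0_eq using rep_homD(2)[OF flip_hom o f] f by (simp add: compose_def)
qed

lemma T_m1_0_apply: "f \<in> carrier (ind_triv :: ('p::prime_card mod_ring, _, _) rep) \<Longrightarrow> T_m1_0 f = flip (off_diag f)"
  by (simp add: T_m1_0_eq compose_def)

lemma T_m1_0_hom: "T_m1_0 \<in> rep_hom GL2 ind_triv (ind_triv :: ('p::prime_card mod_ring, _, _) rep)"
  unfolding T_m1_0_eq by (rule rep_hom_compose[OF off_diag_hom flip_hom representation_ind_triv])

text \<open>Candidate for \<open>T\<close> in weight 0, equivariant as a composite of equivariant
  maps. Applying \<open>flip\<close> alone is enough: the operator T_-1,0 + T_1,0 equals
  \<open>flip\<close> after \<open>average\<close>, and the section after the projection is already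
  \<open>average\<close>.\<close>

definition hecke_const :: "('p::prime_card padic ^ 2 ^ 2 \<Rightarrow> 'p bipoly) \<Rightarrow> 'p padic ^ 2 ^ 2 \<Rightarrow> 'p bipoly" where
  "hecke_const = compose (carrier (ind KZ (Wt 0))) (compose (carrier ind_triv) proj_const flip) (section_fun 0)"

definition hecke_interp :: "('p::prime_card padic ^ 2 ^ 2 \<Rightarrow> 'p bipoly) \<Rightarrow> 'p padic ^ 2 ^ 2 \<Rightarrow> 'p bipoly" where
  "hecke_interp = compose (carrier (ind KZ (Wt (CARD('p) - 1))))
     (compose (carrier ind_triv) proj_interp T_m1_0) (section_fun (CARD('p) - 1))"

lemma hecke_const_hom: "hecke_const \<in> rep_hom GL2 (ind KZ (Wt 0)) (ind KZ (Wt 0) :: ('p::prime_card mod_ring, _, _) rep)"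
  unfolding hecke_const_def
  by (rule rep_hom_compose[OF section_fun_rep_hom[OF disjI1[OF refl]]
        rep_hom_compose[OF flip_hom proj_const_hom representation_ind_triv]
        inducible.representation_ind[OF inducible_Wt]])

lemma hecke_interp_hom:
  "hecke_interp \<in> rep_hom GL2 (ind KZ (Wt (CARD('p) - 1))) (ind KZ (Wt (CARD('p) - 1)) :: ('p::prime_card mod_ring, _, _) rep)"
  unfolding hecke_interp_def
  by (rule rep_hom_compose[OF section_fun_rep_hom[OF disjI2[OF refl]]
        rep_hom_compose[OF T_m1_0_hom proj_interp_hom representation_ind_triv]
        inducible.representation_ind[OF inducible_Wt]])

lemma hecke_const_intertwines:
  assumes f: "f \<in> carrier (ind_triv :: ('p::prime_card mod_ring, _, _) rep)"
  shows "proj_const (S_const f) = hecke_const (proj_const f)"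
  using rep_homD(1)[OF proj_const_hom f] rep_homD(1)[OF average_hom f]
  by (simp add: hecke_const_def compose_def section_const_proj[OF f] S_const_eq[OF f])

text \<open>Projecting and returning by the section replaces f by f minus its average. The operator
  does not see the difference, since \<open>off_diag\<close> kills averages.\<close>

lemma hecke_interp_intertwines:
  assumes f: "f \<in> carrier (ind_triv :: ('p::prime_card mod_ring, _, _) rep)"
  shows "proj_interp (T_m1_0 f) = hecke_interp (proj_interp f)"
proof -
  interpret representation "ind_triv :: ('p mod_ring, _, _) rep" GL2 by (rule representation_ind_triv)
  have a: "average f \<in> carrier ind_triv" by (rule rep_homD(1)[OF average_hom f])
  have m: "f \<ominus>\<^bsub>ind_triv\<^esub> average f \<in> carrier ind_triv" using f a by simp
  have "T_m1_0 (average f) = \<zero>\<^bsub>ind_triv\<^esub>"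
    using rep_hom_zero[OF flip_hom representation_ind_triv representation_ind_triv]
    by (simp add: T_m1_0_apply[OF a] off_diag_average[OF f])
  then have "T_m1_0 (f \<ominus>\<^bsub>ind_triv\<^esub> average f) = T_m1_0 f"
    using rep_hom_minus[OF T_m1_0_hom representation_ind_triv representation_ind_triv f a]
      rep_homD(1)[OF T_m1_0_hom f] by (simp add: minus_eq)
  then show ?thesis
    using rep_homD(1)[OF proj_interp_hom f] m
    unfolding hecke_interp_def compose_def by (simp add: section_interp_proj[OF f, simplified])
qed

lemma T_1_0_ind_elem: "T_1_0 (ind_elem_IZ (mat 1)) = (ind_elem_IZ beta :: 'p::prime_card padic ^ 2 ^ 2 \<Rightarrow> 'p mod_ring)"
  by (simp add: T_1_0_eq flip_ind_elem)

lemma Hecke_T_0: "Hecke_T 0 = (hecke_const :: _ \<Rightarrow> 'p::prime_card padic ^ 2 ^ 2 \<Rightarrow> 'p bipoly)"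
proof (rule Hecke_T_eqI[OF hecke_const_hom])
  fix P :: "'p bipoly" assume "homogeneous2 0 P"
  then obtain c where c: "P = const2 c * 1" by (auto simp: homogeneous2_0_iff)
  let ?I = "ind KZ (Wt 0) :: ('p mod_ring, _, _) rep"
  let ?e = "ind_elem_IZ (mat 1) :: 'p padic ^ 2 ^ 2 \<Rightarrow> 'p mod_ring"
  \<comment> \<open>The permutation matrix turns \<open>alpha\<close> into \<open>beta\<close> and
    acts trivially on the weight 0, so the term [alpha, 1] of \<open>T\<close> is the contribution
    of \<open>T_1_0\<close>.\<close>
  define w :: "'p padic_int ^ 2 ^ 2" where "w = mat2 0 1 1 0"
  have w: "embed_mat w \<in> KZ" using embed_mat_KZ[of w] by (simp add: w_def det_2)
  have "beta = alpha ** embed_mat w"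
    by (rule mat2_eqI) (simp_all add: matrix_mult_nth_2 beta_def alpha_def w_def)
  then have b: "ind_elem KZ (Wt 0) beta 1 = ind_elem KZ (Wt 0) (alpha :: 'p padic ^ 2 ^ 2) 1"
    using ind_elem_Wt_mult[OF alpha_GL2 w, of 0 1] by (simp add: mat_act_def)
  have e: "?e \<in> carrier ind_triv" by simp
  have "hecke_const (ind_elem KZ (Wt 0) (mat 1) 1) = proj_const (S_const ?e)"
    using hecke_const_intertwines[OF e] proj_const_ind_elem[of "mat 1 :: 'p padic ^ 2 ^ 2"] by simp
  also have "\<dots> = proj_const (T_m1_0 ?e) \<oplus>\<^bsub>?I\<^esub> proj_const (T_1_0 ?e)"
    unfolding S_const_def T_1_0_eq
    by (rule rep_homD(2)[OF proj_const_hom rep_homD(1)[OF T_m1_0_hom e] rep_homD(1)[OF flip_hom e]])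
  also have "proj_const (T_m1_0 ?e) = (\<Oplus>\<^bsub>?I\<^esub>l\<in>(I1 :: 'p padic_int set). proj_const (ind_elem_IZ (hecke_mat l)))"
    unfolding T_m1_0_ind_elem
    by (rule rep_hom_finsum[OF proj_const_hom representation_ind_triv inducible.representation_ind[OF inducible_Wt]]) simp_all
  also have "\<dots> = (\<Oplus>\<^bsub>?I\<^esub>l\<in>(I1 :: 'p padic_int set). ind_elem KZ (Wt 0) (hecke_mat l) 1)"
    by (simp add: proj_const_ind_elem)
  also have "proj_const (T_1_0 ?e) = ind_elem KZ (Wt 0) alpha 1"
    by (simp add: T_1_0_ind_elem proj_const_ind_elem b)
  also have "(\<Oplus>\<^bsub>?I\<^esub>l\<in>(I1 :: 'p padic_int set). ind_elem KZ (Wt 0) (hecke_mat l) 1) \<oplus>\<^bsub>?I\<^esub> ind_elem KZ (Wt 0) alpha 1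
      = hecke_rhs 0 1"
    by (simp add: hecke_rhs_def)
  finally have 1: "hecke_const (ind_elem KZ (Wt 0) (mat 1) 1) = (hecke_rhs 0 1 :: 'p padic ^ 2 ^ 2 \<Rightarrow> 'p bipoly)" .
  show "hecke_const (ind_elem KZ (Wt 0) (mat 1) P) = hecke_rhs 0 P"
    unfolding c hecke_rhs_smult[OF homogeneous2_1] ind_elem_Wt_smult[OF GL2_1 homogeneous2_1]
      rep_homD(3)[OF hecke_const_hom ind_elem_Wt_carrier[OF GL2_1 homogeneous2_1]] 1 ..
qed

text \<open>Computed on the image -X^(p-1) of the generator, where the value of
  \<open>T_m1_0\<close> is known; multiplication by -1 removes the sign.\<close>

lemma hecke_interp_Xtop:
  "hecke_interp (ind_elem KZ (Wt (CARD('p) - 1)) (mat 1) Xtop)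
    = (\<Oplus>\<^bsub>ind KZ (Wt (CARD('p) - 1))\<^esub>l\<in>(I1 :: 'p::prime_card padic_int set). ind_elem KZ (Wt (CARD('p) - 1)) (hecke_mat l) Xtop)"
proof -
  let ?W = "Wt (CARD('p) - 1) :: ('p mod_ring, 'p bipoly, 'p padic ^ 2 ^ 2) rep"
  let ?I = "ind KZ ?W"
  let ?e = "ind_elem_IZ (mat 1) :: 'p padic ^ 2 ^ 2 \<Rightarrow> 'p mod_ring"
  define m where "m = const2 (- 1) * (Xtop :: 'p bipoly)"
  interpret I: representation ?I GL2 by (rule inducible.representation_ind[OF inducible_Wt])
  have m: "homogeneous2 (CARD('p) - 1) m" unfolding m_def by (intro homogeneous2_const2_mult homogeneous2_Xtop)
  have X: "Xtop = const2 (- 1) * m" by (simp add: m_def)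
  have e: "?e \<in> carrier ind_triv" by simp
  have "hecke_interp (ind_elem KZ ?W (mat 1) m) = proj_interp (T_m1_0 ?e)"
    unfolding hecke_interp_intertwines[OF e] proj_interp_ind_elem[OF GL2_1] m_def ..
  also have "\<dots> = (\<Oplus>\<^bsub>?I\<^esub>l\<in>(I1 :: 'p padic_int set). proj_interp (ind_elem_IZ (hecke_mat l)))"
    unfolding T_m1_0_ind_elem
    by (rule rep_hom_finsum[OF proj_interp_hom representation_ind_triv I.representation_axioms]) simp_all
  also have "\<dots> = (\<Oplus>\<^bsub>?I\<^esub>l\<in>(I1 :: 'p padic_int set). ind_elem KZ ?W (hecke_mat l) m)"
    unfolding proj_interp_ind_elem[OF hecke_mat_GL2] m_def ..
  finally have 1: "hecke_interp (ind_elem KZ ?W (mat 1) m)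
    = (\<Oplus>\<^bsub>?I\<^esub>l\<in>(I1 :: 'p padic_int set). ind_elem KZ ?W (hecke_mat l) m)" .
  have c: "ind_elem KZ ?W (hecke_mat l) m \<in> carrier ?I" "ind_elem KZ ?W (hecke_mat l) Xtop \<in> carrier ?I" for l
    by (intro ind_elem_Wt_carrier hecke_mat_GL2 m homogeneous2_Xtop)+
  have "hecke_interp (ind_elem KZ ?W (mat 1) Xtop) = (- 1) \<odot>\<^bsub>?I\<^esub> hecke_interp (ind_elem KZ ?W (mat 1) m)"
    unfolding X ind_elem_Wt_smult[OF GL2_1 m] rep_homD(3)[OF hecke_interp_hom ind_elem_Wt_carrier[OF GL2_1 m]] ..
  also have "\<dots> = (\<Oplus>\<^bsub>?I\<^esub>l\<in>(I1 :: 'p padic_int set). ind_elem KZ ?W (hecke_mat l) Xtop)"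
    unfolding 1
  proof (rule ind_Wt_eqI)
    show "(- 1) \<odot>\<^bsub>?I\<^esub> (\<Oplus>\<^bsub>?I\<^esub>l\<in>(I1 :: 'p padic_int set). ind_elem KZ ?W (hecke_mat l) m) \<in> carrier ?I"
      by (intro I.smult_closed finsum_ind_Wt_carrier c)
    show "(\<Oplus>\<^bsub>?I\<^esub>l\<in>(I1 :: 'p padic_int set). ind_elem KZ ?W (hecke_mat l) Xtop) \<in> carrier ?I"
      by (intro finsum_ind_Wt_carrier c)
    fix y :: "'p padic ^ 2 ^ 2" assume y: "y \<in> GL2"
    show "((- 1) \<odot>\<^bsub>?I\<^esub> (\<Oplus>\<^bsub>?I\<^esub>l\<in>(I1 :: 'p padic_int set). ind_elem KZ ?W (hecke_mat l) m)) y
        = (\<Oplus>\<^bsub>?I\<^esub>l\<in>(I1 :: 'p padic_int set). ind_elem KZ ?W (hecke_mat l) Xtop) y"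
      unfolding ind_apply(3)[OF y] finsum_ind_Wt_apply[OF c(1) y] finsum_ind_Wt_apply[OF c(2) y] Wt_simps(4)
        sum_distrib_left ind_elem_Wt_linear(2)[OF y hecke_mat_GL2, symmetric] X[symmetric] ..
  qed
  finally show ?thesis .
qed

section \<open>Coset representatives in the weight p - 1\<close>

lemma ind_elem_mult_eq:
  assumes "g = g' ** embed_mat k" "det (residue_mat k) \<noteq> 0" "g' \<in> (GL2 :: ('p::prime_card padic ^ 2 ^ 2) set)"
    "homogeneous2 r v"
  shows "ind_elem KZ (Wt r) g v = ind_elem KZ (Wt r) g' (mat_act (residue_mat k) v)"
  using ind_elem_Wt_mult[OF assms(3) _ assms(4)] embed_mat_KZ[OF assms(2)] assms(1) by simp

lemma weyl_hecke_zero: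
  assumes l: "residue l = 0"
  shows "ind_elem KZ (Wt (CARD('p) - 1)) (weyl_mat c ** hecke_mat l) Xtop
    = ind_elem KZ (Wt (CARD('p) - 1)) (alpha :: 'p::prime_card padic ^ 2 ^ 2) (pY ^ (CARD('p) - 1))"
proof -
  obtain m where m: "l = pint * m" using l by (auto simp: residue_eq_0_iff elim: dvdE)
  \<comment> \<open>The product has rows (p c, c l + 1) and (p, l); its second row is divisible by p
    since l is, and removing that factor leaves k. Modulo p the first column of k is (0, 1), so k
    sends X to Y.\<close>
  define k where "k = mat2 (pint * c) (c * l + 1) 1 m"
  have "weyl_mat c ** hecke_mat l = alpha ** embed_mat k"
    by (rule mat2_eqI) (simp_all add: matrix_mult_nth_2 alpha_def k_def m p_adic_def)
  moreover have "det (residue_mat k) \<noteq> 0" by (simp add: k_def det_2 residue_mult residue_add l)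
  moreover have "mat_act (residue_mat k) Xtop = pY ^ (CARD('p) - 1)"
    by (simp add: mat_act_def k_def residue_mult)
  ultimately show ?thesis using ind_elem_mult_eq[OF _ _ alpha_GL2 homogeneous2_Xtop] by metis
qed

lemma weyl_hecke_nonzero:
  assumes l: "residue l \<noteq> 0" and m: "residue m = residue c + 1 / residue l"
  shows "ind_elem KZ (Wt (CARD('p) - 1)) (weyl_mat c ** hecke_mat l) Xtop
    = ind_elem KZ (Wt (CARD('p) - 1)) (hecke_mat m :: 'p::prime_card padic ^ 2 ^ 2) Xtop"
proof -
  have "residue (c * l + 1 - m * l) = 0"
    using l by (simp add: residue_mult residue_add residue_diff m distrib_right)
  then obtain d where "c * l + 1 - m * l = pint * d" by (auto simp: residue_eq_0_iff elim: dvdE)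
  then have d: "c * l + 1 = pint * d + m * l" by (simp add: algebra_simps)
  have d': "1 + of_padic_int c * of_padic_int l = of_padic_int l * of_padic_int m + of_padic_int d * of_nat CARD('p)"
    using arg_cong[OF d, of of_padic_int] by (simp add: algebra_simps)
  \<comment> \<open>Solves the matrix equation with \<open>hecke_mat m\<close> as left factor; the
    choice of m makes c l + 1 - m l divisible by p, so the entry d is integral. Modulo p this k is
    upper triangular with entries -1/l and l on the diagonal, and it fixes X^(p-1) by
    Fermat.\<close>
  define k where "k = mat2 (c - m) d pint l"
  have "weyl_mat c ** hecke_mat l = hecke_mat m ** embed_mat k"
    using d' by (intro mat2_eqI) (simp_all add: matrix_mult_nth_2 k_def p_adic_def algebra_simps)
  moreover have r: "residue c - residue m \<noteq> 0" using l by (simp add: m)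
  then have "det (residue_mat k) \<noteq> 0" using l by (simp add: k_def det_2 residue_diff)
  moreover have "mat_act (residue_mat k) Xtop = Xtop"
  proof -
    have "mat_act (residue_mat k) Xtop = (const2 (residue c - residue m) * pX) ^ (CARD('p) - 1)"
      by (simp add: mat_act_def k_def residue_diff)
    also have "\<dots> = const2 ((residue c - residue m) ^ (CARD('p) - 1)) * Xtop"
      by (simp only: power_mult_distrib const2_power)
    also have "\<dots> = Xtop" unfolding power_card_minus_1 using r by simp
    finally show ?thesis .
  qed
  ultimately show ?thesis using ind_elem_mult_eq[OF _ _ hecke_mat_GL2 homogeneous2_Xtop] by metis
qed

lemma sum_moebius:
  fixes B :: "'p::prime_card mod_ring \<Rightarrow> 'a::ab_group_add"
  shows "(\<Sum>x\<in>UNIV - {0}. B (c + 1 / x)) = (\<Sum>z\<in>UNIV - {c}. B z)"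
  by (rule sum.reindex_bij_witness[where j="\<lambda>x. c + 1 / x" and i="\<lambda>z. 1 / (z - c)"]) auto

text \<open>The form is the translate of X^(p-1) by \<open>weyl_mat\<close>, so its image is the
  translate of a known sum. The label with residue 0 becomes the term at \<open>alpha\<close>; the
  nonzero residues are permuted among the remaining terms.\<close>

lemma hecke_interp_Ytop:
  "hecke_interp (ind_elem KZ (Wt (CARD('p) - 1)) (mat 1) ((pY + const2 c * pX) ^ (CARD('p) - 1)))
    = (hecke_rhs (CARD('p) - 1) ((pY + const2 c * pX) ^ (CARD('p) - 1)) :: 'p::prime_card padic ^ 2 ^ 2 \<Rightarrow> 'p bipoly)"
proof (rule ind_Wt_eqI)
  let ?W = "Wt (CARD('p) - 1) :: ('p mod_ring, 'p bipoly, 'p padic ^ 2 ^ 2) rep"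
  let ?I = "ind KZ ?W"
  let ?P = "(pY + const2 c * pX) ^ (CARD('p) - 1) :: 'p bipoly"
  define k where "k = weyl_mat (teich c)"
  have k: "k \<in> KZ" "red k = mat2 c 1 1 0" "k \<in> GL2"
    using weyl_mat_KZ[of "teich c"] KZ_sub_GL2 by (auto simp: k_def)
  have P: "homogeneous2 (CARD('p) - 1) ?P" by (intro homogeneous2_power homogeneous2_linear')
  show "hecke_interp (ind_elem KZ ?W (mat 1) ?P) \<in> carrier ?I"
    by (rule rep_homD(1)[OF hecke_interp_hom ind_elem_Wt_carrier[OF GL2_1 P]])
  show "hecke_rhs (CARD('p) - 1) ?P \<in> carrier ?I" by (rule hecke_rhs_carrier[OF P])
  fix y :: "'p padic ^ 2 ^ 2" assume y: "y \<in> GL2"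
  define B where "B z = ind_elem KZ ?W (hecke_mat (teich z)) Xtop y" for z
  have "ind_elem KZ ?W (mat 1) ?P = act ?I k (ind_elem KZ ?W (mat 1) Xtop)"
    using ind_elem_Wt_mult[OF GL2_1 k(1) homogeneous2_Xtop] ind_elem_Wt_act[OF GL2_1 k(3) homogeneous2_Xtop]
    by (simp add: k(2) mat_act_pX)
  then have "hecke_interp (ind_elem KZ ?W (mat 1) ?P)
      = act ?I k (\<Oplus>\<^bsub>?I\<^esub>l\<in>(I1 :: 'p padic_int set). ind_elem KZ ?W (hecke_mat l) Xtop)"
    using rep_homD(4)[OF hecke_interp_hom k(3) ind_elem_Wt_carrier[OF GL2_1 homogeneous2_Xtop]]
    by (simp only: hecke_interp_Xtop)
  then have "hecke_interp (ind_elem KZ ?W (mat 1) ?P) y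
      = (\<Sum>x\<in>UNIV. ind_elem KZ ?W (hecke_mat (teich x)) Xtop (y ** k))"
    using finsum_ind_Wt_apply[OF ind_elem_Wt_carrier[OF hecke_mat_GL2 homogeneous2_Xtop] GL2_mult[OF y k(3)]]
    by (simp only: ind_apply(4)[OF y])
  also have "\<dots> = (\<Sum>x\<in>UNIV. ind_elem KZ ?W (k ** hecke_mat (teich x)) Xtop y)"
  proof (rule sum.cong[OF refl])
    fix x :: "'p mod_ring"
    show "ind_elem KZ ?W (hecke_mat (teich x)) Xtop (y ** k) = ind_elem KZ ?W (k ** hecke_mat (teich x)) Xtop y"
      unfolding ind_elem_Wt_act[OF hecke_mat_GL2 k(3) homogeneous2_Xtop, symmetric] ind_apply(4)[OF y] ..
  qed
  also have "\<dots> = ind_elem KZ ?W (k ** hecke_mat (teich 0)) Xtop y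
      + (\<Sum>x\<in>UNIV - {0}. ind_elem KZ ?W (k ** hecke_mat (teich x)) Xtop y)"
    by (rule sum.remove) simp_all
  also have "ind_elem KZ ?W (k ** hecke_mat (teich 0)) Xtop = ind_elem KZ ?W alpha (pY ^ (CARD('p) - 1))"
    unfolding k_def by (rule weyl_hecke_zero) simp
  also have "(\<Sum>x\<in>UNIV - {0}. ind_elem KZ ?W (k ** hecke_mat (teich x)) Xtop y)
      = (\<Sum>x\<in>UNIV - {0}. B (c + 1 / x))"
  proof (rule sum.cong[OF refl])
    fix x :: "'p mod_ring" assume "x \<in> UNIV - {0}"
    then show "ind_elem KZ ?W (k ** hecke_mat (teich x)) Xtop y = B (c + 1 / x)"
      unfolding B_def k_def by (intro fun_cong[OF weyl_hecke_nonzero]) simp_all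
  qed
  also have "\<dots> = (\<Sum>z\<in>UNIV - {c}. B z)" by (rule sum_moebius)
  \<comment> \<open>The index z = c is missing from the sum obtained so far, and its term in the
    formula is 0: P(X, -z X) = (c - z)^(p-1) X^(p-1) vanishes at z = c and equals X^(p-1)
    otherwise.\<close>
  also have "\<dots> = (\<Sum>z\<in>UNIV. ind_elem KZ ?W (hecke_mat (teich z)) (subst2 ?P pX (const2 (- z) * pX)) y)"
  proof (rule sum.mono_neutral_cong_left)
    have s: "subst2 ?P pX (const2 (- z) * pX) = (if z = c then 0 else Xtop)" for z
    proof -
      have "subst2 ?P pX (const2 (- z) * pX) = (const2 (c - z) * pX) ^ (CARD('p) - 1)"
        by (simp add: algebra_simps)
      also have "\<dots> = const2 ((c - z) ^ (CARD('p) - 1)) * Xtop"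
        by (simp only: power_mult_distrib const2_power)
      finally show ?thesis unfolding power_card_minus_1 by auto
    qed
    show "\<forall>z\<in>UNIV - (UNIV - {c}). ind_elem KZ ?W (hecke_mat (teich z)) (subst2 ?P pX (const2 (- z) * pX)) y = 0"
      unfolding s using y by (auto simp: ind_elem_Wt_apply mat_act_def)
    show "\<And>z. z \<in> UNIV - {c} \<Longrightarrow> B z = ind_elem KZ ?W (hecke_mat (teich z)) (subst2 ?P pX (const2 (- z) * pX)) y"
      unfolding s B_def by auto
  qed simp_all
  also have "ind_elem KZ ?W alpha (pY ^ (CARD('p) - 1)) = ind_elem KZ ?W alpha (subst2 ?P 0 pY)" by simp
  finally show "hecke_interp (ind_elem KZ ?W (mat 1) ?P) y = hecke_rhs (CARD('p) - 1) ?P y"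
    unfolding hecke_rhs_apply[OF P y] by (simp only: add.commute)
qed

lemma Hecke_T_top: "Hecke_T (CARD('p) - 1) = (hecke_interp :: _ \<Rightarrow> 'p::prime_card padic ^ 2 ^ 2 \<Rightarrow> 'p bipoly)"
proof (rule Hecke_T_eqI[OF hecke_interp_hom])
  let ?W = "Wt (CARD('p) - 1) :: ('p mod_ring, 'p bipoly, 'p padic ^ 2 ^ 2) rep"
  let ?I = "ind KZ ?W"
  interpret I: representation ?I GL2 by (rule inducible.representation_ind[OF inducible_Wt])
  fix P :: "'p bipoly" assume "homogeneous2 (CARD('p) - 1) P"
  then show "hecke_interp (ind_elem KZ ?W (mat 1) P) = hecke_rhs (CARD('p) - 1) P"
  proof (induction rule: Wt_top_induct)
    case X
    \<comment> \<open>As p - 1 is positive, X^(p-1) vanishes at X = 0; the term at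
      \<open>alpha\<close> is absent for this form.\<close>
    have z: "subst2 Xtop 0 pY = (0 :: 'p bipoly)" using p_ge_2[where 'p='p] by (simp add: power_0_left)
    have "ind_elem KZ ?W alpha (subst2 Xtop 0 pY) = \<zero>\<^bsub>?I\<^esub>"
      using inducible.ind_elem_zero[OF inducible_Wt alpha_GL2, of "CARD('p) - 1"] unfolding z by (simp only: Wt_simps(2))
    moreover have "(\<Oplus>\<^bsub>?I\<^esub>l\<in>(I1 :: 'p padic_int set). ind_elem KZ ?W (hecke_mat l) Xtop) \<in> carrier ?I"
      by (intro finsum_ind_Wt_carrier ind_elem_Wt_carrier hecke_mat_GL2 homogeneous2_Xtop)
    moreover have "subst2 Xtop pX W = Xtop" for W :: "'p bipoly" by simp
    ultimately show ?case unfolding hecke_interp_Xtop hecke_rhs_def by (simp only: I.r_zero)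
  next
    case (Y c)
    show ?case by (rule hecke_interp_Ytop)
  next
    case (add P Q)
    have "ind_elem KZ ?W (mat 1) (P + Q) = ind_elem KZ ?W (mat 1) P \<oplus>\<^bsub>?I\<^esub> ind_elem KZ ?W (mat 1) Q"
      using inducible.ind_elem_add[OF inducible_Wt GL2_1, of P "CARD('p) - 1" Q] add by simp
    then show ?case
      using add rep_homD(2)[OF hecke_interp_hom ind_elem_Wt_carrier[OF GL2_1 add(1)] ind_elem_Wt_carrier[OF GL2_1 add(2)]]
      by (simp only: hecke_rhs_add)
  next
    case (smult c P)
    then show ?case
      unfolding ind_elem_Wt_smult[OF GL2_1 smult(1)] hecke_rhs_smult[OF smult(1)]
        rep_homD(3)[OF hecke_interp_hom ind_elem_Wt_carrier[OF GL2_1 smult(1)]] by simp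
  qed
qed

section \<open>The isomorphisms\<close>

definition Phi :: "('p::prime_card padic ^ 2 ^ 2 \<Rightarrow> 'p mod_ring) \<Rightarrow> 'p padic ^ 2 ^ 2 \<Rightarrow> 'p bipoly set" where
  "Phi = fibrewise class_of_fun"

lemma Phi_hom: "Phi \<in> rep_hom GL2 ind_triv (ind KZ Wt_quot :: ('p::prime_card mod_ring, _, _) rep)"
  unfolding Phi_def by (rule fibrewise_rep_hom[OF class_of_fun_rep_hom inducible_Wt_quot])

text \<open>The vector prescribed in the theorem is the indicator of the point (0:1): at X = 0 only
  Y^(2p-2) survives, and for nonzero X the two terms cancel.\<close>

lemma Phi_ind_elem:
  "Phi (ind_elem_IZ (mat 1)) = ind_elem KZ Wt_quot (mat 1 :: 'p::prime_card padic ^ 2 ^ 2)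
     (to_Wt_quot (pY ^ (2 * CARD('p) - 2) - pX ^ (CARD('p) - 1) * pY ^ (CARD('p) - 1)))"
proof -
  interpret inducible Wt_quot "KZ :: ('p padic ^ 2 ^ 2) set" by (rule inducible_Wt_quot)
  let ?B = "pY ^ (2 * CARD('p) - 2) - pX ^ (CARD('p) - 1) * pY ^ (CARD('p) - 1) :: 'p bipoly"
  have "homogeneous2 (2 * CARD('p) - 2) ?B"
    by (intro homogeneous2_diff homogeneous2_XY homogeneous2_power homogeneous2_pY)
  moreover have "eval2 ?B = point_fun"
    by (intro ext) (simp add: point_fun_def power_2_card_minus_2 power_card_minus_1_Suc0)
  ultimately have B: "to_Wt_quot ?B = class_of_fun point_fun" by (simp only: to_Wt_quot_eq)
  have c: "class_of_fun point_fun \<in> carrier (Wt_quot :: ('p mod_ring, _, _) rep)" by (simp add: class_of_fun_simps)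
  show ?thesis
    unfolding B
  proof (rule ind_eqI)
    show "Phi (ind_elem_IZ (mat 1 :: 'p padic ^ 2 ^ 2)) \<in> carrier (ind KZ Wt_quot)"
      by (rule rep_homD(1)[OF Phi_hom]) simp
    show "ind_elem KZ Wt_quot (mat 1 :: 'p padic ^ 2 ^ 2) (class_of_fun point_fun) \<in> carrier (ind KZ Wt_quot)"
      by (rule ind_elem_carrier[OF GL2_1 c])
    fix y :: "'p padic ^ 2 ^ 2" assume y: "y \<in> GL2"
    show "Phi (ind_elem_IZ (mat 1)) y = ind_elem KZ Wt_quot (mat 1) (class_of_fun point_fun) y"
      using y by (simp add: Phi_def fibrewise_apply line_fun_ind_elem ind_elem_apply class_of_fun_simps class_of_fun_zero)
  qed
qed

lemma compose_proj_Phi: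
  assumes "\<And>h :: 'p::prime_card mod_ring \<Rightarrow> 'p mod_ring \<Rightarrow> 'p mod_ring. h \<in> carrier line_rep \<Longrightarrow> \<pi> (class_of_fun h) = b h"
  shows "compose (carrier ind_triv) (ind_map KZ Wt_quot \<pi>) Phi = fibrewise b"
proof
  fix f :: "'p padic ^ 2 ^ 2 \<Rightarrow> 'p mod_ring"
  show "compose (carrier ind_triv) (ind_map KZ Wt_quot \<pi>) Phi f = fibrewise b f"
  proof (cases "f \<in> carrier ind_triv")
    case True
    have "Phi f \<in> carrier (ind KZ Wt_quot)" by (rule rep_homD(1)[OF Phi_hom True])
    then have "compose (carrier ind_triv) (ind_map KZ Wt_quot \<pi>) Phi f = compose GL2 \<pi> (Phi f)"
      using True by (simp add: compose_def ind_map_def)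
    also have "\<dots> = (\<lambda>y\<in>GL2. b (line_fun f y))"
      using True by (auto simp: compose_def Phi_def fibrewise_apply assms line_fun_line_rep)
    finally show ?thesis using True by (simp add: fibrewise_def)
  qed (simp add: compose_def fibrewise_def)
qed

lemma T_1_2_T_1_0:
  assumes "f \<in> carrier (ind_triv :: ('p::prime_card mod_ring, _, _) rep)"
  shows "T_1_2 (T_1_0 f) = off_diag f"
  using assms rep_homD(1)[OF flip_hom assms] by (simp add: T_1_2_eq T_1_0_eq compose_def flip_flip)

text \<open>\<open>average\<close> is the projection followed by the section, and its value at y is
  again the total of the fibre over y, so neither map loses what the other sees.\<close>

lemma proj_const_eq_zero_iff:
  assumes f: "f \<in> carrier (ind_triv :: ('p::prime_card mod_ring, _, _) rep)"
  shows "proj_const f = \<zero>\<^bsub>ind KZ (Wt 0)\<^esub> \<longleftrightarrow> average f = \<zero>\<^bsub>ind_triv\<^esub>"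
proof -
  interpret I: representation "ind_triv :: ('p mod_ring, _, _) rep" GL2 by (rule representation_ind_triv)
  interpret J: representation "ind KZ (Wt 0) :: ('p mod_ring, _, _) rep" GL2
    by (rule inducible.representation_ind[OF inducible_Wt])
  have c: "average f \<in> carrier ind_triv" "proj_const f \<in> carrier (ind KZ (Wt 0))"
    by (rule rep_homD(1)[OF average_hom f], rule rep_homD(1)[OF proj_const_hom f])
  show ?thesis
  proof
    assume "proj_const f = \<zero>\<^bsub>ind KZ (Wt 0)\<^esub>"
    then show "average f = \<zero>\<^bsub>ind_triv\<^esub>"
      using rep_hom_zero[OF section_fun_rep_hom[OF disjI1[OF refl]] J.representation_axioms I.representation_axioms]
      by (simp add: section_const_proj[OF f, symmetric])
  next
    assume a: "average f = \<zero>\<^bsub>ind_triv\<^esub>"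
    show "proj_const f = \<zero>\<^bsub>ind KZ (Wt 0)\<^esub>"
    proof (rule ind_Wt_eqI[OF c(2) J.zero_closed])
      fix y :: "'p padic ^ 2 ^ 2" assume y: "y \<in> GL2"
      have "line_total (line_fun f y) = 0" using average_apply[OF f y] by (simp add: a ind_triv_apply y)
      then show "proj_const f y = \<zero>\<^bsub>ind KZ (Wt 0)\<^esub> y" using f y by (simp add: fibrewise_apply ind_apply)
    qed
  qed
qed

text \<open>With E = \<open>average\<close>, the product E (E - 1) vanishes because E is idempotent,
  which gives one inclusion.\<close>

lemma image_off_diag:
  "op_image (\<lambda>f. T_1_2 (T_1_0 f)) = {f \<in> carrier (ind_triv :: ('p::prime_card mod_ring, _, _) rep).
     proj_const f = \<zero>\<^bsub>ind KZ (Wt 0)\<^esub>}"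
proof -
  interpret I: representation "ind_triv :: ('p mod_ring, _, _) rep" GL2 by (rule representation_ind_triv)
  have av: "average g \<in> carrier ind_triv" if "g \<in> carrier ind_triv" for g :: "'p padic ^ 2 ^ 2 \<Rightarrow> 'p mod_ring"
    by (rule rep_homD(1)[OF average_hom that])
  have 1: "off_diag g \<in> carrier ind_triv" "average (off_diag g) = \<zero>\<^bsub>ind_triv\<^esub>"
    if g: "g \<in> carrier ind_triv" for g :: "'p padic ^ 2 ^ 2 \<Rightarrow> 'p mod_ring"
  proof -
    show "off_diag g \<in> carrier ind_triv" by (rule rep_homD(1)[OF off_diag_hom g])
    have "average (off_diag g) = average (average g) \<ominus>\<^bsub>ind_triv\<^esub> average g"
      unfolding off_diag_def using g
      by (simp add: rep_hom_minus[OF average_hom I.representation_axioms I.representation_axioms av[OF g] g])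
    then show "average (off_diag g) = \<zero>\<^bsub>ind_triv\<^esub>"
      using av[OF g] by (simp add: average_average[OF g] I.minus_eq I.r_neg)
  qed
  have 2: "\<exists>g\<in>carrier ind_triv. f = off_diag g"
    if f: "f \<in> carrier ind_triv" "average f = \<zero>\<^bsub>ind_triv\<^esub>" for f :: "'p padic ^ 2 ^ 2 \<Rightarrow> 'p mod_ring"
  proof
    \<comment> \<open>For f of average 0, the operator E - 1 acts as -1 on multiples of f, so -f is
      a preimage.\<close>
    let ?g = "(- 1) \<odot>\<^bsub>ind_triv\<^esub> f"
    show g: "?g \<in> carrier ind_triv" using f by simp
    show "f = off_diag ?g"
    proof (rule ind_triv_eqI)
      show "off_diag ?g \<in> carrier ind_triv" by (rule rep_homD(1)[OF off_diag_hom g])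
      fix y :: "'p padic ^ 2 ^ 2" assume y: "y \<in> GL2"
      have "line_total (line_fun ?g y) = average ?g y" using g y by (simp only: average_apply)
      also have "\<dots> = 0" using y f by (simp add: rep_homD(3)[OF average_hom f(1)])
          (simp add: ind_triv_apply)
      finally show "f y = off_diag ?g y" using g y by (simp add: off_diag_apply ind_triv_apply)
    qed (rule f(1))
  qed
  have "off_diag ` carrier ind_triv = {f \<in> carrier (ind_triv :: ('p mod_ring, _, _) rep). average f = \<zero>\<^bsub>ind_triv\<^esub>}"
  proof (intro equalityI subsetI)
    fix f :: "'p padic ^ 2 ^ 2 \<Rightarrow> 'p mod_ring" assume "f \<in> {f \<in> carrier ind_triv. average f = \<zero>\<^bsub>ind_triv\<^esub>}"
    then show "f \<in> off_diag ` carrier ind_triv" using 2[of f] by (simp add: image_iff)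
  qed (use 1 in \<open>elim imageE, simp\<close>)
  also have "\<dots> = {f \<in> carrier ind_triv. proj_const f = \<zero>\<^bsub>ind KZ (Wt 0) :: ('p mod_ring, _, 'p padic ^ 2 ^ 2) rep\<^esub>}"
    by (intro Collect_cong conj_cong refl proj_const_eq_zero_iff[symmetric])
  finally have "off_diag ` carrier ind_triv = {f \<in> carrier ind_triv. proj_const f = \<zero>\<^bsub>ind KZ (Wt 0) :: ('p mod_ring, _, 'p padic ^ 2 ^ 2) rep\<^esub>}" .
  then show ?thesis unfolding op_image_def by (simp add: T_1_2_T_1_0 cong: image_cong)
qed

lemma interpolate_punctured_const: "interpolate (punctured_const c) = (0 :: 'p::prime_card bipoly)"
  by (rule eval2_inj[OF homogeneous2_interpolate homogeneous2_0], intro ext)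
    (simp add: eval2_interpolate[OF punctured_const_line_rep])

text \<open>Averages have constant fibres, whose interpolant is 0. Conversely, applying the section
  to a vanishing projection gives f minus its average equal to 0, so f is its own average.\<close>

lemma image_average:
  "op_image (\<lambda>f. f \<oplus>\<^bsub>ind_triv\<^esub> T_1_2 (T_1_0 f)) = {f \<in> carrier (ind_triv :: ('p::prime_card mod_ring, _, _) rep).
     proj_interp f = \<zero>\<^bsub>ind KZ (Wt (CARD('p) - 1))\<^esub>}"
proof -
  let ?J = "ind KZ (Wt (CARD('p) - 1)) :: ('p mod_ring, _, 'p padic ^ 2 ^ 2) rep"
  interpret I: representation "ind_triv :: ('p mod_ring, _, _) rep" GL2 by (rule representation_ind_triv)
  interpret J: representation ?J GL2 by (rule inducible.representation_ind[OF inducible_Wt])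
  have av: "average g \<in> carrier ind_triv" if "g \<in> carrier ind_triv" for g :: "'p padic ^ 2 ^ 2 \<Rightarrow> 'p mod_ring"
    by (rule rep_homD(1)[OF average_hom that])
  have e: "f \<oplus>\<^bsub>ind_triv\<^esub> off_diag f = average f"
    if f: "f \<in> carrier ind_triv" for f :: "'p padic ^ 2 ^ 2 \<Rightarrow> 'p mod_ring"
  proof (rule ind_triv_eqI)
    show "f \<oplus>\<^bsub>ind_triv\<^esub> off_diag f \<in> carrier ind_triv" using f rep_homD(1)[OF off_diag_hom f] by simp
  qed (use f av in \<open>simp_all add: ind_triv_apply off_diag_apply average_apply\<close>)
  have "proj_interp (average g) = \<zero>\<^bsub>?J\<^esub>" if g: "g \<in> carrier ind_triv" for g :: "'p padic ^ 2 ^ 2 \<Rightarrow> 'p mod_ring"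
  proof (rule ind_Wt_eqI[OF rep_homD(1)[OF proj_interp_hom av[OF g]] J.zero_closed])
    fix y :: "'p padic ^ 2 ^ 2" assume y: "y \<in> GL2"
    then show "proj_interp (average g) y = \<zero>\<^bsub>?J\<^esub> y"
      using av[OF g] g by (simp only: fibrewise_apply line_fun_average interpolate_punctured_const ind_apply Wt_simps)
  qed
  moreover have "f = average f" if f: "f \<in> carrier ind_triv" "proj_interp f = \<zero>\<^bsub>?J\<^esub>"
    for f :: "'p padic ^ 2 ^ 2 \<Rightarrow> 'p mod_ring"
  proof (rule ind_triv_eqI[OF f(1) av[OF f(1)]])
    fix y :: "'p padic ^ 2 ^ 2" assume y: "y \<in> GL2"
    have "f \<ominus>\<^bsub>ind_triv\<^esub> average f = \<zero>\<^bsub>ind_triv\<^esub>"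
      unfolding section_interp_proj[OF f(1), symmetric] f(2)
      by (rule rep_hom_zero[OF section_fun_rep_hom[OF disjI2[OF refl]] J.representation_axioms I.representation_axioms])
    then have "f y - average f y = 0"
      using ind_triv_minus_apply[OF f(1) av[OF f(1)] y] by (simp add: ind_triv_apply y)
    then show "f y = average f y" by simp
  qed
  ultimately have "average ` carrier ind_triv = {f \<in> carrier ind_triv. proj_interp f = \<zero>\<^bsub>?J\<^esub>}"
    using av by (intro equalityI subsetI) (auto simp only: image_iff mem_Collect_eq)
  then show ?thesis unfolding op_image_def by (simp add: T_1_2_T_1_0 e cong: image_cong)
qed

lemma quotient_proj_const:
  "quotient_by_kernel (ind_triv :: ('p::prime_card mod_ring, _, _) rep) (ind KZ (Wt 0)) GL2 proj_const
    (op_image (\<lambda>f. T_1_2 (T_1_0 f)))"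
  by (intro quotient_by_kernel.intro quotient_by_kernel_axioms.intro representation_ind_triv
      inducible.representation_ind[OF inducible_Wt] proj_const_hom image_off_diag)

lemma quotient_proj_interp:
  "quotient_by_kernel (ind_triv :: ('p::prime_card mod_ring, _, _) rep) (ind KZ (Wt (CARD('p) - 1))) GL2 proj_interp
    (op_image (\<lambda>f. f \<oplus>\<^bsub>ind_triv\<^esub> T_1_2 (T_1_0 f)))"
  by (intro quotient_by_kernel.intro quotient_by_kernel_axioms.intro representation_ind_triv
      inducible.representation_ind[OF inducible_Wt] proj_interp_hom image_average)

text \<open>Stability of N comes from the intertwining relation together with T 0 = 0; both halves
  of the claim are needed for each of the two operators.\<close>

lemma quotient_by_kernel_intertwines:
  assumes q: "quotient_by_kernel M Q H \<phi> N" and T: "T \<in> rep_hom H Q Q"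
    and S: "\<And>f. f \<in> carrier M \<Longrightarrow> S f \<in> carrier M" "\<And>f. f \<in> carrier M \<Longrightarrow> \<phi> (S f) = T (\<phi> f)"
  shows "(\<forall>f\<in>N. S f \<in> N) \<and>
    (\<forall>A\<in>carrier (quot_rep M N). induced M N \<phi> (induced_op M N S A) = T (induced M N \<phi> A))"
proof -
  interpret quotient_by_kernel M Q H \<phi> N by (rule q)
  have "T \<zero>\<^bsub>Q\<^esub> = \<zero>\<^bsub>Q\<^esub>" by (rule rep_hom_zero[OF T Q.representation_axioms Q.representation_axioms])
  then have "\<forall>f\<in>N. S f \<in> N" using S N by simp
  then show ?thesis using induced_op_intertwines[of S T, OF S] by blast
qed

theorem theorem3p13:
  fixes N\<^sub>0 N\<^sub>1 :: "('p::prime_card padic ^ 2 ^ 2 \<Rightarrow> 'p mod_ring) set"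
    and S\<^sub>0 S\<^sub>1 :: "('p padic ^ 2 ^ 2 \<Rightarrow> 'p mod_ring) \<Rightarrow> 'p padic ^ 2 ^ 2 \<Rightarrow> 'p mod_ring"
    and v :: "'p padic ^ 2 ^ 2 \<Rightarrow> 'p bipoly set"
  defines "N\<^sub>0 \<equiv> op_image (\<lambda>f. T_1_2 (T_1_0 f))"
    and "N\<^sub>1 \<equiv> op_image (\<lambda>f. f \<oplus>\<^bsub>ind_triv\<^esub> T_1_2 (T_1_0 f))"
    and "S\<^sub>0 \<equiv> (\<lambda>f. T_m1_0 f \<oplus>\<^bsub>ind_triv\<^esub> T_1_0 f)"
    and "S\<^sub>1 \<equiv> T_m1_0"
    and "v \<equiv> ind_elem KZ Wt_quot (mat 1)
           (to_Wt_quot (pY ^ (2 * CARD('p) - 2) - pX ^ (CARD('p) - 1) * pY ^ (CARD('p) - 1)))"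
  shows "(\<exists>!\<Phi>. \<Phi> \<in> rep_hom GL2 ind_triv (ind KZ Wt_quot) \<and> \<Phi> (ind_elem_IZ (mat 1)) = v) \<and>
    (\<forall>\<Phi> \<in> rep_hom GL2 ind_triv (ind KZ Wt_quot). \<Phi> (ind_elem_IZ (mat 1)) = v \<longrightarrow>
      (let \<phi>\<^sub>0 = compose (carrier ind_triv) (ind_map KZ Wt_quot proj_0) \<Phi>;
           \<phi>\<^sub>1 = compose (carrier ind_triv) (ind_map KZ Wt_quot proj_top) \<Phi>
       in
        (\<forall>f\<in>N\<^sub>0. \<phi>\<^sub>0 f = \<zero>\<^bsub>ind KZ (Wt 0)\<^esub>) \<and>
        induced ind_triv N\<^sub>0 \<phi>\<^sub>0 \<in> rep_iso GL2 (quot_rep ind_triv N\<^sub>0) (ind KZ (Wt 0)) \<and>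
        (\<forall>f\<in>N\<^sub>1. \<phi>\<^sub>1 f = \<zero>\<^bsub>ind KZ (Wt (CARD('p) - 1))\<^esub>) \<and>
        induced ind_triv N\<^sub>1 \<phi>\<^sub>1
          \<in> rep_iso GL2 (quot_rep ind_triv N\<^sub>1) (ind KZ (Wt (CARD('p) - 1))) \<and>
        (\<forall>f\<in>N\<^sub>0. S\<^sub>0 f \<in> N\<^sub>0) \<and>
        (\<forall>A\<in>carrier (quot_rep ind_triv N\<^sub>0).
           induced ind_triv N\<^sub>0 \<phi>\<^sub>0 (induced_op ind_triv N\<^sub>0 S\<^sub>0 A)
             = Hecke_T 0 (induced ind_triv N\<^sub>0 \<phi>\<^sub>0 A)) \<and>
        (\<forall>f\<in>N\<^sub>1. S\<^sub>1 f \<in> N\<^sub>1) \<and>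
        (\<forall>A\<in>carrier (quot_rep ind_triv N\<^sub>1).
           induced ind_triv N\<^sub>1 \<phi>\<^sub>1 (induced_op ind_triv N\<^sub>1 S\<^sub>1 A)
             = Hecke_T (CARD('p) - 1) (induced ind_triv N\<^sub>1 \<phi>\<^sub>1 A))))"
proof -
  interpret Q0: quotient_by_kernel "ind_triv :: ('p mod_ring, _, _) rep" "ind KZ (Wt 0)" GL2 proj_const N\<^sub>0
    unfolding N\<^sub>0_def by (rule quotient_proj_const)
  interpret Q1: quotient_by_kernel "ind_triv :: ('p mod_ring, _, _) rep" "ind KZ (Wt (CARD('p) - 1))" GL2 proj_interp N\<^sub>1
    unfolding N\<^sub>1_def by (rule quotient_proj_interp)
  have S0: "S\<^sub>0 = S_const" unfolding S\<^sub>0_def by (simp add: S_const_def fun_eq_iff)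
  have Sc: "S_const f \<in> carrier ind_triv" if "f \<in> carrier ind_triv" for f :: "'p padic ^ 2 ^ 2 \<Rightarrow> 'p mod_ring"
    unfolding S_const_eq[OF that] by (rule rep_homD(1)[OF flip_hom rep_homD(1)[OF average_hom that]])
  have J: "representation (ind KZ Wt_quot :: ('p mod_ring, _, _) rep) GL2"
    by (rule inducible.representation_ind[OF inducible_Wt_quot])
  \<comment> \<open>The claim concerns every equivariant map with the prescribed value on the
    generator; uniqueness allows each of them to be replaced by the explicit
    \<open>Phi\<close>.\<close>
  have unique: "\<Phi> = Phi" if "\<Phi> \<in> rep_hom GL2 ind_triv (ind KZ Wt_quot)" "\<Phi> (ind_elem_IZ (mat 1)) = v" for \<Phi>
    by (rule ind_triv_hom_eqI[OF that(1) Phi_hom J]) (simp only: that(2) Phi_ind_elem v_def)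
  have ex1: "\<exists>!\<Phi>. \<Phi> \<in> rep_hom GL2 ind_triv (ind KZ Wt_quot) \<and> \<Phi> (ind_elem_IZ (mat 1)) = v"
    using Phi_hom Phi_ind_elem unique unfolding v_def by blast
  have c0: "compose (carrier ind_triv) (ind_map KZ Wt_quot proj_0) Phi = (proj_const :: _ \<Rightarrow> 'p padic ^ 2 ^ 2 \<Rightarrow> 'p bipoly)"
    by (rule compose_proj_Phi) (rule proj_0_class)
  have c1: "compose (carrier ind_triv) (ind_map KZ Wt_quot proj_top) Phi = (proj_interp :: _ \<Rightarrow> 'p padic ^ 2 ^ 2 \<Rightarrow> 'p bipoly)"
    by (rule compose_proj_Phi) (rule proj_top_class)
  have k0: "\<forall>f\<in>N\<^sub>0. proj_const f = \<zero>\<^bsub>ind KZ (Wt 0)\<^esub>" using Q0.N by simp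
  have k1: "\<forall>f\<in>N\<^sub>1. proj_interp f = \<zero>\<^bsub>ind KZ (Wt (CARD('p) - 1))\<^esub>" using Q1.N by simp
  have i0: "induced ind_triv N\<^sub>0 proj_const \<in> rep_iso GL2 (quot_rep ind_triv N\<^sub>0) (ind KZ (Wt 0))"
  proof (rule Q0.induced_rep_iso)
    fix F :: "'p padic ^ 2 ^ 2 \<Rightarrow> 'p bipoly" assume F: "F \<in> carrier (ind KZ (Wt 0))"
    then show "\<exists>f\<in>carrier ind_triv. proj_const f = F"
      using proj_const_section[OF F] rep_homD(1)[OF section_fun_rep_hom[OF disjI1[OF refl]] F] by blast
  qed
  have i1: "induced ind_triv N\<^sub>1 proj_interp \<in> rep_iso GL2 (quot_rep ind_triv N\<^sub>1) (ind KZ (Wt (CARD('p) - 1)))"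
  proof (rule Q1.induced_rep_iso)
    fix F :: "'p padic ^ 2 ^ 2 \<Rightarrow> 'p bipoly" assume F: "F \<in> carrier (ind KZ (Wt (CARD('p) - 1)))"
    then show "\<exists>f\<in>carrier ind_triv. proj_interp f = F"
      using proj_interp_section[OF F] rep_homD(1)[OF section_fun_rep_hom[OF disjI2[OF refl]] F] by blast
  qed
  have t0: "(\<forall>f\<in>N\<^sub>0. S\<^sub>0 f \<in> N\<^sub>0) \<and> (\<forall>A\<in>carrier (quot_rep ind_triv N\<^sub>0).
      induced ind_triv N\<^sub>0 proj_const (induced_op ind_triv N\<^sub>0 S\<^sub>0 A) = Hecke_T 0 (induced ind_triv N\<^sub>0 proj_const A))"
    unfolding S0 Hecke_T_0
    by (rule quotient_by_kernel_intertwines[OF Q0.quotient_by_kernel_axioms hecke_const_hom])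
      (erule Sc hecke_const_intertwines)+
  have t1: "(\<forall>f\<in>N\<^sub>1. S\<^sub>1 f \<in> N\<^sub>1) \<and> (\<forall>A\<in>carrier (quot_rep ind_triv N\<^sub>1).
      induced ind_triv N\<^sub>1 proj_interp (induced_op ind_triv N\<^sub>1 S\<^sub>1 A)
        = Hecke_T (CARD('p) - 1) (induced ind_triv N\<^sub>1 proj_interp A))"
    unfolding S\<^sub>1_def Hecke_T_top
    by (rule quotient_by_kernel_intertwines[OF Q1.quotient_by_kernel_axioms hecke_interp_hom])
      (erule rep_homD(1)[OF T_m1_0_hom] hecke_interp_intertwines)+
  show ?thesis
    unfolding Let_def
    by (rule conjI[OF ex1], intro ballI impI, drule (1) unique, simp only: c0 c1)
      (intro conjI k0 i0 k1 i1 conjunct1[OF t0] conjunct2[OF t0] conjunct1[OF t1] conjunct2[OF t1])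
qed

end
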